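(* Let $(M,\eta,g,\phi)$ be a regular closed non-Sasakian $(\kappa,\mu)$-manifold with $|I_M|>1$. There is a unique $K$-contact structure $(M,\eta,\bar g,\bar\phi)$ such that the two distributions $\mathscr D_h(\lambda)$, $\mathscr D_h(-\lambda)$ of the bi-Legendrian structure determined by the eigenspaces of $h=\frac12\mathcal L_\xi\phi$ are orthogonal with respect to $\bar g$. This unique structure coincides with the canonical Sasakian structure associated with the $(\kappa,\mu)$-manifold $(M,\eta,g,\phi)$.
   Context: A contact metric manifold $(M^{2n+1},\eta,g,\phi)$ consists of a contact form $\eta$ with Reeb field $\xi$ ($\eta(\xi)=1$, $d\eta(\xi,\cdot)=0$), a Riemannian metric $g$ and a $(1,1)$-tensor field $\phi$ with $\eta=i_\xi g$, $\phi^2=-I+\eta\otimes\xi$, $d\eta(X,Y)=g(X,\phi Y)$. It is $K$-contact if $\mathcal L_\xi g=0$, and Sasakian if the almost complex structure $J(X,f\partial_t)=(\phi X-f\xi,\eta(X)\partial_t)$ on $M\times\mathbb R$ is integrable. It is a $(\kappa,\mu)$-manifold ($\kappa,\mu\in\mathbb R$ constants) if, with $h=\frac12\mathcal L_\xi\phi$, $R(X,Y)\xi=\kappa(\eta(Y)X-\eta(X)Y)+\mu(\eta(Y)hX-\eta(X)hY)$; it is Sasakian iff $\kappa=1$, and non-Sasakian means $\kappa<1$. In that case $h$ is $g$-symmetric, $h^2=-(1-\kappa)\phi^2$ (the convention for $d\eta$ is the standard one in contact metric geometry, with the factor $\frac12$, for which this holds), and $h$ has eigenvalues $0,\lambda,-\lambda$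 with $\lambda=\sqrt{1-\kappa}$. The eigendistributions $\mathscr D_h(\lambda),\mathscr D_h(-\lambda)$ are complementary Legendrian distributions (rank $n$, $d\eta$ vanishing on each) in $\mathrm{Ker}(\eta)$. The Boeckx index is $I_M=\dfrac{1-\mu/2}{\sqrt{1-\kappa}}$. Regular means that $\xi$ is a regular vector field (around each point there is a flow box pierced at most once by any integral curve); $\eta$ is taken so that the flow of $\xi$ generates a free $\mathbb S^1$-action, giving the Boothby-Wang principal $\mathbb S^1$-bundle $\pi:M\to B$ over a symplectic manifold $(B,\omega)$ with $\pi^*\omega=d\eta$. When $|I_M|>1$, the canonical Sasakian structure $(\eta,\bar g,\bar\phi)$ associated with the $(\kappa,\mu)$-manifold is given by $$\bar g(X,Y)=\frac{|I_M|}{\sqrt{I_M^2-1}}\left(g(X,Y)+g\Big(X,\tfrac{h}{1-\mu/2}Y\Big)\right)\ \text{ for }X,Y\in\mathrm{Ker}(\eta),\qquad \bar g(\xi,\cdot)=\eta,$$ with $\bar\phi$ determined by $d\eta(X,Y)=\bar g(X,\bar\phi Y)$ and $\bar\phi\xi=0$. *)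

theory Defs
  imports
    "HOL-Analysis.Analysis"
    "HOL-Combinatorics.Permutations"
    "HOL-Library.Function_Algebras"
begin

section \<open>Smooth manifolds\<close>

text \<open>
  A manifold is the whole of a second countable Hausdorff type together with a smooth atlas modelled
  on a Euclidean space. Smoothness is \<open>C\<^sup>\<infinity>\<close>.
\<close>

primrec C_k_on :: "nat \<Rightarrow> 'e::euclidean_space set \<Rightarrow> ('e \<Rightarrow> 'b::real_normed_vector) \<Rightarrow> bool" where
  "C_k_on 0 S f \<longleftrightarrow> continuous_on S f"
| "C_k_on (Suc k) S f \<longleftrightarrow>
     (\<forall>x\<in>S. f differentiable (at x)) \<and> (\<forall>v. C_k_on k S (\<lambda>x. frechet_derivative f (at x) v))"

text \<open>Only meaningful on open sets, as the derivatives are two-sided.\<close>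

definition smooth_on :: "'e::euclidean_space set \<Rightarrow> ('e \<Rightarrow> 'b::real_normed_vector) \<Rightarrow> bool" where
  "smooth_on S f \<longleftrightarrow> (\<forall>k. C_k_on k S f)"

type_synonym ('a, 'e) chart = "'a set \<times> ('a \<Rightarrow> 'e)"
type_synonym ('a, 'e) atlas = "('a, 'e) chart set"

definition is_chart :: "('a::topological_space, 'e::euclidean_space) chart \<Rightarrow> bool" where
  "is_chart = (\<lambda>(U, c). open U \<and> open (c ` U) \<and> homeomorphism U (c ` U) c (inv_into U c))"

definition smoothly_compatible ::
    "('a, 'e::euclidean_space) chart \<Rightarrow> ('a, 'e) chart \<Rightarrow> bool" where
  "smoothly_compatible = (\<lambda>(U, c) (V, d).
     smooth_on (c ` (U \<inter> V)) (d \<circ> inv_into U c) \<and> smooth_on (d ` (U \<inter> V)) (c \<circ> inv_into V d))"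

definition smooth_manifold ::
    "('a::{t2_space,second_countable_topology}, 'e::euclidean_space) atlas \<Rightarrow> bool" where
  "smooth_manifold A \<longleftrightarrow>
     (\<forall>C\<in>A. is_chart C) \<and> (\<Union>(fst ` A)) = UNIV \<and> (\<forall>C\<in>A. \<forall>D\<in>A. smoothly_compatible C D)"

definition closed_manifold ::
    "('a::{t2_space,second_countable_topology}, 'e::euclidean_space) atlas \<Rightarrow> bool" where
  "closed_manifold A \<longleftrightarrow> smooth_manifold A \<and> compact (UNIV :: 'a set)"

definition smooth_charts ::
    "('a::topological_space, 'e::euclidean_space) atlas \<Rightarrow> ('a, 'e) chart set" where
  "smooth_charts A = {C. is_chart C \<and> (\<forall>D\<in>A. smoothly_compatible C D)}"

definition smooth_functions :: "('a, 'e::euclidean_space) atlas \<Rightarrow> ('a \<Rightarrow> real) set" where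
  "smooth_functions A = {f. \<forall>(U, c)\<in>A. smooth_on (c ` U) (f \<circ> inv_into U c)}"


section \<open>Vector fields\<close>

text \<open>
  Tangent vectors at \<open>p\<close> are the derivations at \<open>p\<close> of the algebra of smooth functions. They are made
  to vanish on functions that are not smooth, so that equality of tangent vectors and of vector
  fields is equality in HOL. Addition, subtraction and zero are the pointwise ones.
\<close>

type_synonym 'a tangent_vector = "('a \<Rightarrow> real) \<Rightarrow> real"
type_synonym 'a vfield = "'a \<Rightarrow> 'a tangent_vector"

definition tangent_space ::
    "('a, 'e::euclidean_space) atlas \<Rightarrow> 'a \<Rightarrow> 'a tangent_vector set" where
  "tangent_space A p = {v.
     (\<forall>f\<in>smooth_functions A. \<forall>g\<in>smooth_functions A. v (f + g) = v f + v g) \<and>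
     (\<forall>r. \<forall>f\<in>smooth_functions A. v (\<lambda>q. r * f q) = r * v f) \<and>
     (\<forall>f\<in>smooth_functions A. \<forall>g\<in>smooth_functions A. v (f * g) = v f * g p + f p * v g) \<and>
     (\<forall>f. f \<notin> smooth_functions A \<longrightarrow> v f = 0)}"

definition vector_fields :: "('a, 'e::euclidean_space) atlas \<Rightarrow> 'a vfield set" where
  "vector_fields A = {X. (\<forall>p. X p \<in> tangent_space A p) \<and>
     (\<forall>f\<in>smooth_functions A. (\<lambda>p. X p f) \<in> smooth_functions A)}"

definition deriv_along :: "'a vfield \<Rightarrow> ('a \<Rightarrow> real) \<Rightarrow> 'a \<Rightarrow> real" where
  "deriv_along X f = (\<lambda>p. X p f)"

definition fmul :: "('a \<Rightarrow> real) \<Rightarrow> 'a vfield \<Rightarrow> 'a vfield"  (infixr "\<cdot>" 75) where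
  "f \<cdot> X = (\<lambda>p u. f p * X p u)"

definition cmul :: "real \<Rightarrow> 'a vfield \<Rightarrow> 'a vfield"  (infixr "\<cdot>\<^sub>\<real>" 75) where
  "r \<cdot>\<^sub>\<real> X = (\<lambda>_. r) \<cdot> X"

definition bracket :: "'a vfield \<Rightarrow> 'a vfield \<Rightarrow> 'a vfield" where
  "bracket X Y = (\<lambda>p f. X p (deriv_along Y f) - Y p (deriv_along X f))"

definition integral_curve ::
    "('a::topological_space, 'e::euclidean_space) atlas \<Rightarrow> 'a vfield \<Rightarrow> real set \<Rightarrow> (real \<Rightarrow> 'a) \<Rightarrow> bool"
  where
  "integral_curve A X J \<gamma> \<longleftrightarrow> open J \<and> is_interval J \<and> continuous_on J \<gamma> \<and>
     (\<forall>t\<in>J. \<forall>f\<in>smooth_functions A. ((\<lambda>s. f (\<gamma> s)) has_real_derivative X (\<gamma> t) f) (at t))"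


section \<open>Tensor fields\<close>

text \<open>
  Tensor fields are \<open>C\<^sup>\<infinity>(M)\<close>-multilinear maps on the module of vector fields. Their values matter
  on smooth vector fields only.
\<close>

type_synonym 'a form1 = "'a vfield \<Rightarrow> 'a \<Rightarrow> real"
type_synonym 'a form2 = "'a vfield \<Rightarrow> 'a vfield \<Rightarrow> 'a \<Rightarrow> real"
type_synonym 'a endo = "'a vfield \<Rightarrow> 'a vfield"

definition one_form :: "('a, 'e::euclidean_space) atlas \<Rightarrow> 'a form1 \<Rightarrow> bool" where
  "one_form A \<eta> \<longleftrightarrow>
     (\<forall>X\<in>vector_fields A. \<eta> X \<in> smooth_functions A) \<and>
     (\<forall>X\<in>vector_fields A. \<forall>Y\<in>vector_fields A. \<eta> (X + Y) = \<eta> X + \<eta> Y) \<and>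
     (\<forall>f\<in>smooth_functions A. \<forall>X\<in>vector_fields A. \<eta> (f \<cdot> X) = f * \<eta> X)"

definition endo_field :: "('a, 'e::euclidean_space) atlas \<Rightarrow> 'a endo \<Rightarrow> bool" where
  "endo_field A \<phi> \<longleftrightarrow>
     (\<forall>X\<in>vector_fields A. \<phi> X \<in> vector_fields A) \<and>
     (\<forall>X\<in>vector_fields A. \<forall>Y\<in>vector_fields A. \<phi> (X + Y) = \<phi> X + \<phi> Y) \<and>
     (\<forall>f\<in>smooth_functions A. \<forall>X\<in>vector_fields A. \<phi> (f \<cdot> X) = f \<cdot> \<phi> X)"

definition riemannian_metric :: "('a, 'e::euclidean_space) atlas \<Rightarrow> 'a form2 \<Rightarrow> bool" where
  "riemannian_metric A g \<longleftrightarrow>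
     (\<forall>X\<in>vector_fields A. one_form A (g X)) \<and>
     (\<forall>X\<in>vector_fields A. \<forall>Y\<in>vector_fields A. g X Y = g Y X) \<and>
     (\<forall>X\<in>vector_fields A. \<forall>p. g X X p \<ge> 0 \<and> (g X X p = 0 \<longleftrightarrow> X p = 0))"

text \<open>The exterior derivative of a 1-form, with the factor 1/2 used in contact metric geometry.\<close>

definition ext_deriv :: "'a form1 \<Rightarrow> 'a form2" where
  "ext_deriv \<eta> X Y =
     (\<lambda>p. (deriv_along X (\<eta> Y) p - deriv_along Y (\<eta> X) p - \<eta> (bracket X Y) p) / 2)"

definition lie_deriv_metric :: "'a vfield \<Rightarrow> 'a form2 \<Rightarrow> 'a form2" where
  "lie_deriv_metric Z g X Y = deriv_along Z (g X Y) - g (bracket Z X) Y - g X (bracket Z Y)"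

definition lie_deriv_endo :: "'a vfield \<Rightarrow> 'a endo \<Rightarrow> 'a endo" where
  "lie_deriv_endo Z \<phi> X = bracket Z (\<phi> X) - \<phi> (bracket Z X)"


section \<open>Levi-Civita connection and curvature\<close>

definition levi_civita ::
    "('a, 'e::euclidean_space) atlas \<Rightarrow> 'a form2 \<Rightarrow> ('a vfield \<Rightarrow> 'a vfield \<Rightarrow> 'a vfield) \<Rightarrow> bool" where
  "levi_civita A g nabla \<longleftrightarrow>
     (\<forall>X\<in>vector_fields A. \<forall>Y\<in>vector_fields A. nabla X Y \<in> vector_fields A) \<and>
     (\<forall>X\<in>vector_fields A. \<forall>Y\<in>vector_fields A. \<forall>Z\<in>vector_fields A.
        nabla (X + Y) Z = nabla X Z + nabla Y Z \<and> nabla X (Y + Z) = nabla X Y + nabla X Z) \<and>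
     (\<forall>f\<in>smooth_functions A. \<forall>X\<in>vector_fields A. \<forall>Y\<in>vector_fields A.
        nabla (f \<cdot> X) Y = f \<cdot> nabla X Y \<and> nabla X (f \<cdot> Y) = deriv_along X f \<cdot> Y + f \<cdot> nabla X Y) \<and>
     (\<forall>X\<in>vector_fields A. \<forall>Y\<in>vector_fields A. nabla X Y - nabla Y X = bracket X Y) \<and>
     (\<forall>X\<in>vector_fields A. \<forall>Y\<in>vector_fields A. \<forall>Z\<in>vector_fields A.
        deriv_along X (g Y Z) = g (nabla X Y) Z + g Y (nabla X Z))"

definition curvature ::
    "('a vfield \<Rightarrow> 'a vfield \<Rightarrow> 'a vfield) \<Rightarrow> 'a vfield \<Rightarrow> 'a vfield \<Rightarrow> 'a vfield \<Rightarrow> 'a vfield" where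
  "curvature nabla X Y Z = nabla X (nabla Y Z) - nabla Y (nabla X Z) - nabla (bracket X Y) Z"


section \<open>Contact metric structures\<close>

text \<open>
  The sum is a positive multiple of \<open>(\<eta> \<and> (d\<eta>)\<^sup>n)(X\<^sub>0, \<dots>, X\<^sub>2\<^sub>n)\<close>, where the dimension is \<open>2n + 1\<close>.
\<close>

definition contact_form :: "('a, 'e::euclidean_space) atlas \<Rightarrow> 'a form1 \<Rightarrow> bool" where
  "contact_form A \<eta> \<longleftrightarrow> one_form A \<eta> \<and>
     (\<exists>n. DIM('e) = 2 * n + 1 \<and>
       (\<forall>p. \<exists>X :: nat \<Rightarrow> 'a vfield. (\<forall>i. X i \<in> vector_fields A) \<and>
         (\<Sum>\<sigma> | \<sigma> permutes {..<2 * n + 1}. of_int (sign \<sigma>) * \<eta> (X (\<sigma> 0)) p *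
            (\<Prod>i<n. ext_deriv \<eta> (X (\<sigma> (2 * i + 1))) (X (\<sigma> (2 * i + 2))) p)) \<noteq> 0))"

definition reeb_field :: "('a, 'e::euclidean_space) atlas \<Rightarrow> 'a form1 \<Rightarrow> 'a vfield \<Rightarrow> bool" where
  "reeb_field A \<eta> \<xi> \<longleftrightarrow> \<xi> \<in> vector_fields A \<and> \<eta> \<xi> = (\<lambda>_. 1) \<and>
     (\<forall>X\<in>vector_fields A. ext_deriv \<eta> \<xi> X = (\<lambda>_. 0))"

definition contact_metric ::
    "('a, 'e::euclidean_space) atlas \<Rightarrow> 'a form1 \<Rightarrow> 'a vfield \<Rightarrow> 'a form2 \<Rightarrow> 'a endo \<Rightarrow> bool" where
  "contact_metric A \<eta> \<xi> g \<phi> \<longleftrightarrow>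
     contact_form A \<eta> \<and> reeb_field A \<eta> \<xi> \<and> riemannian_metric A g \<and> endo_field A \<phi> \<and>
     (\<forall>X\<in>vector_fields A. \<eta> X = g \<xi> X) \<and>
     (\<forall>X\<in>vector_fields A. \<phi> (\<phi> X) = \<eta> X \<cdot> \<xi> - X) \<and>
     (\<forall>X\<in>vector_fields A. \<forall>Y\<in>vector_fields A. ext_deriv \<eta> X Y = g X (\<phi> Y))"

definition K_contact ::
    "('a, 'e::euclidean_space) atlas \<Rightarrow> 'a form1 \<Rightarrow> 'a vfield \<Rightarrow> 'a form2 \<Rightarrow> 'a endo \<Rightarrow> bool" where
  "K_contact A \<eta> \<xi> g \<phi> \<longleftrightarrow> contact_metric A \<eta> \<xi> g \<phi> \<and>
     (\<forall>X\<in>vector_fields A. \<forall>Y\<in>vector_fields A. lie_deriv_metric \<xi> g X Y = (\<lambda>_. 0))"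


subsection \<open>Sasakian structures\<close>

definition times_line_atlas :: "('a, 'e) atlas \<Rightarrow> ('a \<times> real, 'e \<times> real) atlas" where
  "times_line_atlas A = (\<lambda>(U, c). (U \<times> UNIV, \<lambda>(p, t). (c p, t))) ` A"

text \<open>
  A vector field on \<open>M \<times> \<real>\<close> is a pair \<open>(X, a \<partial>\<^sub>t)\<close>, with \<open>X\<close> a family of vector fields on \<open>M\<close> depending
  on \<open>t\<close> and \<open>a\<close> a function on \<open>M \<times> \<real>\<close>.
\<close>

definition field_pair ::
    "('a, 'e::euclidean_space) atlas \<Rightarrow> (real \<Rightarrow> 'a vfield) \<Rightarrow> ('a \<times> real \<Rightarrow> real) \<Rightarrow> ('a \<times> real) vfield"
  where
  "field_pair A X a = (\<lambda>(p, t) F.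
     if F \<in> smooth_functions (times_line_atlas A)
     then X t p (\<lambda>q. F (q, t)) + a (p, t) * deriv (\<lambda>s. F (p, s)) t
     else 0)"

definition M_part :: "('a \<times> real) vfield \<Rightarrow> real \<Rightarrow> 'a vfield" where
  "M_part Z t = (\<lambda>p f. Z (p, t) (f \<circ> fst))"

definition line_part :: "('a \<times> real) vfield \<Rightarrow> 'a \<times> real \<Rightarrow> real" where
  "line_part Z = deriv_along Z snd"

text \<open>\<open>J(X, a \<partial>\<^sub>t) = (\<phi> X - a \<xi>, \<eta>(X) \<partial>\<^sub>t)\<close>\<close>

definition cone_J ::
    "('a, 'e::euclidean_space) atlas \<Rightarrow> 'a form1 \<Rightarrow> 'a vfield \<Rightarrow> 'a endo \<Rightarrow> ('a \<times> real) endo" where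
  "cone_J A \<eta> \<xi> \<phi> Z = field_pair A
     (\<lambda>t. \<phi> (M_part Z t) - (\<lambda>p. line_part Z (p, t)) \<cdot> \<xi>)
     (\<lambda>(p, t). \<eta> (M_part Z t) p)"

text \<open>Integrability of an almost complex structure is the vanishing of its Nijenhuis tensor.\<close>

definition integrable_acs :: "('a, 'e::euclidean_space) atlas \<Rightarrow> 'a endo \<Rightarrow> bool" where
  "integrable_acs A J \<longleftrightarrow> (\<forall>X\<in>vector_fields A. \<forall>Y\<in>vector_fields A.
     bracket (J X) (J Y) - J (bracket (J X) Y) - J (bracket X (J Y)) + J (J (bracket X Y)) = 0)"

definition sasakian ::
    "('a, 'e::euclidean_space) atlas \<Rightarrow> 'a form1 \<Rightarrow> 'a vfield \<Rightarrow> 'a form2 \<Rightarrow> 'a endo \<Rightarrow> bool" where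
  "sasakian A \<eta> \<xi> g \<phi> \<longleftrightarrow> contact_metric A \<eta> \<xi> g \<phi> \<and>
     integrable_acs (times_line_atlas A) (cone_J A \<eta> \<xi> \<phi>)"


subsection \<open>\<open>(\<kappa>,\<mu>)\<close>-manifolds\<close>

definition h_tensor :: "'a vfield \<Rightarrow> 'a endo \<Rightarrow> 'a endo" where
  "h_tensor \<xi> \<phi> X = (1/2) \<cdot>\<^sub>\<real> lie_deriv_endo \<xi> \<phi> X"

text \<open>The Levi-Civita connection exists and is unique, so the quantifier merely names it.\<close>

definition kappa_mu_manifold ::
    "('a, 'e::euclidean_space) atlas \<Rightarrow> 'a form1 \<Rightarrow> 'a vfield \<Rightarrow> 'a form2 \<Rightarrow> 'a endo \<Rightarrow>
     real \<Rightarrow> real \<Rightarrow> bool" where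
  "kappa_mu_manifold A \<eta> \<xi> g \<phi> \<kappa> \<mu> \<longleftrightarrow> contact_metric A \<eta> \<xi> g \<phi> \<and>
     (\<exists>nabla. levi_civita A g nabla \<and>
       (\<forall>X\<in>vector_fields A. \<forall>Y\<in>vector_fields A.
          curvature nabla X Y \<xi> =
            \<kappa> \<cdot>\<^sub>\<real> (\<eta> Y \<cdot> X - \<eta> X \<cdot> Y) +
            \<mu> \<cdot>\<^sub>\<real> (\<eta> Y \<cdot> h_tensor \<xi> \<phi> X - \<eta> X \<cdot> h_tensor \<xi> \<phi> Y)))"

definition boeckx_index :: "real \<Rightarrow> real \<Rightarrow> real" where
  "boeckx_index \<kappa> \<mu> = (1 - \<mu> / 2) / sqrt (1 - \<kappa>)"

definition eigen_distribution ::
    "('a, 'e::euclidean_space) atlas \<Rightarrow> 'a endo \<Rightarrow> real \<Rightarrow> 'a \<Rightarrow> 'a tangent_vector set" where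
  "eigen_distribution A h r p = {X p | X. X \<in> vector_fields A \<and> h X p = (r \<cdot>\<^sub>\<real> X) p}"

definition orthogonal_distributions ::
    "('a, 'e::euclidean_space) atlas \<Rightarrow> 'a form2 \<Rightarrow> ('a \<Rightarrow> 'a tangent_vector set) \<Rightarrow>
     ('a \<Rightarrow> 'a tangent_vector set) \<Rightarrow> bool" where
  "orthogonal_distributions A g D E \<longleftrightarrow>
     (\<forall>p. \<forall>X\<in>vector_fields A. \<forall>Y\<in>vector_fields A. X p \<in> D p \<longrightarrow> Y p \<in> E p \<longrightarrow> g X Y p = 0)"

text \<open>
  The formula for \<open>gbar\<close> on the kernel of \<open>\<eta>\<close> and the equation \<open>gbar(\<xi>, X) = \<eta>(X)\<close> determine \<open>gbar\<close>, since
  every vector field \<open>Z\<close> is \<open>X + \<eta>(Z) \<xi>\<close> with \<open>\<eta>(X) = 0\<close>; then \<open>phibar\<close> is determined by the last lines.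
\<close>

definition canonical_sasakian_structure ::
    "('a, 'e::euclidean_space) atlas \<Rightarrow> 'a form1 \<Rightarrow> 'a vfield \<Rightarrow> 'a form2 \<Rightarrow> 'a endo \<Rightarrow>
     real \<Rightarrow> real \<Rightarrow> 'a form2 \<Rightarrow> 'a endo \<Rightarrow> bool" where
  "canonical_sasakian_structure A \<eta> \<xi> g \<phi> \<kappa> \<mu> gbar phibar \<longleftrightarrow>
     (let I = boeckx_index \<kappa> \<mu> in
       riemannian_metric A gbar \<and>
       (\<forall>X\<in>vector_fields A. \<forall>Y\<in>vector_fields A. \<eta> X = (\<lambda>_. 0) \<longrightarrow> \<eta> Y = (\<lambda>_. 0) \<longrightarrow>
          gbar X Y = (\<lambda>p. \<bar>I\<bar> / sqrt (I\<^sup>2 - 1) *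
            (g X Y p + g X ((1 / (1 - \<mu> / 2)) \<cdot>\<^sub>\<real> h_tensor \<xi> \<phi> Y) p))) \<and>
       (\<forall>X\<in>vector_fields A. gbar \<xi> X = \<eta> X) \<and>
       endo_field A phibar \<and>
       (\<forall>X\<in>vector_fields A. \<forall>Y\<in>vector_fields A. ext_deriv \<eta> X Y = gbar X (phibar Y)) \<and>
       phibar \<xi> = 0)"


section \<open>Regularity\<close>

text \<open>
  A flow box of \<open>X\<close> is a chart onto an open cube in which \<open>X\<close> is the coordinate field of direction
  \<open>b\<close>. An integral curve pierces it at most once if all its points in the box lie on one and the same
  segment of direction \<open>b\<close> (a closed orbit runs through this segment repeatedly).
\<close>

definition flow_box ::
    "('a::topological_space, 'e::euclidean_space) atlas \<Rightarrow> 'a vfield \<Rightarrow> ('a, 'e) chart \<Rightarrow> 'e \<Rightarrow> bool" where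
  "flow_box A X = (\<lambda>(U, c) b. (U, c) \<in> smooth_charts A \<and> b \<in> Basis \<and>
     (\<exists>a r. r > 0 \<and> c ` U = box (a - r *\<^sub>R One) (a + r *\<^sub>R One)) \<and>
     (\<forall>q\<in>U. \<forall>f\<in>smooth_functions A.
        X q f = frechet_derivative (f \<circ> inv_into U c) (at (c q)) b))"

definition regular_field ::
    "('a::topological_space, 'e::euclidean_space) atlas \<Rightarrow> 'a vfield \<Rightarrow> bool" where
  "regular_field A X \<longleftrightarrow> (\<forall>p. \<exists>U c b. p \<in> U \<and> flow_box A X (U, c) b \<and>
     (\<forall>J \<gamma>. integral_curve A X J \<gamma> \<longrightarrow>
        (\<forall>s\<in>J. \<forall>t\<in>J. \<gamma> s \<in> U \<longrightarrow> \<gamma> t \<in> U \<longrightarrow> (\<exists>r. c (\<gamma> t) - c (\<gamma> s) = r *\<^sub>R b))))"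

text \<open>The flow descends to a free action of \<open>S\<^sup>1 = \<real> / T\<int>\<close>; the length \<open>T\<close> of the circle is arbitrary.\<close>

definition generates_free_circle_action ::
    "('a::topological_space, 'e::euclidean_space) atlas \<Rightarrow> 'a vfield \<Rightarrow> bool" where
  "generates_free_circle_action A X \<longleftrightarrow> (\<exists>\<Phi> :: real \<Rightarrow> 'a \<Rightarrow> 'a. \<exists>T > 0.
     (\<forall>p. \<Phi> 0 p = p \<and> integral_curve A X UNIV (\<lambda>t. \<Phi> t p)) \<and>
     (\<forall>s t p. \<Phi> (s + t) p = \<Phi> s (\<Phi> t p)) \<and>
     (\<forall>t p. \<Phi> t p = p \<longleftrightarrow> (\<exists>k::int. t = of_int k * T)))"

definition regular_contact ::
    "('a::topological_space, 'e::euclidean_space) atlas \<Rightarrow> 'a vfield \<Rightarrow> bool" where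
  "regular_contact A \<xi> \<longleftrightarrow> regular_field A \<xi> \<and> generates_free_circle_action A \<xi>"

end

(*
  With A X = nabla_X xi = - phi X - phi h X, the curvature condition in the direction of xi gives
  h^2 = (kappa - 1) phi^2 and L_xi h = (2 - mu) phi h + 2 (1 - kappa) phi, which yields L_xi phibar = 0 for
  phibar = c (phi + phi h / (1 - mu/2)).

  Uniqueness: a competing phi' exchanges the two Legendrian eigendistributions, hence anticommutes with h.
  Applying L_xi to this identity determines the square of psi = phi' phi on D(lam) and on D(-lam), where it is
  a positive constant. As - psi is positive definite for the competing metric, psi itself is determined.

  The structure is Sasakian: on Ker eta the curvature condition and d(d eta) = 0 form a linear system for the
  second fundamental forms of the eigendistributions that has only the zero solution. So the
  eigendistributions are integrable and totally geodesic, the Nijenhuis torsion of phibar vanishes on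
  D(lam), and hence everywhere, as phibar D(lam) = D(-lam). The Nijenhuis tensor of J on M x R is then computed on
  fields that do not depend on t, which span by means of a finite global frame of the compact manifold M.
*)
theory Submission
  imports Defs
begin

section \<open>Calculus of smooth functions\<close>

text \<open>On D(r), where r is lam or - lam, phibar is sc r = c (1 + r / al) times phi, with al = 1
  - mu/2. The coefficient 1 / al is the one for which the contributions of phi and of phi h to L_xi
  phibar cancel. Then c is forced by phibar^2 = - I on Ker eta, that is by sc lam * sc (- lam) = 1.
  And |I_M| > 1 means lam < |al|, which makes both scales positive and gbar definite.

  The obstacle is the passage to M x R. Tangent vectors are derivations of the algebra of global
  functions, so a field on M x R does not come with components in a chart. Even the lift of a smooth
  field X of M is not obviously smooth: p -> X_p F(., t) is smooth for each t, but joint smoothness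
  in (p, t) has to be shown. Both problems are solved by a finite list of pairs (x, E) with v f =
  SUM v(x) E f for all tangent vectors v. In a chart it comes from Hadamard's lemma multiplied by
  bump functions, which keeps every factor defined on all of M; compactness makes the list
  finite.\<close>

lemma has_derivative_cong_open:
  assumes "open S" "x \<in> S" "\<And>y. y \<in> S \<Longrightarrow> f y = g y"
  shows "(f has_derivative D) (at x) \<longleftrightarrow> (g has_derivative D) (at x)"
  using has_derivative_transform_within_open[OF _ assms(1,2), of f D UNIV g]
    has_derivative_transform_within_open[OF _ assms(1,2), of g D UNIV f] assms(3) by auto

lemma C_k_on_cong:
  assumes "open S" "\<And>x. x \<in> S \<Longrightarrow> f x = g x"
  shows "C_k_on k S f \<longleftrightarrow> C_k_on k S g"
  using assms(2)
proof (induction k arbitrary: f g)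
  case 0
  then show ?case by (simp cong: continuous_on_cong)
next
  case (Suc k)
  have *: "(f has_derivative D) (at x) \<longleftrightarrow> (g has_derivative D) (at x)" if "x \<in> S" for x D
    using has_derivative_cong_open[OF assms(1) that] Suc.prems by blast
  have "frechet_derivative f (at x) = frechet_derivative g (at x)" if "x \<in> S" for x
    unfolding frechet_derivative_def using * that by simp
  then have "C_k_on k S (\<lambda>x. frechet_derivative f (at x) v) \<longleftrightarrow>
      C_k_on k S (\<lambda>x. frechet_derivative g (at x) v)" for v
    by (intro Suc.IH) simp
  moreover have "f differentiable (at x) \<longleftrightarrow> g differentiable (at x)" if "x \<in> S" for x
    using * that by (simp add: differentiable_def)
  ultimately show ?case by simp
qed

lemma smooth_on_cong:
  assumes "open S" "\<And>x. x \<in> S \<Longrightarrow> f x = g x"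
  shows "smooth_on S f \<longleftrightarrow> smooth_on S g"
  unfolding smooth_on_def by (intro all_cong1 C_k_on_cong assms)

lemma C_k_on_subset: "C_k_on k S f \<Longrightarrow> T \<subseteq> S \<Longrightarrow> C_k_on k T f"
  by (induction k arbitrary: f) (auto intro: continuous_on_subset)

lemma smooth_on_subset: "smooth_on S f \<Longrightarrow> T \<subseteq> S \<Longrightarrow> smooth_on T f"
  unfolding smooth_on_def using C_k_on_subset by blast

lemma C_k_on_Suc_D: "C_k_on (Suc k) S f \<Longrightarrow> C_k_on k S f"
proof (induction k arbitrary: f)
  case 0
  then show ?case
    by (auto intro!: continuous_at_imp_continuous_on differentiable_imp_continuous_within)
next
  case (Suc k)
  then show ?case by (metis C_k_on.simps(2))
qed

text \<open>Lets the derivative be given by a formula \<open>D\<close>; on an open set the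
  congruence lemma replaces \<open>frechet_derivative\<close> by it.\<close>

lemma C_k_on_SucI:
  assumes "\<And>x. x \<in> S \<Longrightarrow> (f has_derivative D x) (at x)" "open S"
    "\<And>v. C_k_on k S (\<lambda>x. D x v)"
  shows "C_k_on (Suc k) S f"
proof -
  have "frechet_derivative f (at x) = D x" if "x \<in> S" for x
    using frechet_derivative_at[OF assms(1)[OF that]] by simp
  then show ?thesis
    using assms C_k_on_cong[OF assms(2), of "\<lambda>x. frechet_derivative f (at x) _" "\<lambda>x. D x _"]
    by (auto simp: differentiable_def)
qed

lemma C_k_on_Suc_deriv:
  "C_k_on (Suc k) S f \<Longrightarrow> x \<in> S \<Longrightarrow> (f has_derivative frechet_derivative f (at x)) (at x)"
  by (simp add: frechet_derivative_works)

lemma smooth_on_deriv: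
  "smooth_on S f \<Longrightarrow> x \<in> S \<Longrightarrow> (f has_derivative frechet_derivative f (at x)) (at x)"
  unfolding smooth_on_def by (metis C_k_on_Suc_deriv)

lemma smooth_on_frechet: "smooth_on S f \<Longrightarrow> smooth_on S (\<lambda>x. frechet_derivative f (at x) v)"
  unfolding smooth_on_def by (metis C_k_on.simps(2))

lemma smooth_on_continuous: "smooth_on S f \<Longrightarrow> continuous_on S f"
  unfolding smooth_on_def by (metis C_k_on.simps(1))

lemma C_k_on_local:
  assumes "\<And>x. x \<in> S \<Longrightarrow> \<exists>T. open T \<and> x \<in> T \<and> C_k_on k T f"
  shows "C_k_on k S f"
  using assms
proof (induction k arbitrary: f)
  case 0
  then show ?case
    by (fastforce intro!: continuous_at_imp_continuous_on simp: continuous_on_eq_continuous_at)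
next
  case (Suc k)
  have "f differentiable (at x)" if "x \<in> S" for x
    using Suc.prems[OF that] by auto
  moreover have "C_k_on k S (\<lambda>x. frechet_derivative f (at x) v)" for v
    by (rule Suc.IH) (use Suc.prems in fastforce)
  ultimately show ?case by simp
qed

lemma smooth_on_local:
  "(\<And>x. x \<in> S \<Longrightarrow> \<exists>T. open T \<and> x \<in> T \<and> smooth_on T f) \<Longrightarrow> smooth_on S f"
  unfolding smooth_on_def by (metis C_k_on_local)

lemma C_k_on_const: "open S \<Longrightarrow> C_k_on k S (\<lambda>x. c)"
  by (induction k arbitrary: c) auto

lemma C_k_on_add:
  assumes "open S" "C_k_on k S f" "C_k_on k S g"
  shows "C_k_on k S (\<lambda>x. f x + g x)"
  using assms(2,3)
proof (induction k arbitrary: f g)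
  case (Suc k)
  show ?case
    by (rule C_k_on_SucI[where D="\<lambda>x v. frechet_derivative f (at x) v + frechet_derivative g (at x) v"])
      (use Suc assms(1) in \<open>auto intro!: has_derivative_add simp: frechet_derivative_works\<close>)
qed (auto intro: continuous_on_add)

lemma C_k_on_linear:
  assumes "open S" "bounded_linear L" "C_k_on k S f"
  shows "C_k_on k S (\<lambda>x. L (f x))"
  using assms(3)
proof (induction k arbitrary: f)
  case 0
  then show ?case
    using bounded_linear.continuous_on[OF assms(2)] by auto
next
  case (Suc k)
  show ?case
    by (rule C_k_on_SucI[where D="\<lambda>x v. L (frechet_derivative f (at x) v)"])
      (use Suc assms(1) in \<open>auto intro!: bounded_linear.has_derivative[OF assms(2)] simp: frechet_derivative_works\<close>)
qed

lemma C_k_on_scaleR: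
  fixes f :: "'e::euclidean_space \<Rightarrow> real"
  assumes "open S" "C_k_on k S f" "C_k_on k S g"
  shows "C_k_on k S (\<lambda>x. f x *\<^sub>R g x)"
  using assms(2,3)
proof (induction k arbitrary: f g)
  case (Suc k)
  show ?case
  proof (rule C_k_on_SucI[where D="\<lambda>x v. f x *\<^sub>R frechet_derivative g (at x) v + frechet_derivative f (at x) v *\<^sub>R g x"])
    fix v
    show "C_k_on k S (\<lambda>x. f x *\<^sub>R frechet_derivative g (at x) v + frechet_derivative f (at x) v *\<^sub>R g x)"
      using Suc.prems C_k_on_Suc_D[OF Suc.prems(1)] C_k_on_Suc_D[OF Suc.prems(2)]
      by (auto intro!: C_k_on_add assms(1) Suc.IH)
  qed (use Suc assms(1) in \<open>auto intro!: has_derivative_scaleR simp: frechet_derivative_works\<close>)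
qed (auto intro: continuous_on_scaleR)

lemma C_k_on_sum:
  assumes "open S" "\<And>i. i \<in> I \<Longrightarrow> C_k_on k S (f i)"
  shows "C_k_on k S (\<lambda>x. \<Sum>i\<in>I. f i x)"
  using assms(2)
  by (induction I rule: infinite_finite_induct) (auto intro!: C_k_on_const C_k_on_add assms(1))

lemma linear_basis_expansion:
  fixes L :: "'e::euclidean_space \<Rightarrow> 'b::real_vector"
  assumes "linear L"
  shows "L w = (\<Sum>b\<in>Basis. (w \<bullet> b) *\<^sub>R L b)"
  by (subst euclidean_representation[symmetric, of w]) (simp only: linear_sum[OF assms] linear_cmul[OF assms])

text \<open>Expanded in a basis, the chain rule is a finite sum of products of a coordinate of the
  derivative of g with a partial derivative of f composed with g. The induction hypothesis applies
  to the latter, with the same g one order lower.\<close>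

lemma C_k_on_compose:
  fixes g :: "'e::euclidean_space \<Rightarrow> 'f::euclidean_space"
  assumes "open S" "C_k_on k T f" "C_k_on k S g" "g ` S \<subseteq> T"
  shows "C_k_on k S (\<lambda>x. f (g x))"
  using assms(2,3)
proof (induction k arbitrary: f)
  case 0
  then show ?case using assms(4) continuous_on_compose2 by auto
next
  case (Suc k)
  show ?case
  proof (rule C_k_on_SucI[where D="\<lambda>x v. \<Sum>b\<in>Basis. (frechet_derivative g (at x) v \<bullet> b) *\<^sub>R frechet_derivative f (at (g x)) b"])
    fix x assume x: "x \<in> S"
    have g: "(g has_derivative frechet_derivative g (at x)) (at x)"
      using C_k_on_Suc_deriv Suc.prems(2) x by blast
    have f: "(f has_derivative frechet_derivative f (at (g x))) (at (g x))"
      using C_k_on_Suc_deriv[OF Suc.prems(1)] assms(4) x by blast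
    have lin: "linear (frechet_derivative f (at (g x)))"
      using f has_derivative_linear by blast
    show "((\<lambda>x. f (g x)) has_derivative
        (\<lambda>v. \<Sum>b\<in>Basis. (frechet_derivative g (at x) v \<bullet> b) *\<^sub>R frechet_derivative f (at (g x)) b)) (at x)"
      by (rule has_derivative_eq_rhs[OF has_derivative_compose[OF g f]])
        (intro ext linear_basis_expansion[OF lin])
  next
    fix v
    show "C_k_on k S (\<lambda>x. \<Sum>b\<in>Basis. (frechet_derivative g (at x) v \<bullet> b) *\<^sub>R frechet_derivative f (at (g x)) b)"
    proof (intro C_k_on_sum C_k_on_scaleR assms(1))
      fix b :: 'f
      show "C_k_on k S (\<lambda>x. frechet_derivative g (at x) v \<bullet> b)"
        using Suc.prems(2) by (intro C_k_on_linear[where L="\<lambda>y. y \<bullet> b"] assms(1) bounded_linear_inner_left) auto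
      show "C_k_on k S (\<lambda>x. frechet_derivative f (at (g x)) b)"
        using Suc.prems C_k_on_Suc_D[OF Suc.prems(2)]
        by (intro Suc.IH[where f="\<lambda>y. frechet_derivative f (at y) b"]) auto
    qed
  qed (fact assms(1))
qed

lemma smooth_on_const: "open S \<Longrightarrow> smooth_on S (\<lambda>x. c)"
  by (simp add: smooth_on_def C_k_on_const)

lemma smooth_on_add:
  "open S \<Longrightarrow> smooth_on S f \<Longrightarrow> smooth_on S g \<Longrightarrow> smooth_on S (\<lambda>x. f x + g x)"
  by (simp add: smooth_on_def C_k_on_add)

lemma smooth_on_scaleR:
  fixes f :: "'e::euclidean_space \<Rightarrow> real"
  shows "open S \<Longrightarrow> smooth_on S f \<Longrightarrow> smooth_on S g \<Longrightarrow> smooth_on S (\<lambda>x. f x *\<^sub>R g x)"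
  by (simp add: smooth_on_def C_k_on_scaleR)

lemma smooth_on_mult:
  fixes f :: "'e::euclidean_space \<Rightarrow> real"
  shows "open S \<Longrightarrow> smooth_on S f \<Longrightarrow> smooth_on S g \<Longrightarrow> smooth_on S (\<lambda>x. f x * g x)"
  using smooth_on_scaleR[of S f g] by simp

lemma smooth_on_sum:
  "open S \<Longrightarrow> (\<And>i. i \<in> I \<Longrightarrow> smooth_on S (f i)) \<Longrightarrow> smooth_on S (\<lambda>x. \<Sum>i\<in>I. f i x)"
  by (simp add: smooth_on_def C_k_on_sum)

lemma smooth_on_linear:
  "open S \<Longrightarrow> bounded_linear L \<Longrightarrow> smooth_on S f \<Longrightarrow> smooth_on S (\<lambda>x. L (f x))"
  by (simp add: smooth_on_def C_k_on_linear)

lemma smooth_on_ident: "open S \<Longrightarrow> smooth_on S (\<lambda>x. x)"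
  unfolding smooth_on_def
proof
  fix k assume "open S"
  then show "C_k_on k S (\<lambda>x. x)"
    by (cases k) (auto simp: C_k_on_const)
qed

lemma smooth_on_minus:
  fixes f :: "'e::euclidean_space \<Rightarrow> 'b::real_normed_vector"
  assumes "open S" "smooth_on S f" "smooth_on S g" shows "smooth_on S (\<lambda>x. f x - g x)"
  using smooth_on_add[OF assms(1,2) smooth_on_linear[OF assms(1) bounded_linear_minus[OF bounded_linear_ident] assms(3)]]
  by simp

lemma smooth_on_compose:
  fixes g :: "'e::euclidean_space \<Rightarrow> 'f::euclidean_space"
  shows "open S \<Longrightarrow> smooth_on T f \<Longrightarrow> smooth_on S g \<Longrightarrow> g ` S \<subseteq> T \<Longrightarrow> smooth_on S (\<lambda>x. f (g x))"
  unfolding smooth_on_def using C_k_on_compose[of S _ T f g] by blast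

lemma smooth_on_Pair:
  fixes f :: "'e::euclidean_space \<Rightarrow> 'b::real_normed_vector" and g :: "'e \<Rightarrow> 'c::real_normed_vector"
  assumes "open S" "smooth_on S f" "smooth_on S g"
  shows "smooth_on S (\<lambda>x. (f x, g x))"
proof -
  have 1: "bounded_linear (\<lambda>x::'b. (x, 0::'c))" "bounded_linear (\<lambda>x::'c. (0::'b, x))"
    by (intro bounded_linear_Pair bounded_linear_ident bounded_linear_zero)+
  show ?thesis
    using smooth_on_add[OF assms(1) smooth_on_linear[OF assms(1) 1(1) assms(2)] smooth_on_linear[OF assms(1) 1(2) assms(3)]]
    by simp
qed

lemma smooth_on_fst: "open S \<Longrightarrow> smooth_on S (fst :: 'e::euclidean_space \<times> 'f::euclidean_space \<Rightarrow> 'e)"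
  using smooth_on_linear[OF _ bounded_linear_fst smooth_on_ident] by auto

lemma smooth_on_snd: "open S \<Longrightarrow> smooth_on S (snd :: 'e::euclidean_space \<times> 'f::euclidean_space \<Rightarrow> 'f)"
  using smooth_on_linear[OF _ bounded_linear_snd smooth_on_ident] by auto

text \<open>For 1/x on the punctured line the derivative is a constant times the product of two
  copies of 1/x, so the order can be raised by induction; composition with f does the rest.\<close>

lemma smooth_on_inverse:
  fixes f :: "'e::euclidean_space \<Rightarrow> real"
  assumes "open S" "smooth_on S f" "\<And>x. x \<in> S \<Longrightarrow> f x \<noteq> 0"
  shows "smooth_on S (\<lambda>x. inverse (f x))"
proof -
  have "C_k_on k (-{0}) (inverse :: real \<Rightarrow> real)" for k
  proof (induction k)
    case 0
    then show ?case by (auto intro!: continuous_intros)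
  next
    case (Suc k)
    show ?case
    proof (rule C_k_on_SucI[where D="\<lambda>x v. - (inverse x * v * inverse x)"])
      fix v :: real
      have "C_k_on k (-{0}) (\<lambda>x::real. (-v) *\<^sub>R (inverse x *\<^sub>R inverse x))"
        by (intro C_k_on_scaleR C_k_on_const Suc open_Compl closed_singleton)
      then show "C_k_on k (-{0}) (\<lambda>x::real. - (inverse x * v * inverse x))"
        by (simp add: mult_ac)
    qed (auto intro: has_derivative_inverse')
  qed
  then have "smooth_on (-{0}) (inverse :: real \<Rightarrow> real)"
    by (simp add: smooth_on_def)
  moreover have "f ` S \<subseteq> -{0}" using assms(3) by auto
  ultimately show ?thesis using smooth_on_compose[OF assms(1) _ assms(2)] by blast
qed

section \<open>Cut-off functions\<close>

text \<open>The derivatives of \<open>exp (- 1 / x)\<close> are combinations of the functions \<open>exp (- 1 / x) / x ^ n\<close>.\<close>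

definition flat :: "nat \<Rightarrow> real \<Rightarrow> real" where
  "flat n x = (if x > 0 then inverse x ^ n * exp (- inverse x) else 0)"

lemma flat_has_derivative:
  "(flat n has_real_derivative (flat (n + 2) x - real n * flat (n + 1) x)) (at x)"
proof -
  consider "x > 0" | "x < 0" | "x = 0" by linarith
  then show ?thesis
  proof cases
    case 1
    have "((\<lambda>x. inverse x ^ n) has_real_derivative - (real n * inverse x ^ (n + 1))) (at x)"
      using 1 DERIV_power[OF DERIV_inverse, where n=n and x=x and s=UNIV] by (cases n) (auto simp: algebra_simps)
    moreover have "((\<lambda>x. exp (- inverse x)) has_real_derivative exp (- inverse x) * inverse x ^ 2) (at x)"
      using 1 by (auto intro!: derivative_eq_intros simp: power2_eq_square)
    ultimately have "((\<lambda>x. inverse x ^ n * exp (- inverse x)) has_real_derivative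
        (flat (n + 2) x - real n * flat (n + 1) x)) (at x)"
      using 1 by (auto dest: DERIV_mult simp: flat_def algebra_simps power2_eq_square)
    then show ?thesis
      by (rule has_field_derivative_transform_within_open[of _ _ _ "{0<..}"]) (use 1 in \<open>auto simp: flat_def\<close>)
  next
    case 2
    have "((\<lambda>x. 0) has_real_derivative (flat (n + 2) x - real n * flat (n + 1) x)) (at x)"
      using 2 by (auto simp: flat_def)
    then show ?thesis
      by (rule has_field_derivative_transform_within_open[of _ _ _ "{..<0}"]) (use 2 in \<open>auto simp: flat_def\<close>)
  next
    case 3
    \<comment> \<open>With t = 1/h the difference quotient at 0 from the right is t^(n+1) / exp t as
      t tends to infinity; from the left it is 0.\<close>
    have "((\<lambda>t::real. t ^ Suc n / exp t) \<longlongrightarrow> 0) at_top"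
      by (rule tendsto_power_div_exp_0)
    then have *: "((\<lambda>h::real. inverse h ^ Suc n / exp (inverse h)) \<longlongrightarrow> 0) (at_right 0)"
      by (rule filterlim_compose) (rule filterlim_inverse_at_top_right)
    have "((\<lambda>h. (flat n (0 + h) - flat n 0) / h) \<longlongrightarrow> 0) (at_right 0)"
      by (rule Lim_transform_eventually[OF *])
        (auto simp: eventually_at_filter flat_def exp_minus field_simps)
    moreover have "((\<lambda>h. (flat n (0 + h) - flat n 0) / h) \<longlongrightarrow> 0) (at_left 0)"
      by (rule Lim_transform_eventually[OF tendsto_const])
        (auto simp: eventually_at_filter flat_def)
    ultimately have "((\<lambda>h. (flat n (0 + h) - flat n 0) / h) \<longlongrightarrow> 0) (at 0)"
      using filterlim_split_at by blast
    then show ?thesis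
      using 3 by (simp add: DERIV_def flat_def)
  qed
qed

lemma smooth_on_flat: "smooth_on UNIV (flat n)"
proof -
  have "C_k_on k UNIV (flat n)" for k n
  proof (induction k arbitrary: n)
    case 0
    then show ?case
      by (auto intro!: continuous_at_imp_continuous_on DERIV_isCont flat_has_derivative)
  next
    case (Suc k)
    show ?case
    proof (rule C_k_on_SucI)
      show "(flat n has_derivative (\<lambda>v. (flat (n + 2) x - real n * flat (n + 1) x) * v)) (at x)" for x
        using flat_has_derivative[of n x] by (simp add: has_field_derivative_def)
      fix v :: real
      have "C_k_on k UNIV (\<lambda>x. v *\<^sub>R flat (n + 2) x + (- v * real n) *\<^sub>R flat (n + 1) x)"
        by (intro C_k_on_add C_k_on_scaleR C_k_on_const Suc open_UNIV)
      then show "C_k_on k UNIV (\<lambda>x. (flat (n + 2) x - real n * flat (n + 1) x) * v)"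
        by (simp add: algebra_simps)
    qed simp
  qed
  then show ?thesis by (simp add: smooth_on_def)
qed

text \<open>The squared distance, unlike the distance, is smooth at the centre
  \<open>a\<close>.\<close>

definition bump :: "'e::euclidean_space \<Rightarrow> real \<Rightarrow> 'e \<Rightarrow> real" where
  "bump a r x = flat 0 (r\<^sup>2 - (x - a) \<bullet> (x - a))"

lemma bump_pos_iff: "r > 0 \<Longrightarrow> bump a r x > 0 \<longleftrightarrow> x \<in> ball a r"
  by (auto simp: bump_def flat_def dist_norm norm_minus_commute simp flip: power2_norm_eq_inner)
    (smt (verit) power_mono power_strict_mono norm_ge_zero zero_less_numeral pos2)+

lemma bump_zero: "r > 0 \<Longrightarrow> x \<notin> ball a r \<Longrightarrow> bump a r x = 0"
  using bump_pos_iff[of r a x] by (auto simp: bump_def flat_def)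

lemma smooth_on_inner:
  fixes f g :: "'e::euclidean_space \<Rightarrow> 'f::euclidean_space"
  assumes "open S" "smooth_on S f" "smooth_on S g"
  shows "smooth_on S (\<lambda>x. f x \<bullet> g x)"
proof -
  have "smooth_on S (\<lambda>x. \<Sum>b\<in>Basis. (f x \<bullet> b) * (g x \<bullet> b))"
    using assms
    by (intro smooth_on_sum smooth_on_mult smooth_on_linear[OF _ bounded_linear_inner_left]) auto
  moreover have "(\<lambda>x. f x \<bullet> g x) = (\<lambda>x. \<Sum>b\<in>Basis. (f x \<bullet> b) * (g x \<bullet> b))"
    by (intro ext euclidean_inner)
  ultimately show ?thesis by simp
qed

lemma smooth_on_bump: "open S \<Longrightarrow> smooth_on S (bump a r)"
proof -
  assume "open S"
  then have "smooth_on S (\<lambda>x. flat 0 (r\<^sup>2 - (x - a) \<bullet> (x - a)))"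
    by (intro smooth_on_compose[OF _ smooth_on_flat] smooth_on_minus smooth_on_inner smooth_on_const smooth_on_ident) auto
  then show ?thesis by (simp add: bump_def[abs_def])
qed

section \<open>Integrals that depend smoothly on a parameter\<close>

lemma C_k_on_integral:
  fixes K :: "real \<times> 'e::euclidean_space \<Rightarrow> real"
  assumes "open V" "convex V" "open W" "{0..1} \<times> V \<subseteq> W" "smooth_on W K"
  shows "C_k_on k V (\<lambda>x. integral {0..1} (\<lambda>u. K (u, x)))"
proof -
  have swap: "continuous_on (V \<times> cbox 0 1) (\<lambda>p. F (snd p, fst p))" if "continuous_on W F" for F :: "_ \<Rightarrow> real"
  proof (rule continuous_on_compose2[OF that])
    show "continuous_on (V \<times> cbox 0 1) (\<lambda>p. (snd p, fst p))"
      by (intro continuous_intros)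
  qed (use assms(4) in auto)
  have sect: "continuous_on (cbox 0 1) (\<lambda>u. F (u, x))"
    if "continuous_on W F" "x \<in> V" for F :: "_ \<Rightarrow> real" and x
  proof (rule continuous_on_compose2[OF that(1)])
    show "continuous_on (cbox 0 1) (\<lambda>u. (u, x))"
      by (intro continuous_intros)
  qed (use assms(4) that(2) in auto)
  from assms(5) show ?thesis
  proof (induction k arbitrary: K)
    case 0
    have "continuous_on (V \<times> cbox 0 1) (\<lambda>(x, u). K (u, x))"
      using swap[OF smooth_on_continuous[OF 0]] by (simp add: split_beta)
    then have "continuous_on V (\<lambda>x. integral (cbox 0 1) (\<lambda>u. K (u, x)))"
      by (rule integral_continuous_on_param)
    then show ?case by simp
  next
    case (Suc k)
    \<comment> \<open>The derivative of the kernel in the direction b of the parameter is smooth on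
      the same open set W, so it can serve as the kernel in the induction hypothesis. W surrounds
      the unit interval, which makes two-sided derivatives available at its ends.\<close>
    let ?D = "\<lambda>b p. frechet_derivative K (at p) (0, b)"
    have contD: "continuous_on W (?D b)" for b
      by (rule smooth_on_continuous[OF smooth_on_frechet[OF Suc.prems]])
    have repr: "?D v p = (\<Sum>b\<in>Basis. ?D b p * (v \<bullet> b))" if "p \<in> W" for v p
    proof -
      have "linear (frechet_derivative K (at p))"
        by (rule has_derivative_linear[OF smooth_on_deriv[OF Suc.prems that]])
      moreover have "linear (\<lambda>v::'e. (0::real, v))"
        by (auto intro!: linearI)
      ultimately have "linear (\<lambda>v. frechet_derivative K (at p) (0, v))"
        using linear_compose[of "\<lambda>v. (0, v)" "frechet_derivative K (at p)"] by (simp only: o_def)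
      from linear_basis_expansion[OF this, of v] show ?thesis
        by (simp add: mult.commute)
    qed
    show ?case
    proof (rule C_k_on_SucI)
      fix x assume x: "x \<in> V"
      \<comment> \<open>\<open>leibniz_rule\<close> asks for the derivative as a continuous map into
        the bounded linear functionals; written in the basis, this is continuity of finitely many
        partial derivatives.\<close>
      let ?fx = "\<lambda>x u. (\<Sum>b\<in>Basis. ?D b (u, x) *\<^sub>R blinfun_inner_left b) :: 'e \<Rightarrow>\<^sub>L real"
      have fx: "blinfun_apply (?fx x u) v = ?D v (u, x)" if "x \<in> V" "u \<in> {0..1}" for x u v
      proof -
        have "(u, x) \<in> W" using that assms(4) by auto
        from repr[OF this, of v] show ?thesis
          by (simp add: blinfun.sum_left blinfun.scaleR_left inner_commute)
      qed
      have cont_fx: "continuous_on (V \<times> cbox 0 1) (\<lambda>(x, u). ?fx x u)"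
        unfolding split_beta
        by (intro continuous_on_sum continuous_on_scaleR continuous_on_const swap[OF contD])
      have "((\<lambda>x. integral (cbox 0 1) (\<lambda>u. K (u, x))) has_derivative
         blinfun_apply (integral (cbox 0 1) (?fx x))) (at x within V)"
      proof (rule leibniz_rule[OF _ _ cont_fx x assms(2)])
        fix y u assume y: "y \<in> V" and u: "u \<in> cbox (0::real) 1"
        have d: "((\<lambda>y. K (u, y)) has_derivative (\<lambda>v. ?D v (u, y))) (at y)"
        proof (rule has_derivative_compose[of "\<lambda>y. (u, y)" "\<lambda>v. (0, v)"])
          show "((\<lambda>y. (u, y)) has_derivative (\<lambda>v. (0, v))) (at y)"
            by (intro has_derivative_Pair has_derivative_const has_derivative_ident)
          show "(K has_derivative frechet_derivative K (at (u, y))) (at (u, y))"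
            by (rule smooth_on_deriv[OF Suc.prems]) (use y u assms(4) in auto)
        qed
        have "(\<lambda>v. ?D v (u, y)) = blinfun_apply (?fx y u)"
          by (rule ext, rule fx[OF y, symmetric]) (use u in simp)
        then show "((\<lambda>y. K (u, y)) has_derivative blinfun_apply (?fx y u)) (at y within V)"
          by (rule has_derivative_at_withinI[OF has_derivative_eq_rhs[OF d]])
      next
        fix y assume y: "y \<in> V"
        show "(\<lambda>u. K (u, y)) integrable_on cbox 0 1"
          by (intro integrable_continuous sect smooth_on_continuous[OF Suc.prems] y)
      qed
      moreover have "blinfun_apply (integral (cbox 0 1) (?fx x)) v = integral {0..1} (\<lambda>u. ?D v (u, x))" for v
      proof -
        have i: "?fx x integrable_on cbox 0 1"
          by (intro integrable_continuous continuous_on_sum continuous_on_scaleR continuous_on_const sect contD x)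
        have "blinfun_apply (integral (cbox 0 1) (?fx x)) v = integral (cbox 0 1) (\<lambda>u. blinfun_apply (?fx x u) v)"
          by (rule integral_linear[OF i blinfun.bounded_linear_left, unfolded o_def, symmetric])
        also have "\<dots> = integral (cbox 0 1) (\<lambda>u. ?D v (u, x))"
          by (rule integral_cong, rule fx[OF x]) simp
        finally show ?thesis by simp
      qed
      then have "blinfun_apply (integral (cbox 0 1) (?fx x)) = (\<lambda>v. integral {0..1} (\<lambda>u. ?D v (u, x)))"
        by (rule ext)
      ultimately show "((\<lambda>x. integral {0..1} (\<lambda>u. K (u, x))) has_derivative
         (\<lambda>v. integral {0..1} (\<lambda>u. ?D v (u, x)))) (at x)"
        unfolding at_within_open[OF x assms(1)] by simp
    next
      fix v
      show "C_k_on k V (\<lambda>x. integral {0..1} (\<lambda>u. ?D v (u, x)))"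
        by (rule Suc.IH) (rule smooth_on_frechet[OF Suc.prems])
    qed (fact assms(1))
  qed
qed

lemma smooth_on_integral:
  fixes K :: "real \<times> 'e::euclidean_space \<Rightarrow> real"
  assumes "open V" "convex V" "open W" "{0..1} \<times> V \<subseteq> W" "smooth_on W K"
  shows "smooth_on V (\<lambda>x. integral {0..1} (\<lambda>u. K (u, x)))"
  unfolding smooth_on_def using C_k_on_integral[OF assms] by blast

section \<open>Vector fields and tensor fields\<close>

lemma vfield_eqI: "(\<And>p u. X p u = Y p u) \<Longrightarrow> (X :: 'a vfield) = Y"
  by (intro ext)

lemma vfield_eqD: "(X :: 'a vfield) = Y \<Longrightarrow> X p u = Y p u"
  by simp

lemma fmul_apply [simp]: "(f \<cdot> X) p u = f p * X p u"
  by (simp add: fmul_def)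

lemma cmul_apply [simp]: "(r \<cdot>\<^sub>\<real> X) p u = r * X p u"
  by (simp add: cmul_def)

lemma deriv_along_apply: "deriv_along X f p = X p f"
  by (simp add: deriv_along_def)

lemma deriv_along_bracket:
  "deriv_along (bracket X Y) f = deriv_along X (deriv_along Y f) - deriv_along Y (deriv_along X f)"
  by (auto simp: bracket_def deriv_along_def)

lemma bracket_antisym: "bracket X Y = - bracket Y X"
  by (auto simp: bracket_def intro!: vfield_eqI)

text \<open>Open chart images suffice for the algebra of fields and tensors. The assumption holds
  for M and for M x R alike, so the results below are available on both.\<close>

locale open_atlas =
  fixes A :: "('a, 'e::euclidean_space) atlas"
  assumes open_charts: "(U, c) \<in> A \<Longrightarrow> open (c ` U)"
begin

lemma smooth_const [simp]: "(\<lambda>_. r) \<in> smooth_functions A"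
  using open_charts by (auto simp: smooth_functions_def o_def intro!: smooth_on_const)

lemma smooth_zero [simp]: "0 \<in> smooth_functions A"
  using smooth_const[of 0] by (simp add: zero_fun_def)

lemma smooth_add [simp]:
  "f \<in> smooth_functions A \<Longrightarrow> g \<in> smooth_functions A \<Longrightarrow> f + g \<in> smooth_functions A"
  using open_charts by (fastforce simp: smooth_functions_def o_def intro!: smooth_on_add)

lemma smooth_mult [simp]:
  "f \<in> smooth_functions A \<Longrightarrow> g \<in> smooth_functions A \<Longrightarrow> f * g \<in> smooth_functions A"
  using open_charts by (fastforce simp: smooth_functions_def o_def intro!: smooth_on_mult)

lemma smooth_cmult [simp]: "f \<in> smooth_functions A \<Longrightarrow> (\<lambda>p. r * f p) \<in> smooth_functions A"
  using smooth_mult[OF smooth_const[of r], of f] by (simp add: times_fun_def)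

lemma smooth_uminus [simp]: "f \<in> smooth_functions A \<Longrightarrow> - f \<in> smooth_functions A"
  using smooth_cmult[of f "-1"] by (simp add: fun_Compl_def)

lemma smooth_diff [simp]:
  "f \<in> smooth_functions A \<Longrightarrow> g \<in> smooth_functions A \<Longrightarrow> f - g \<in> smooth_functions A"
  using smooth_add[OF _ smooth_uminus, of f g] by simp

lemma smooth_sum_list [simp]:
  "(\<And>x. x \<in> set xs \<Longrightarrow> F x \<in> smooth_functions A) \<Longrightarrow> (\<Sum>x\<leftarrow>xs. F x) \<in> smooth_functions A"
  by (induction xs) auto

lemma tangent_add:
  "v \<in> tangent_space A p \<Longrightarrow> f \<in> smooth_functions A \<Longrightarrow> g \<in> smooth_functions A \<Longrightarrow> v (f + g) = v f + v g"
  by (simp add: tangent_space_def)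

lemma tangent_cmult:
  "v \<in> tangent_space A p \<Longrightarrow> f \<in> smooth_functions A \<Longrightarrow> v (\<lambda>q. r * f q) = r * v f"
  by (simp add: tangent_space_def)

lemma tangent_mult:
  "v \<in> tangent_space A p \<Longrightarrow> f \<in> smooth_functions A \<Longrightarrow> g \<in> smooth_functions A \<Longrightarrow>
    v (f * g) = v f * g p + f p * v g"
  by (simp add: tangent_space_def)

lemma tangent_nonsmooth: "v \<in> tangent_space A p \<Longrightarrow> f \<notin> smooth_functions A \<Longrightarrow> v f = 0"
  by (simp add: tangent_space_def)

lemma tangent_uminus:
  "v \<in> tangent_space A p \<Longrightarrow> f \<in> smooth_functions A \<Longrightarrow> v (- f) = - v f"
  using tangent_cmult[of v p f "-1"] by (simp add: fun_Compl_def)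

lemma tangent_diff:
  "v \<in> tangent_space A p \<Longrightarrow> f \<in> smooth_functions A \<Longrightarrow> g \<in> smooth_functions A \<Longrightarrow> v (f - g) = v f - v g"
  using tangent_add[of v p f "- g"] tangent_uminus[of v p g] by simp

lemma tangent_const: "v \<in> tangent_space A p \<Longrightarrow> v (\<lambda>_. r) = 0"
  using tangent_mult[of v p "\<lambda>_. 1" "\<lambda>_. 1"] tangent_cmult[of v p "\<lambda>_. 1" r]
  by (simp add: times_fun_def)

lemma tangent_zero: "v \<in> tangent_space A p \<Longrightarrow> v 0 = 0"
  using tangent_const[of v p 0] by (simp add: zero_fun_def)

lemma tangent_sum_list:
  "v \<in> tangent_space A p \<Longrightarrow> (\<And>x. x \<in> set xs \<Longrightarrow> F x \<in> smooth_functions A) \<Longrightarrow>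
    v (\<Sum>x\<leftarrow>xs. F x) = (\<Sum>x\<leftarrow>xs. v (F x))"
  by (induction xs) (auto simp: tangent_zero tangent_add)

lemma field_tangent: "X \<in> vector_fields A \<Longrightarrow> X p \<in> tangent_space A p"
  by (simp add: vector_fields_def)

lemma deriv_along_smooth [simp]:
  "X \<in> vector_fields A \<Longrightarrow> f \<in> smooth_functions A \<Longrightarrow> deriv_along X f \<in> smooth_functions A"
  by (simp add: vector_fields_def deriv_along_def)

lemma deriv_along_add:
  "X \<in> vector_fields A \<Longrightarrow> f \<in> smooth_functions A \<Longrightarrow> g \<in> smooth_functions A \<Longrightarrow>
    deriv_along X (f + g) = deriv_along X f + deriv_along X g"
  by (auto simp: deriv_along_def tangent_add[OF field_tangent])

lemma deriv_along_diff:
  "X \<in> vector_fields A \<Longrightarrow> f \<in> smooth_functions A \<Longrightarrow> g \<in> smooth_functions A \<Longrightarrow>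
    deriv_along X (f - g) = deriv_along X f - deriv_along X g"
  by (auto simp: deriv_along_def tangent_diff[OF field_tangent])

lemma deriv_along_mult:
  "X \<in> vector_fields A \<Longrightarrow> f \<in> smooth_functions A \<Longrightarrow> g \<in> smooth_functions A \<Longrightarrow>
    deriv_along X (f * g) = deriv_along X f * g + f * deriv_along X g"
  by (auto simp: deriv_along_def tangent_mult[OF field_tangent])

lemma deriv_along_cmult:
  "X \<in> vector_fields A \<Longrightarrow> f \<in> smooth_functions A \<Longrightarrow>
    deriv_along X (\<lambda>p. r * f p) = (\<lambda>p. r * deriv_along X f p)"
  by (auto simp: deriv_along_def tangent_cmult[OF field_tangent])

lemma deriv_along_const [simp]: "X \<in> vector_fields A \<Longrightarrow> deriv_along X (\<lambda>_. r) = 0"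
  by (auto simp: deriv_along_def tangent_const[OF field_tangent])

lemma deriv_along_nonsmooth: "X \<in> vector_fields A \<Longrightarrow> f \<notin> smooth_functions A \<Longrightarrow> deriv_along X f = 0"
  by (auto simp: deriv_along_def tangent_nonsmooth[OF field_tangent])

lemma field_zero [simp]: "0 \<in> vector_fields A"
  using smooth_zero by (auto simp: vector_fields_def tangent_space_def zero_fun_def)

lemma field_add [simp]: "X \<in> vector_fields A \<Longrightarrow> Y \<in> vector_fields A \<Longrightarrow> X + Y \<in> vector_fields A"
  using smooth_add[of "deriv_along X _" "deriv_along Y _"]
  by (auto simp: vector_fields_def tangent_space_def algebra_simps plus_fun_def deriv_along_def)

lemma field_fmul [simp]: "f \<in> smooth_functions A \<Longrightarrow> X \<in> vector_fields A \<Longrightarrow> f \<cdot> X \<in> vector_fields A"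
  using smooth_mult[of f "deriv_along X _"]
  by (auto simp: vector_fields_def tangent_space_def algebra_simps times_fun_def deriv_along_def)

lemma field_cmul [simp]: "X \<in> vector_fields A \<Longrightarrow> r \<cdot>\<^sub>\<real> X \<in> vector_fields A"
  by (simp add: cmul_def)

lemma field_uminus [simp]: "X \<in> vector_fields A \<Longrightarrow> - X \<in> vector_fields A"
proof -
  assume "X \<in> vector_fields A"
  moreover have "- X = (-1) \<cdot>\<^sub>\<real> X" by (auto intro: vfield_eqI)
  ultimately show ?thesis using field_cmul[of X "-1"] by simp
qed

lemma field_diff [simp]: "X \<in> vector_fields A \<Longrightarrow> Y \<in> vector_fields A \<Longrightarrow> X - Y \<in> vector_fields A"
  using field_add[OF _ field_uminus, of X Y] by simp

lemma field_bracket [simp]: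
  assumes X: "X \<in> vector_fields A" and Y: "Y \<in> vector_fields A"
  shows "bracket X Y \<in> vector_fields A"
proof -
  have "bracket X Y p \<in> tangent_space A p" for p
    unfolding tangent_space_def bracket_def
    using X Y
    apply (simp add: deriv_along_add deriv_along_mult deriv_along_cmult deriv_along_nonsmooth
        tangent_add[OF field_tangent] tangent_mult[OF field_tangent] tangent_cmult[OF field_tangent]
        tangent_zero[OF field_tangent])
    apply (simp add: deriv_along_apply algebra_simps)
    done
  moreover have "(\<lambda>p. bracket X Y p f) \<in> smooth_functions A" if "f \<in> smooth_functions A" for f
  proof -
    have "deriv_along X (deriv_along Y f) - deriv_along Y (deriv_along X f) \<in> smooth_functions A"
      using that X Y by simp
    then show ?thesis
      by (auto simp: bracket_def deriv_along_def elim!: back_subst[of "\<lambda>X. X \<in> smooth_functions A"])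
  qed
  ultimately show ?thesis by (simp add: vector_fields_def)
qed

lemma deriv_along_field_simps:
  "deriv_along (X + Y) f = deriv_along X f + deriv_along Y f"
  "deriv_along (X - Y) f = deriv_along X f - deriv_along Y f"
  "deriv_along (k \<cdot> X) f = k * deriv_along X f"
  by (auto simp: deriv_along_def)

lemma bracket_fmul_right:
  assumes "X \<in> vector_fields A" "Y \<in> vector_fields A" "f \<in> smooth_functions A"
  shows "bracket X (f \<cdot> Y) = f \<cdot> bracket X Y + deriv_along X f \<cdot> Y"
proof (rule vfield_eqI)
  fix p u
  \<comment> \<open>If \<open>u\<close> is not smooth, both sides vanish by the convention for
    tangent vectors.\<close>
  show "bracket X (f \<cdot> Y) p u = (f \<cdot> bracket X Y + deriv_along X f \<cdot> Y) p u"
    by (cases "u \<in> smooth_functions A")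
      (use assms in \<open>simp_all add: bracket_def deriv_along_field_simps deriv_along_nonsmooth deriv_along_apply
        tangent_mult[OF field_tangent] tangent_nonsmooth[OF field_tangent] tangent_zero[OF field_tangent] algebra_simps\<close>)
qed

lemma bracket_add_right:
  assumes "X \<in> vector_fields A" "Y \<in> vector_fields A" "Z \<in> vector_fields A"
  shows "bracket X (Y + Z) = bracket X Y + bracket X Z"
proof (rule vfield_eqI)
  fix p u
  show "bracket X (Y + Z) p u = (bracket X Y + bracket X Z) p u"
    by (cases "u \<in> smooth_functions A")
      (use assms in \<open>simp_all add: bracket_def deriv_along_field_simps deriv_along_nonsmooth deriv_along_apply
        tangent_add[OF field_tangent] tangent_nonsmooth[OF field_tangent] tangent_zero[OF field_tangent] algebra_simps\<close>)
qed

lemma bracket_cmul_right: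
  assumes "X \<in> vector_fields A" "Y \<in> vector_fields A"
  shows "bracket X (r \<cdot>\<^sub>\<real> Y) = r \<cdot>\<^sub>\<real> bracket X Y"
  unfolding cmul_def using assms by (auto simp: bracket_fmul_right intro!: vfield_eqI)

lemma bracket_uminus_right:
  assumes "X \<in> vector_fields A" "Y \<in> vector_fields A"
  shows "bracket X (- Y) = - bracket X Y"
proof -
  have "- Y = (-1) \<cdot>\<^sub>\<real> Y" by (auto intro: vfield_eqI)
  then show ?thesis using bracket_cmul_right[OF assms, of "-1"] by (auto intro: vfield_eqI)
qed

lemma bracket_diff_right:
  assumes "X \<in> vector_fields A" "Y \<in> vector_fields A" "Z \<in> vector_fields A"
  shows "bracket X (Y - Z) = bracket X Y - bracket X Z"
  using bracket_add_right[of X Y "- Z"] assms by (simp add: bracket_uminus_right)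

lemma bracket_zero_right: "X \<in> vector_fields A \<Longrightarrow> bracket X 0 = 0"
  using bracket_diff_right[of X X X] by simp

lemma bracket_add_left:
  assumes "X \<in> vector_fields A" "Y \<in> vector_fields A" "Z \<in> vector_fields A"
  shows "bracket (X + Y) Z = bracket X Z + bracket Y Z"
  using assms by (simp add: bracket_antisym[of _ Z] bracket_add_right)

lemma bracket_cmul_left:
  assumes "X \<in> vector_fields A" "Y \<in> vector_fields A"
  shows "bracket (r \<cdot>\<^sub>\<real> X) Y = r \<cdot>\<^sub>\<real> bracket X Y"
  using assms by (auto simp: bracket_antisym[of _ Y] bracket_cmul_right intro: vfield_eqI)

lemma bracket_uminus_left:
  assumes "X \<in> vector_fields A" "Y \<in> vector_fields A"
  shows "bracket (- X) Y = - bracket X Y"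
  using assms by (simp add: bracket_antisym[of _ Y] bracket_uminus_right)

lemma bracket_fmul_left:
  assumes "X \<in> vector_fields A" "Y \<in> vector_fields A" "f \<in> smooth_functions A"
  shows "bracket (f \<cdot> X) Y = f \<cdot> bracket X Y - deriv_along Y f \<cdot> X"
  using assms by (auto simp: bracket_antisym[of _ Y] bracket_fmul_right intro!: vfield_eqI)

lemma jacobi:
  assumes "X \<in> vector_fields A" "Y \<in> vector_fields A" "Z \<in> vector_fields A"
  shows "bracket X (bracket Y Z) = bracket (bracket X Y) Z + bracket Y (bracket X Z)"
proof (rule vfield_eqI)
  fix p u
  show "bracket X (bracket Y Z) p u = (bracket (bracket X Y) Z + bracket Y (bracket X Z)) p u"
    unfolding bracket_def
    by (cases "u \<in> smooth_functions A")
      (use assms in \<open>simp_all add: deriv_along_bracket[unfolded bracket_def] deriv_along_nonsmooth deriv_along_apply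
        tangent_diff[OF field_tangent] tangent_nonsmooth[OF field_tangent] tangent_zero[OF field_tangent] algebra_simps\<close>)
qed

section \<open>Linearity of one-forms and of endomorphism fields\<close>

lemma one_form_smooth: "one_form A \<eta> \<Longrightarrow> X \<in> vector_fields A \<Longrightarrow> \<eta> X \<in> smooth_functions A"
  by (simp add: one_form_def)

lemma one_form_add: "one_form A \<eta> \<Longrightarrow> X \<in> vector_fields A \<Longrightarrow> Y \<in> vector_fields A \<Longrightarrow> \<eta> (X + Y) = \<eta> X + \<eta> Y"
  by (simp add: one_form_def)

lemma one_form_fmul: "one_form A \<eta> \<Longrightarrow> f \<in> smooth_functions A \<Longrightarrow> X \<in> vector_fields A \<Longrightarrow> \<eta> (f \<cdot> X) = f * \<eta> X"
  by (simp add: one_form_def)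

lemma one_form_cmul: "one_form A \<eta> \<Longrightarrow> X \<in> vector_fields A \<Longrightarrow> \<eta> (r \<cdot>\<^sub>\<real> X) = (\<lambda>p. r * \<eta> X p)"
  unfolding cmul_def by (auto simp: one_form_fmul)

lemma one_form_uminus: "one_form A \<eta> \<Longrightarrow> X \<in> vector_fields A \<Longrightarrow> \<eta> (- X) = - \<eta> X"
proof -
  assume "one_form A \<eta>" "X \<in> vector_fields A"
  moreover have "- X = (-1) \<cdot>\<^sub>\<real> X" by (auto intro: vfield_eqI)
  ultimately show ?thesis using one_form_cmul[of \<eta> X "-1"] by auto
qed

lemma one_form_diff:
  "one_form A \<eta> \<Longrightarrow> X \<in> vector_fields A \<Longrightarrow> Y \<in> vector_fields A \<Longrightarrow> \<eta> (X - Y) = \<eta> X - \<eta> Y"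
  using one_form_add[of \<eta> X "- Y"] by (auto simp: one_form_uminus)

lemma one_form_zero: "one_form A \<eta> \<Longrightarrow> \<eta> 0 = 0"
  using one_form_diff[of \<eta> 0 0] by simp

lemma endo_field_field: "endo_field A \<phi> \<Longrightarrow> X \<in> vector_fields A \<Longrightarrow> \<phi> X \<in> vector_fields A"
  by (simp add: endo_field_def)

lemma endo_add: "endo_field A \<phi> \<Longrightarrow> X \<in> vector_fields A \<Longrightarrow> Y \<in> vector_fields A \<Longrightarrow> \<phi> (X + Y) = \<phi> X + \<phi> Y"
  by (simp add: endo_field_def)

lemma endo_fmul: "endo_field A \<phi> \<Longrightarrow> f \<in> smooth_functions A \<Longrightarrow> X \<in> vector_fields A \<Longrightarrow> \<phi> (f \<cdot> X) = f \<cdot> \<phi> X"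
  by (simp add: endo_field_def)

lemma endo_cmul: "endo_field A \<phi> \<Longrightarrow> X \<in> vector_fields A \<Longrightarrow> \<phi> (r \<cdot>\<^sub>\<real> X) = r \<cdot>\<^sub>\<real> \<phi> X"
  unfolding cmul_def by (simp only: endo_fmul smooth_const)

lemma endo_uminus: "endo_field A \<phi> \<Longrightarrow> X \<in> vector_fields A \<Longrightarrow> \<phi> (- X) = - \<phi> X"
proof -
  assume "endo_field A \<phi>" "X \<in> vector_fields A"
  moreover have "- X = (-1) \<cdot>\<^sub>\<real> X" by (auto intro: vfield_eqI)
  ultimately show ?thesis using endo_cmul[of \<phi> X "-1"] by (auto intro: vfield_eqI)
qed

lemma endo_diff:
  "endo_field A \<phi> \<Longrightarrow> X \<in> vector_fields A \<Longrightarrow> Y \<in> vector_fields A \<Longrightarrow> \<phi> (X - Y) = \<phi> X - \<phi> Y"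
  unfolding diff_conv_add_uminus by (simp only: endo_add endo_uminus field_uminus)

lemma endo_zero: "endo_field A \<phi> \<Longrightarrow> \<phi> 0 = 0"
  using endo_diff[of \<phi> 0 0] by simp

end

lemma smooth_manifold_open_atlas: "smooth_manifold A \<Longrightarrow> open_atlas A"
  by (force simp: open_atlas_def smooth_manifold_def is_chart_def)

section \<open>Riemannian metrics and their values at a point\<close>

locale riemannian = open_atlas A for A :: "('a, 'e::euclidean_space) atlas" +
  fixes g :: "'a form2"
  assumes metric: "riemannian_metric A g"
begin

lemma metric_form: "X \<in> vector_fields A \<Longrightarrow> one_form A (g X)"
  using metric by (simp add: riemannian_metric_def)

lemma metric_sym: "X \<in> vector_fields A \<Longrightarrow> Y \<in> vector_fields A \<Longrightarrow> g X Y = g Y X"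
  using metric by (simp add: riemannian_metric_def)

lemma metric_nonneg: "X \<in> vector_fields A \<Longrightarrow> 0 \<le> g X X p"
  using metric by (simp add: riemannian_metric_def)

lemma metric_zero_iff: "X \<in> vector_fields A \<Longrightarrow> g X X p = 0 \<longleftrightarrow> X p = 0"
  using metric by (simp add: riemannian_metric_def)

lemma metric_smooth [simp]:
  "X \<in> vector_fields A \<Longrightarrow> Y \<in> vector_fields A \<Longrightarrow> g X Y \<in> smooth_functions A"
  by (simp add: metric_form one_form_smooth)

lemma metric_right:
  assumes "X \<in> vector_fields A" "Y \<in> vector_fields A" "Z \<in> vector_fields A"
  shows "g X (Y + Z) p = g X Y p + g X Z p" "g X (Y - Z) p = g X Y p - g X Z p"
  using one_form_add[OF metric_form] one_form_diff[OF metric_form] assms by auto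

lemma metric_right':
  assumes "X \<in> vector_fields A" "Y \<in> vector_fields A"
  shows "f \<in> smooth_functions A \<Longrightarrow> g X (f \<cdot> Y) p = f p * g X Y p"
    "g X (r \<cdot>\<^sub>\<real> Y) p = r * g X Y p" "g X (- Y) p = - g X Y p" "g X 0 p = 0"
  using one_form_fmul[OF metric_form] one_form_cmul[OF metric_form] one_form_uminus[OF metric_form]
    one_form_zero[OF metric_form] assms by auto

lemma metric_left:
  assumes "X \<in> vector_fields A" "Y \<in> vector_fields A" "Z \<in> vector_fields A"
  shows "g (X + Y) Z p = g X Z p + g Y Z p" "g (X - Y) Z p = g X Z p - g Y Z p"
  using metric_right[of Z X Y p] assms by (auto simp: metric_sym[of _ Z])

lemma metric_left':
  assumes "X \<in> vector_fields A" "Y \<in> vector_fields A"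
  shows "f \<in> smooth_functions A \<Longrightarrow> g (f \<cdot> X) Y p = f p * g X Y p"
    "g (r \<cdot>\<^sub>\<real> X) Y p = r * g X Y p" "g (- X) Y p = - g X Y p" "g 0 Y p = 0"
  using metric_right'[of Y X] assms by (auto simp: metric_sym[of _ Y])

lemmas metric_simps = metric_left metric_left' metric_right metric_right'

text \<open>By Cauchy--Schwarz the value of \<open>g X Y\<close> at \<open>p\<close> depends on \<open>X p\<close> only.\<close>

lemma metric_pointwise:
  assumes X: "X \<in> vector_fields A" and Y: "Y \<in> vector_fields A" and 0: "X p = 0"
  shows "g X Y p = 0"
proof (rule ccontr)
  assume n: "g X Y p \<noteq> 0"
  have xx: "g X X p = 0" using metric_zero_iff[OF X] 0 by simp
  \<comment> \<open>As g(X, X) = 0 at p, the square of r X + Y there is affine in r; this r gives it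
    the value -1.\<close>
  define r where "r = - (g Y Y p + 1) / (2 * g X Y p)"
  have "0 \<le> g (r \<cdot>\<^sub>\<real> X + Y) (r \<cdot>\<^sub>\<real> X + Y) p"
    using X Y by (simp add: metric_nonneg)
  also have "\<dots> = r * (2 * g X Y p) + g Y Y p"
    using X Y xx by (simp add: metric_simps metric_sym[of Y X])
  also have "\<dots> = - 1" using n by (simp add: r_def)
  finally show False by simp
qed

lemma metric_cong_point:
  assumes "X \<in> vector_fields A" "X' \<in> vector_fields A" "Y \<in> vector_fields A" "Y' \<in> vector_fields A"
    and "X p = X' p" "Y p = Y' p"
  shows "g X Y p = g X' Y' p"
  using metric_pointwise[of "X - X'" Y p] metric_pointwise[of "Y - Y'" X' p] assms
  by (simp add: metric_simps metric_sym[of X'])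

lemma metric_nondegenerate:
  assumes "X \<in> vector_fields A" "\<And>Z p. Z \<in> vector_fields A \<Longrightarrow> g X Z p = 0"
  shows "X = 0"
  using assms metric_zero_iff[of X] by (auto intro!: ext[of X])

lemma metric_ext:
  assumes "X \<in> vector_fields A" "Y \<in> vector_fields A"
    "\<And>Z p. Z \<in> vector_fields A \<Longrightarrow> g X Z p = g Y Z p"
  shows "X = Y"
  using metric_nondegenerate[of "X - Y"] assms by (simp add: metric_simps)

end

section \<open>Global frames\<close>

text \<open>Integrate the derivative of f along the segment from x to y: \<open>G i y\<close> is the
  mean of the i-th partial derivative over that segment.\<close>

lemma hadamard:
  fixes f :: "'e::euclidean_space \<Rightarrow> real"
  assumes B: "open B" "convex B" and f: "smooth_on B f" and x: "x \<in> B"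
  obtains G where "\<And>i. smooth_on B (G i)"
    "\<And>y. y \<in> B \<Longrightarrow> f y = f x + (\<Sum>i\<in>Basis. ((y - x) \<bullet> i) * G i y)"
    "\<And>i. G i x = frechet_derivative f (at x) i"
proof -
  define K where "K i p = frechet_derivative f (at (x + fst p *\<^sub>R (snd p - x))) i" for i :: 'e and p :: "real \<times> 'e"
  define G where "G i y = integral {0..1} (\<lambda>u. K i (u, y))" for i y
  let ?l = "\<lambda>p :: real \<times> 'e. x + fst p *\<^sub>R (snd p - x)"
  \<comment> \<open>An open domain for the kernel: u may leave the unit interval as long as the
    point on the line through x and y stays in B.\<close>
  define W where "W = ?l -` B"
  have W: "open W"
    unfolding W_def by (rule open_vimage[OF B(1)]) (intro continuous_intros)
  have seg: "x + u *\<^sub>R (y - x) \<in> B" if "0 \<le> u" "u \<le> 1" "y \<in> B" for u y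
    using convexD_alt[OF B(2) x that(3), of u] that by (simp add: algebra_simps)
  have "smooth_on B (G i)" for i
    unfolding G_def[abs_def]
  proof (rule smooth_on_integral[OF B W])
    show "{0..1} \<times> B \<subseteq> W" using seg by (auto simp: W_def)
    have "smooth_on W (\<lambda>p. fst p *\<^sub>R (snd p - x))"
      by (rule smooth_on_scaleR) (intro W smooth_on_fst smooth_on_minus smooth_on_snd smooth_on_const)+
    then have "smooth_on W ?l"
      by (intro smooth_on_add W smooth_on_const)
    then show "smooth_on W (K i)"
      unfolding K_def[abs_def]
      by (rule smooth_on_compose[OF W smooth_on_frechet[OF f]]) (auto simp: W_def)
  qed
  moreover have "f y = f x + (\<Sum>i\<in>Basis. ((y - x) \<bullet> i) * G i y)" if y: "y \<in> B" for y
  proof -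
    have cont: "continuous_on {0..1} (\<lambda>u. K i (u, y))" for i
      unfolding K_def fst_conv snd_conv
      by (rule continuous_on_compose2[OF smooth_on_continuous[OF smooth_on_frechet[OF f]]])
        (use seg y in \<open>auto intro!: continuous_intros\<close>)
    have d: "((\<lambda>u. f (x + u *\<^sub>R (y - x))) has_vector_derivative
        (\<Sum>i\<in>Basis. ((y - x) \<bullet> i) * K i (u, y))) (at u within {0..1})" if u: "u \<in> {0..1}" for u
    proof -
      have b: "x + u *\<^sub>R (y - x) \<in> B" using seg u y by auto
      note fd = smooth_on_deriv[OF f b]
      have "((\<lambda>u. x + u *\<^sub>R (y - x)) has_derivative (\<lambda>v. v *\<^sub>R (y - x))) (at u)"
        by (auto intro!: derivative_eq_intros)
      from has_derivative_compose[OF this fd]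
      have "((\<lambda>u. f (x + u *\<^sub>R (y - x))) has_derivative
          (\<lambda>v. frechet_derivative f (at (x + u *\<^sub>R (y - x))) (v *\<^sub>R (y - x)))) (at u)" .
      moreover have "frechet_derivative f (at (x + u *\<^sub>R (y - x))) (v *\<^sub>R (y - x)) =
          v *\<^sub>R (\<Sum>i\<in>Basis. ((y - x) \<bullet> i) * K i (u, y))" for v
        using linear_basis_expansion[OF has_derivative_linear[OF fd], of "y - x"]
          linear_cmul[OF has_derivative_linear[OF fd], of v "y - x"] by (simp add: K_def)
      ultimately show ?thesis
        unfolding has_vector_derivative_def by (simp add: has_derivative_at_withinI)
    qed
    have "((\<lambda>u. \<Sum>i\<in>Basis. ((y - x) \<bullet> i) * K i (u, y)) has_integral f (x + 1 *\<^sub>R (y - x)) - f (x + 0 *\<^sub>R (y - x))) {0..1}"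
      by (rule fundamental_theorem_of_calculus) (use d in auto)
    moreover have "((\<lambda>u. \<Sum>i\<in>Basis. ((y - x) \<bullet> i) * K i (u, y)) has_integral (\<Sum>i\<in>Basis. ((y - x) \<bullet> i) * G i y)) {0..1}"
      unfolding G_def
      by (intro has_integral_sum has_integral_mult_right integrable_integral finite_Basis)
        (rule integrable_continuous_interval[OF cont])
    ultimately have "f (x + 1 *\<^sub>R (y - x)) - f (x + 0 *\<^sub>R (y - x)) = (\<Sum>i\<in>Basis. ((y - x) \<bullet> i) * G i y)"
      by (rule has_integral_unique)
    then show ?thesis by simp
  qed
  moreover have "G i x = frechet_derivative f (at x) i" for i
    by (simp add: G_def K_def)
  ultimately show ?thesis using that by blast
qed

lemma times_line_open:
  assumes "open (c ` U)"
  shows "open ((\<lambda>(p, t). (c p, t)) ` (U \<times> (UNIV :: real set)))"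
proof -
  have "(\<lambda>(p, t). (c p, t)) ` (U \<times> (UNIV :: real set)) = c ` U \<times> UNIV" by force
  then show ?thesis using assms by (simp add: open_Times)
qed

definition extend_by_zero :: "'a set \<Rightarrow> ('a \<Rightarrow> 'e) \<Rightarrow> 'e set \<Rightarrow> ('e \<Rightarrow> real) \<Rightarrow> 'a \<Rightarrow> real" where
  "extend_by_zero U c B u p = (if p \<in> U \<and> c p \<in> B then u (c p) else 0)"

section \<open>Functions in the charts of M and of M x R\<close>

locale manifold =
  fixes A :: "('a::{t2_space,second_countable_topology}, 'e::euclidean_space) atlas"
  assumes manifold: "smooth_manifold A"
begin

abbreviation A' :: "('a \<times> real, 'e \<times> real) atlas" where "A' \<equiv> times_line_atlas A"

sublocale open_atlas A
  using manifold by (rule smooth_manifold_open_atlas)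

lemma open_atlas_times_line: "open_atlas A'"
proof
  fix W d assume "(W, d) \<in> A'"
  then obtain U c where Uc: "(U, c) \<in> A" and eq: "W = U \<times> UNIV" "d = (\<lambda>(p, t). (c p, t))"
    by (auto simp: times_line_atlas_def)
  show "open (d ` W)" unfolding eq by (rule times_line_open[OF open_charts[OF Uc]])
qed

sublocale line: open_atlas A'
  by (rule open_atlas_times_line)

lemma chart:
  assumes "(U, c) \<in> A"
  shows "open U" "open (c ` U)" "homeomorphism U (c ` U) c (inv_into U c)" "inj_on c U"
proof -
  have "is_chart (U, c)" using manifold assms by (auto simp: smooth_manifold_def)
  then show "open U" "open (c ` U)" and h: "homeomorphism U (c ` U) c (inv_into U c)"
    by (auto simp: is_chart_def)
  then show "inj_on c U" by (metis homeomorphism_def inj_on_inverseI)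
qed

lemma chart_open_image:
  assumes "(U, c) \<in> A" "open W"
  shows "open (c ` (U \<inter> W))"
proof -
  have "openin (top_of_set (c ` U)) (c ` (U \<inter> W))"
    using homeomorphism_imp_open_map[OF chart(3)[OF assms(1)]] assms(2) by (simp add: openin_open_Int)
  then show ?thesis using openin_open_trans chart(2)[OF assms(1)] by blast
qed

lemma chart_transition:
  assumes "(U, c) \<in> A" "(V, d) \<in> A"
  shows "smooth_on (d ` (U \<inter> V)) (\<lambda>y. c (inv_into V d y))"
  using manifold assms by (fastforce simp: smooth_manifold_def smoothly_compatible_def o_def)

lemma inv_chart_times_line:
  assumes "(U, c) \<in> A" "x \<in> c ` U"
  shows "inv_into (U \<times> (UNIV :: real set)) (\<lambda>(p, t). (c p, t)) (x, t) = (inv_into U c x, t)"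
proof (rule inv_into_f_eq)
  show "inj_on (\<lambda>(p, t). (c p, t)) (U \<times> (UNIV :: real set))"
    using chart(4)[OF assms(1)] by (auto simp: inj_on_def)
qed (use assms in \<open>auto simp: inv_into_into f_inv_into_f\<close>)

lemma smooth_times_line_iff:
  "F \<in> smooth_functions A' \<longleftrightarrow>
    (\<forall>(U, c)\<in>A. smooth_on (c ` U \<times> UNIV) (\<lambda>p. F (inv_into U c (fst p), snd p)))"
proof -
  have "smooth_on ((\<lambda>(p, t). (c p, t)) ` (U \<times> (UNIV :: real set)))
      (F \<circ> inv_into (U \<times> UNIV) (\<lambda>(p, t). (c p, t))) \<longleftrightarrow>
    smooth_on (c ` U \<times> UNIV) (\<lambda>p. F (inv_into U c (fst p), snd p))" if Uc: "(U, c) \<in> A" for U c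
  proof -
    have "(\<lambda>(p, t). (c p, t)) ` (U \<times> (UNIV :: real set)) = c ` U \<times> UNIV" by force
    moreover have "open (c ` U \<times> (UNIV :: real set))" using chart(2)[OF Uc] by (simp add: open_Times)
    ultimately show ?thesis
      using inv_chart_times_line[OF Uc] by (auto intro!: smooth_on_cong)
  qed
  then show ?thesis
    by (force simp: smooth_functions_def times_line_atlas_def)
qed

lemma smooth_times_lineI:
  assumes "\<And>U c. (U, c) \<in> A \<Longrightarrow> smooth_on (c ` U \<times> UNIV) (\<lambda>p. F (inv_into U c (fst p), snd p))"
  shows "F \<in> smooth_functions A'"
  using assms by (auto simp: smooth_times_line_iff)

lemma smooth_iff: "f \<in> smooth_functions A \<longleftrightarrow> (\<forall>(U, c)\<in>A. smooth_on (c ` U) (\<lambda>x. f (inv_into U c x)))"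
  by (auto simp: smooth_functions_def o_def)

lemma smooth_slice:
  assumes F: "F \<in> smooth_functions A'"
  shows "(\<lambda>q. F (q, t)) \<in> smooth_functions A"
  unfolding smooth_iff
proof clarify
  fix U c assume Uc: "(U, c) \<in> A"
  have "smooth_on (c ` U) (\<lambda>x. (x, t))"
    using chart(2)[OF Uc] by (intro smooth_on_Pair smooth_on_ident smooth_on_const)
  moreover have "smooth_on (c ` U \<times> UNIV) (\<lambda>p. F (inv_into U c (fst p), snd p))"
    using F Uc by (auto simp: smooth_times_line_iff)
  ultimately show "smooth_on (c ` U) (\<lambda>x. F (inv_into U c x, t))"
    using smooth_on_compose[OF chart(2)[OF Uc], of "c ` U \<times> UNIV" "\<lambda>p. F (inv_into U c (fst p), snd p)" "\<lambda>x. (x, t)"]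
    by auto
qed

lemma smooth_fst_iff: "f \<circ> fst \<in> smooth_functions A' \<longleftrightarrow> f \<in> smooth_functions A"
proof
  assume "f \<circ> fst \<in> smooth_functions A'"
  from smooth_slice[OF this, of 0] show "f \<in> smooth_functions A" by simp
next
  assume f: "f \<in> smooth_functions A"
  show "f \<circ> fst \<in> smooth_functions A'"
  proof (rule smooth_times_lineI)
    fix U c assume Uc: "(U, c) \<in> A"
    have o: "open (c ` U \<times> (UNIV :: real set))" using chart(2)[OF Uc] by (simp add: open_Times)
    have "smooth_on (c ` U) (\<lambda>x. f (inv_into U c x))" using f Uc by (auto simp: smooth_iff)
    have "smooth_on (c ` U \<times> (UNIV :: real set)) (\<lambda>p. f (inv_into U c (fst p)))"
      by (rule smooth_on_compose[OF o \<open>smooth_on (c ` U) _\<close> smooth_on_fst[OF o]]) auto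
    then show "smooth_on (c ` U \<times> UNIV) (\<lambda>p. (f \<circ> fst) (inv_into U c (fst p), snd p :: real))"
      by simp
  qed
qed

lemma smooth_snd: "snd \<in> smooth_functions A'"
proof (rule smooth_times_lineI)
  fix U c assume Uc: "(U, c) \<in> A"
  have "open (c ` U \<times> (UNIV :: real set))" using chart(2)[OF Uc] by (simp add: open_Times)
  then show "smooth_on (c ` U \<times> UNIV) (\<lambda>p. snd (inv_into U c (fst p), snd p :: real))"
    using smooth_on_snd by simp
qed

lemma smooth_inverse:
  assumes "f \<in> smooth_functions A" "\<And>p. f p \<noteq> 0"
  shows "(\<lambda>p. inverse (f p)) \<in> smooth_functions A"
  using assms chart(2) by (fastforce simp: smooth_iff intro!: smooth_on_inverse)

text \<open>Locally there are two cases. Over B the function is u after a smooth change of charts;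
  off the preimage of K, which is compact and hence closed in the Hausdorff space M, it is zero. The
  variable t is carried along because the frame fields must act smoothly on functions on M x
  R.\<close>

lemma smooth_extend_times_line:
  assumes Uc: "(U, c) \<in> A" and B: "open B" "B \<subseteq> c ` U" and K: "compact K" "K \<subseteq> B"
    and u: "smooth_on (B \<times> UNIV) u" and 0: "\<And>x t. x \<in> B - K \<Longrightarrow> u (x, t) = 0"
  shows "(\<lambda>(p, t). extend_by_zero U c B (\<lambda>x. u (x, t)) p) \<in> smooth_functions A'"
proof (rule smooth_times_lineI)
  fix V d assume Vd: "(V, d) \<in> A"
  define di where "di = inv_into V d"
  define ci where "ci = inv_into U c"
  have c: "continuous_on U c" "continuous_on (c ` U) ci" "\<And>p. p \<in> U \<Longrightarrow> ci (c p) = p"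
    using chart(3)[OF Uc] by (auto simp: homeomorphism_def ci_def)
  have di: "di (d p) = p" if "p \<in> V" for p
    using chart(3)[OF Vd] that by (auto simp: homeomorphism_def di_def)
  define U' where "U' = U \<inter> c -` B"
  have U': "open U'"
    unfolding U'_def using continuous_open_preimage[OF c(1) chart(1)[OF Uc] B(1)] by (simp add: Int_commute)
  have "compact (ci ` K)"
    using K B(2) by (intro compact_continuous_image continuous_on_subset[OF c(2)]) auto
  then have K': "open (- (ci ` K))" by (intro open_Compl compact_imp_closed)
  let ?G = "\<lambda>p :: 'e \<times> real. extend_by_zero U c B (\<lambda>x. u (x, snd p)) (di (fst p))"
  have "smooth_on (d ` V \<times> UNIV) ?G"
  proof (rule smooth_on_local)
    fix z :: "'e \<times> real" assume z: "z \<in> d ` V \<times> UNIV"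
    then obtain p where p: "p \<in> V" "fst z = d p" by auto
    show "\<exists>T. open T \<and> z \<in> T \<and> smooth_on T ?G"
    proof (cases "p \<in> U'")
      case True
      let ?T = "d ` (V \<inter> U') \<times> (UNIV :: real set)"
      have T: "open ?T" using chart_open_image[OF Vd U'] by (simp add: open_Times)
      have "d ` (V \<inter> U') \<subseteq> d ` (U \<inter> V)" by (auto simp: U'_def)
      from smooth_on_subset[OF chart_transition[OF Uc Vd] this]
      have "smooth_on (d ` (V \<inter> U')) (\<lambda>y. c (di y))" by (simp add: di_def)
      from smooth_on_compose[OF T this smooth_on_fst[OF T]]
      have "smooth_on ?T (\<lambda>p. c (di (fst p)))" by auto
      from smooth_on_Pair[OF T this smooth_on_snd[OF T]]
      have s: "smooth_on ?T (\<lambda>p. (c (di (fst p)), snd p))" .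
      have "smooth_on ?T (\<lambda>p. u (c (di (fst p)), snd p))"
        by (rule smooth_on_compose[OF T u s]) (auto simp: di U'_def)
      moreover have "smooth_on ?T (\<lambda>p. u (c (di (fst p)), snd p)) \<longleftrightarrow> smooth_on ?T ?G"
        by (rule smooth_on_cong[OF T]) (auto simp: extend_by_zero_def di U'_def)
      ultimately show ?thesis using T p True by (intro exI[of _ ?T]) (auto simp: mem_Times_iff)
    next
      case False
      let ?T = "d ` (V \<inter> - (ci ` K)) \<times> (UNIV :: real set)"
      have T: "open ?T" using chart_open_image[OF Vd K'] by (simp add: open_Times)
      have "p \<notin> ci ` K"
      proof
        assume "p \<in> ci ` K"
        then obtain x where x: "x \<in> K" "p = ci x" by auto
        then obtain q where "q \<in> U" "x = c q" using K(2) B(2) by auto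
        then show False using False x K(2) c(3) by (auto simp: U'_def)
      qed
      moreover have "?G p = 0" if pT: "p \<in> ?T" for p
      proof -
        obtain q where q: "q \<in> V" "q \<notin> ci ` K" "fst p = d q" using pT by (auto simp: mem_Times_iff)
        have "c q \<notin> K" if "q \<in> U" using q(2) c(3)[OF that] by force
        then show ?thesis using q di 0 by (auto simp: extend_by_zero_def)
      qed
      then have "smooth_on ?T (\<lambda>p. 0 :: real) \<longleftrightarrow> smooth_on ?T ?G"
        by (intro smooth_on_cong[OF T]) auto
      ultimately show ?thesis
        using T p smooth_on_const[OF T] by (intro exI[of _ ?T]) (auto simp: mem_Times_iff)
    qed
  qed
  then show "smooth_on (d ` V \<times> UNIV)
      (\<lambda>p. case (inv_into V d (fst p), snd p) of (p, t) \<Rightarrow> extend_by_zero U c B (\<lambda>x. u (x, t)) p)"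
    by (simp add: di_def)
qed

lemma smooth_extend:
  assumes "(U, c) \<in> A" "open B" "B \<subseteq> c ` U" "compact K" "K \<subseteq> B"
    and u: "smooth_on B u" and "\<And>x. x \<in> B - K \<Longrightarrow> u x = 0"
  shows "extend_by_zero U c B u \<in> smooth_functions A"
proof -
  have o: "open (B \<times> (UNIV :: real set))" using assms(2) by (simp add: open_Times)
  have "smooth_on (B \<times> (UNIV :: real set)) (\<lambda>p. u (fst p))"
    by (rule smooth_on_compose[OF o u smooth_on_fst[OF o]]) auto
  from smooth_extend_times_line[OF assms(1-5) this] assms(7)
  have "(\<lambda>(p, t :: real). extend_by_zero U c B u p) \<in> smooth_functions A'" by simp
  from smooth_slice[OF this, of 0] show ?thesis by simp
qed

text \<open>Joint smoothness in (p, t) is demanded here, since it does not follow formally from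
  smoothness for each fixed t. For compact M every vector field turns out to have it, see
  \<open>lift_field'\<close>.\<close>

definition liftable_fields :: "'a vfield set" where
  "liftable_fields = {E \<in> vector_fields A. \<forall>F\<in>smooth_functions A'.
     (\<lambda>(p, t). E p (\<lambda>q. F (q, t))) \<in> smooth_functions A'}"

lemma liftable_fmul:
  assumes "f \<in> smooth_functions A" "E \<in> liftable_fields"
  shows "f \<cdot> E \<in> liftable_fields"
proof -
  have "(\<lambda>(p, t). (f \<cdot> E) p (\<lambda>q. F (q, t))) \<in> smooth_functions A'" if F: "F \<in> smooth_functions A'" for F
  proof -
    have "(f \<circ> fst) * (\<lambda>(p, t). E p (\<lambda>q. F (q, t))) \<in> smooth_functions A'"
      using assms F by (intro line.smooth_mult) (auto simp: smooth_fst_iff liftable_fields_def)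
    also have "(f \<circ> fst) * (\<lambda>(p, t). E p (\<lambda>q. F (q, t))) = (\<lambda>(p, t). (f \<cdot> E) p (\<lambda>q. F (q, t)))"
      by auto
    finally show ?thesis .
  qed
  then show ?thesis using assms by (simp add: liftable_fields_def)
qed

text \<open>The coordinate field of direction b in the chart, multiplied by the cut-off function
  u.\<close>

definition coord_field :: "'a set \<Rightarrow> ('a \<Rightarrow> 'e) \<Rightarrow> 'e set \<Rightarrow> ('e \<Rightarrow> real) \<Rightarrow> 'e \<Rightarrow> 'a vfield" where
  "coord_field U c B u b = (\<lambda>p f. if f \<in> smooth_functions A
     then extend_by_zero U c B (\<lambda>x. u x * frechet_derivative (\<lambda>y. f (inv_into U c y)) (at x) b) p else 0)"

lemma coord_field_liftable:
  assumes Uc: "(U, c) \<in> A" and B: "open B" "B \<subseteq> c ` U" and K: "compact K" "K \<subseteq> B"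
    and u: "smooth_on B u" and 0: "\<And>x. x \<in> B - K \<Longrightarrow> u x = 0"
  shows "coord_field U c B u b \<in> liftable_fields"
proof -
  let ?E = "coord_field U c B u b"
  have lift: "(\<lambda>(p, t). ?E p (\<lambda>q. F (q, t))) \<in> smooth_functions A'" if F: "F \<in> smooth_functions A'" for F
  proof -
    let ?F = "\<lambda>p. F (inv_into U c (fst p), snd p)"
    \<comment> \<open>The derivative of the slices of F in direction b is the derivative of
      \<open>?F\<close> in direction (b, 0), and so it is smooth in x and t together.\<close>
    define w where "w p = u (fst p) * frechet_derivative ?F (at p) (b, 0)" for p
    have o: "open (B \<times> (UNIV :: real set))" using B(1) by (simp add: open_Times)
    have "smooth_on (c ` U \<times> UNIV) ?F" using F Uc by (auto simp: smooth_times_line_iff)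
    then have F': "smooth_on (B \<times> UNIV) ?F" by (rule smooth_on_subset) (use B(2) in auto)
    have "smooth_on (B \<times> (UNIV :: real set)) (\<lambda>p. u (fst p))"
      by (rule smooth_on_compose[OF o u smooth_on_fst[OF o]]) auto
    then have w: "smooth_on (B \<times> UNIV) w"
      unfolding w_def[abs_def] by (intro smooth_on_mult o smooth_on_frechet F')
    have "w (x, t) = u x * frechet_derivative (\<lambda>y. F (inv_into U c y, t)) (at x) b" if x: "x \<in> B" for x t
    proof -
      have "((\<lambda>y. (y, t)) has_derivative (\<lambda>v. (v, 0))) (at x)"
        by (auto intro!: derivative_eq_intros)
      moreover have "(?F has_derivative frechet_derivative ?F (at (x, t))) (at (x, t))"
        by (rule smooth_on_deriv[OF F']) (use x in auto)
      ultimately have "((\<lambda>y. ?F (y, t)) has_derivative (\<lambda>v. frechet_derivative ?F (at (x, t)) (v, 0))) (at x)"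
        by (rule has_derivative_compose)
      from frechet_derivative_at[OF this] have "frechet_derivative (\<lambda>y. F (inv_into U c y, t)) (at x) b =
          frechet_derivative ?F (at (x, t)) (b, 0)" by (simp add: fun_eq_iff)
      then show ?thesis by (simp add: w_def)
    qed
    then have eq: "extend_by_zero U c B (\<lambda>x. w (x, t)) p = ?E p (\<lambda>q. F (q, t))" for p t
      using smooth_slice[OF F] by (simp add: coord_field_def extend_by_zero_def)
    have "(\<lambda>(p, t). extend_by_zero U c B (\<lambda>x. w (x, t)) p) \<in> smooth_functions A'"
      by (rule smooth_extend_times_line[OF Uc B K w]) (use 0 in \<open>auto simp: w_def\<close>)
    then show ?thesis by (simp add: eq)
  qed
  have "(\<lambda>p. ?E p f) \<in> smooth_functions A" if "f \<in> smooth_functions A" for f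
    using smooth_slice[OF lift[of "f \<circ> fst"], of 0] that by (simp add: smooth_fst_iff)
  moreover have "?E p \<in> tangent_space A p" for p
  proof (cases "p \<in> U \<and> c p \<in> B")
    case False
    then show ?thesis by (auto simp: tangent_space_def coord_field_def extend_by_zero_def)
  next
    case True
    let ?d = "\<lambda>f. frechet_derivative (\<lambda>y. f (inv_into U c y)) (at (c p))"
    have E: "?E p f = (if f \<in> smooth_functions A then u (c p) * ?d f b else 0)" for f
      using True by (auto simp: coord_field_def extend_by_zero_def)
    have d: "((\<lambda>y. f (inv_into U c y)) has_derivative ?d f) (at (c p))" if "f \<in> smooth_functions A" for f
      using that Uc True by (auto simp: smooth_iff intro!: smooth_on_deriv[of "c ` U"])
    have p: "inv_into U c (c p) = p" using True chart(4)[OF Uc] by simp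
    have "?d (f + g) b = ?d f b + ?d g b" if "f \<in> smooth_functions A" "g \<in> smooth_functions A" for f g
      using fun_cong[OF frechet_derivative_at[OF has_derivative_add[OF d[OF that(1)] d[OF that(2)]]], of b] by simp
    moreover have "?d (f * g) b = ?d f b * g p + f p * ?d g b" if "f \<in> smooth_functions A" "g \<in> smooth_functions A" for f g
      using fun_cong[OF frechet_derivative_at[OF has_derivative_mult[OF d[OF that(1)] d[OF that(2)]]], of b] p by simp
    moreover have "?d (\<lambda>q. r * f q) b = r * ?d f b" if "f \<in> smooth_functions A" for f r
    proof -
      have "((\<lambda>y. r * f (inv_into U c y)) has_derivative (\<lambda>v. r * ?d f v)) (at (c p))"
        by (rule has_derivative_mult_right[OF d[OF that]])
      from fun_cong[OF frechet_derivative_at[OF this], of b] show ?thesis by simp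
    qed
    ultimately show ?thesis
      unfolding tangent_space_def by (auto simp: E algebra_simps)
  qed
  ultimately show ?thesis using lift by (simp add: liftable_fields_def vector_fields_def)
qed

text \<open>A frame for the tangent vectors at the points where \<open>\<rho>\<close> does not vanish.\<close>

definition framed_by :: "('a \<Rightarrow> real) \<Rightarrow> (('a \<Rightarrow> real) \<times> 'a vfield) list \<Rightarrow> bool" where
  "framed_by \<rho> L \<longleftrightarrow> \<rho> \<in> smooth_functions A \<and> (\<forall>p. 0 \<le> \<rho> p) \<and>
     set L \<subseteq> smooth_functions A \<times> liftable_fields \<and>
     (\<forall>p. \<forall>v\<in>tangent_space A p. \<forall>f\<in>smooth_functions A. \<rho> p * v f = (\<Sum>(x, E)\<leftarrow>L. v x * E p f))"

text \<open>The coordinate functions of a chart and the Hadamard quotients are only local, while v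
  acts on global functions. So everything is multiplied by a bump function, and
  \<open>\<rho>\<close> records the powers of it that are lost.\<close>

lemma framed_by_chart:
  obtains W \<rho> L where "open W" "p\<^sub>0 \<in> W" "framed_by \<rho> L" "\<And>p. p \<in> W \<Longrightarrow> 0 < \<rho> p"
proof -
  obtain U c where Uc: "(U, c) \<in> A" "p\<^sub>0 \<in> U"
    using manifold by (fastforce simp: smooth_manifold_def)
  have "c p\<^sub>0 \<in> c ` U" using Uc by auto
  then obtain R where R: "R > 0" "ball (c p\<^sub>0) R \<subseteq> c ` U"
    using chart(2)[OF Uc(1)] open_contains_ball by blast
  define B where "B = ball (c p\<^sub>0) R"
  define K where "K = cball (c p\<^sub>0) (R / 2)"
  define \<beta> where "\<beta> = bump (c p\<^sub>0) (R / 2)"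
  have B: "open B" "convex B" "B \<subseteq> c ` U" and K: "compact K" "K \<subseteq> B"
    using R by (auto simp: B_def K_def)
  have \<beta>: "smooth_on B \<beta>" by (simp add: \<beta>_def smooth_on_bump B(1))
  have \<beta>0: "\<beta> x = 0" if "x \<in> B - K" for x
    using that R(1) by (auto simp: \<beta>_def K_def intro!: bump_zero)
  have "0 \<le> \<beta> x" for x by (simp add: \<beta>_def bump_def flat_def)
  have ext: "extend_by_zero U c B (\<lambda>x. \<beta> x * u x) \<in> smooth_functions A" if "smooth_on B u" for u
    by (rule smooth_extend[OF Uc(1) B(1,3) K smooth_on_mult[OF B(1) \<beta> that]]) (simp add: \<beta>0)
  define cut where "cut = extend_by_zero U c B (\<lambda>x. \<beta> x * 1)"
  define cutx where "cutx i = extend_by_zero U c B (\<lambda>x. \<beta> x * (x \<bullet> i))" for i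
  define E where "E i = coord_field U c B \<beta> i" for i
  have smooth: "cut \<in> smooth_functions A" "cutx i \<in> smooth_functions A" for i
    unfolding cut_def cutx_def
    by (intro ext smooth_on_const smooth_on_inner smooth_on_ident B(1))+
  have E: "E i \<in> liftable_fields" for i
    unfolding E_def by (rule coord_field_liftable[OF Uc(1) B(1,3) K \<beta> \<beta>0])
  obtain bs :: "'e list" where bs: "set bs = Basis" "distinct bs"
    using finite_distinct_list[OF finite_Basis] by blast
  define L where "L = map (\<lambda>i. (cutx i, cut \<cdot> E i)) bs @ map (\<lambda>i. (cut, (- cutx i) \<cdot> E i)) bs"
  \<comment> \<open>Two factors make the Hadamard expansion global; the third turns the number
    \<open>cut p * (c p \<bullet> i)\<close> into \<open>cutx i p\<close>, the value of a smooth
    function that can be absorbed into the fields of \<open>L\<close>.\<close>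
  define \<rho> where "\<rho> = cut * cut * cut"
  have id: "\<rho> p * v f = (\<Sum>(x, E)\<leftarrow>L. v x * E p f)"
    if v: "v \<in> tangent_space A p" and f: "f \<in> smooth_functions A" for p v f
  proof (cases "cut p = 0")
    case True
    then have "cutx i p = 0" for i by (auto simp: cut_def cutx_def extend_by_zero_def split: if_splits)
    then show ?thesis using True by (simp add: \<rho>_def L_def o_def split_beta)
  next
    case False
    then have p: "p \<in> U" "c p \<in> B" by (auto simp: cut_def extend_by_zero_def split: if_splits)
    let ?f = "\<lambda>y. f (inv_into U c y)"
    have "smooth_on (c ` U) ?f" using f Uc(1) by (auto simp: smooth_iff)
    then have f': "smooth_on B ?f" by (rule smooth_on_subset[OF _ B(3)])
    obtain G where G: "\<And>i. smooth_on B (G i)"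
      "\<And>y. y \<in> B \<Longrightarrow> ?f y = ?f (c p) + (\<Sum>i\<in>Basis. ((y - c p) \<bullet> i) * G i y)"
      "\<And>i. G i (c p) = frechet_derivative ?f (at (c p)) i"
      using hadamard[OF B(1,2) f' p(2)] by blast
    define \<psi> where "\<psi> i = extend_by_zero U c B (\<lambda>x. \<beta> x * G i x)" for i
    have psi: "\<psi> i \<in> smooth_functions A" for i
      unfolding \<psi>_def by (rule ext[OF G(1)])
    have psi_p: "\<psi> i p = E i p f" for i
      using p f by (simp add: \<psi>_def E_def coord_field_def extend_by_zero_def G(3))
    have cp: "cutx i p = cut p * (c p \<bullet> i)" for i
      using p by (simp add: cut_def cutx_def extend_by_zero_def)
    let ?D = "\<lambda>i. cutx i - (\<lambda>q. (c p \<bullet> i) * cut q)"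
    \<comment> \<open>This is Hadamard's expansion about \<open>c p\<close>, multiplied by
      \<open>cut\<close>^2. Under v the factor \<open>f - f p\<close> on the left and the factors
      \<open>?D i\<close> on the right vanish at p, so the product rule leaves \<open>cut\<close>^2
      v f on one side and the terms v(\<open>?D i\<close>) \<open>E i p f\<close> on the
      other.\<close>
    have "cut * cut * (f - (\<lambda>_. f p)) = (\<Sum>i\<leftarrow>bs. ?D i * \<psi> i)"
    proof
      fix q
      have sum: "(\<Sum>i\<leftarrow>bs. ?D i * \<psi> i) q = (\<Sum>i\<in>Basis. (cutx i q - (c p \<bullet> i) * cut q) * \<psi> i q)"
      proof -
        have *: "(\<Sum>i\<leftarrow>xs. ?D i * \<psi> i) q = (\<Sum>i\<leftarrow>xs. (cutx i q - (c p \<bullet> i) * cut q) * \<psi> i q)" for xs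
          by (induction xs) auto
        show ?thesis unfolding * using bs by (simp add: sum_list_distinct_conv_sum_set)
      qed
      show "(cut * cut * (f - (\<lambda>_. f p))) q = (\<Sum>i\<leftarrow>bs. ?D i * \<psi> i) q"
      proof (cases "q \<in> U \<and> c q \<in> B")
        case True
        then have "f q = f p + (\<Sum>i\<in>Basis. ((c q - c p) \<bullet> i) * G i (c q))"
          using G(2)[of "c q"] p chart(4)[OF Uc(1)] by simp
        then show ?thesis unfolding sum using True
          by (simp add: cut_def cutx_def \<psi>_def extend_by_zero_def sum_distrib_left inner_diff_left algebra_simps)
      next
        case False
        then show ?thesis unfolding sum by (auto simp: cut_def \<psi>_def extend_by_zero_def)
      qed
    qed
    then have "v (cut * cut * (f - (\<lambda>_. f p))) = v (\<Sum>i\<leftarrow>bs. ?D i * \<psi> i)" by simp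
    also have "v (\<Sum>i\<leftarrow>bs. ?D i * \<psi> i) = (\<Sum>i\<leftarrow>bs. v (?D i * \<psi> i))"
      using smooth psi by (intro tangent_sum_list[OF v]) simp
    also have "\<dots> = (\<Sum>i\<leftarrow>bs. (v (cutx i) - (c p \<bullet> i) * v cut) * E i p f)"
      using smooth psi psi_p cp
      by (simp add: tangent_mult[OF v] tangent_diff[OF v] tangent_cmult[OF v])
    also have "v (cut * cut * (f - (\<lambda>_. f p))) = cut p * cut p * v f"
      using smooth f by (simp add: tangent_mult[OF v] tangent_diff[OF v] tangent_const[OF v])
    finally have "cut p * (cut p * cut p * v f) = cut p * (\<Sum>i\<leftarrow>bs. (v (cutx i) - (c p \<bullet> i) * v cut) * E i p f)"
      by simp
    also have "\<dots> = (\<Sum>i\<leftarrow>bs. v (cutx i) * (cut p * E i p f)) + (\<Sum>i\<leftarrow>bs. v cut * (- cutx i p * E i p f))"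
      by (induction bs) (simp_all add: cp algebra_simps)
    finally show ?thesis by (simp add: \<rho>_def L_def o_def split_beta mult.assoc)
  qed
  have "framed_by \<rho> L"
    unfolding framed_by_def using smooth E id
    by (auto simp: \<rho>_def L_def cut_def extend_by_zero_def \<open>\<And>x. 0 \<le> \<beta> x\<close> intro!: liftable_fmul)
  moreover have "open (U \<inter> c -` ball (c p\<^sub>0) (R / 2))"
    using continuous_open_preimage[of U c] chart(1,3)[OF Uc(1)] by (auto simp: homeomorphism_def)
  moreover have "0 < \<rho> p" if "p \<in> U \<inter> c -` ball (c p\<^sub>0) (R / 2)" for p
  proof -
    have "\<beta> (c p) > 0" "c p \<in> B"
      using that R(1) bump_pos_iff[of "R / 2" "c p\<^sub>0" "c p"] by (auto simp: \<beta>_def B_def)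
    then show ?thesis using that by (simp add: \<rho>_def cut_def extend_by_zero_def)
  qed
  ultimately show ?thesis using that[of "U \<inter> c -` ball (c p\<^sub>0) (R / 2)"] Uc(2) R(1) by auto
qed

text \<open>The identities of \<open>framed_by\<close> are additive in \<open>\<rho>\<close> and in
  the list. Those of a finite subcover add up to one with \<open>\<rho>\<close> positive everywhere,
  and the fields are divided by this sum.\<close>

lemma global_frame:
  assumes "compact (UNIV :: 'a set)"
  obtains L where "set L \<subseteq> smooth_functions A \<times> liftable_fields"
    "\<And>p v f. v \<in> tangent_space A p \<Longrightarrow> f \<in> smooth_functions A \<Longrightarrow> v f = (\<Sum>(x, E)\<leftarrow>L. v x * E p f)"
proof -
  define C where "C = {W. open W \<and> (\<exists>\<rho> L. framed_by \<rho> L \<and> (\<forall>p\<in>W. 0 < \<rho> p))}"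
  have "\<exists>W\<in>C. p \<in> W" for p
    by (rule framed_by_chart[of p]) (auto simp: C_def)
  then have U: "UNIV \<subseteq> \<Union>C" by blast
  have op: "open W" if "W \<in> C" for W using that by (simp add: C_def)
  obtain D where D: "D \<subseteq> C" "finite D" "UNIV \<subseteq> \<Union>D"
    by (rule compactE[OF assms U op])
  from D(2,1) have "\<exists>\<rho> L. framed_by \<rho> L \<and> (\<forall>p\<in>\<Union>D. 0 < \<rho> p)"
  proof (induction D rule: finite_induct)
    case empty
    show ?case by (rule exI[of _ 0], rule exI[of _ "[]"]) (simp add: framed_by_def)
  next
    case (insert W D)
    then obtain \<rho> L where 1: "framed_by \<rho> L" "\<forall>p\<in>\<Union>D. 0 < \<rho> p" by auto
    obtain \<rho>' L' where 2: "framed_by \<rho>' L'" "\<forall>p\<in>W. 0 < \<rho>' p" using insert.prems by (auto simp: C_def)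
    have "framed_by (\<rho> + \<rho>') (L @ L')"
      using 1(1) 2(1) by (auto simp: framed_by_def distrib_right)
    moreover have "\<forall>p\<in>\<Union>(insert W D). 0 < (\<rho> + \<rho>') p"
      using 1 2 by (auto simp: framed_by_def intro: add_pos_nonneg add_nonneg_pos)
    ultimately show ?case by blast
  qed
  then obtain \<rho> L where L: "framed_by \<rho> L" "\<And>p. 0 < \<rho> p" using D(3) by blast
  have inv: "(\<lambda>p. inverse (\<rho> p)) \<in> smooth_functions A"
    using L by (intro smooth_inverse) (auto simp: framed_by_def less_imp_neq[symmetric])
  define L' where "L' = map (\<lambda>(x, E). (x, (\<lambda>p. inverse (\<rho> p)) \<cdot> E)) L"
  show ?thesis
  proof
    show "set L' \<subseteq> smooth_functions A \<times> liftable_fields"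
      using L(1) inv by (auto simp: L'_def framed_by_def intro!: liftable_fmul)
    fix p v f assume "v \<in> tangent_space A p" "f \<in> smooth_functions A"
    then have "\<rho> p * v f = (\<Sum>(x, E)\<leftarrow>L. v x * E p f)" using L(1) by (simp add: framed_by_def)
    then have "v f = inverse (\<rho> p) * (\<Sum>(x, E)\<leftarrow>L. v x * E p f)"
      using L(2)[of p] by (simp add: field_simps)
    also have "\<dots> = (\<Sum>(x, E)\<leftarrow>L'. v x * E p f)"
      by (simp add: L'_def o_def split_beta sum_list_const_mult[symmetric] mult_ac)
    finally show "v f = (\<Sum>(x, E)\<leftarrow>L'. v x * E p f)" .
  qed
qed

end

section \<open>Vector fields on the product with the line\<close>

context manifold
begin

lemma product_chart_derivative:
  assumes F: "F \<in> smooth_functions A'" and Uc: "(U, c) \<in> A" and x: "x \<in> c ` U"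
  shows "((\<lambda>s. F (inv_into U c x, s)) has_real_derivative
    frechet_derivative (\<lambda>p. F (inv_into U c (fst p), snd p)) (at (x, t)) (0, 1)) (at t)"
proof -
  let ?F = "\<lambda>p. F (inv_into U c (fst p), snd p)"
  have d: "((\<lambda>s. (x, s)) has_derivative (\<lambda>v. (0, v))) (at t)"
    by (auto intro!: derivative_eq_intros)
  have "smooth_on (c ` U \<times> UNIV) ?F" using F Uc by (auto simp: smooth_times_line_iff)
  then have f: "(?F has_derivative frechet_derivative ?F (at (x, t))) (at (x, t))"
    by (rule smooth_on_deriv) (use x in auto)
  have "frechet_derivative ?F (at (x, t)) (0, v) = frechet_derivative ?F (at (x, t)) (0, 1) * v" for v
    using linear_cmul[OF has_derivative_linear[OF f], of v "(0, 1)"] by (simp add: mult.commute)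
  then have "(\<lambda>v. frechet_derivative ?F (at (x, t)) (0, v)) = (*) (frechet_derivative ?F (at (x, t)) (0, 1))"
    by (rule ext)
  then show ?thesis
    unfolding has_field_derivative_def using has_derivative_compose[OF d f] by (simp only: fst_conv snd_conv)
qed

definition line_deriv :: "('a \<times> real \<Rightarrow> real) \<Rightarrow> 'a \<times> real \<Rightarrow> real" where
  "line_deriv F = (\<lambda>(p, t). deriv (\<lambda>s. F (p, s)) t)"

lemma line_deriv_chart:
  assumes F: "F \<in> smooth_functions A'" and Uc: "(U, c) \<in> A" and x: "x \<in> c ` U"
  shows "line_deriv F (inv_into U c x, t) =
    frechet_derivative (\<lambda>p. F (inv_into U c (fst p), snd p)) (at (x, t)) (0, 1)"
  using DERIV_imp_deriv[OF product_chart_derivative[OF assms]] by (simp add: line_deriv_def)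

lemma line_deriv_has_derivative:
  assumes F: "F \<in> smooth_functions A'"
  shows "((\<lambda>s. F (p, s)) has_real_derivative line_deriv F (p, t)) (at t)"
proof -
  obtain U c where Uc: "(U, c) \<in> A" "p \<in> U"
    using manifold by (fastforce simp: smooth_manifold_def)
  then have "inv_into U c (c p) = p" using chart(4) by simp
  then show ?thesis
    using product_chart_derivative[OF F Uc(1), of "c p" t] line_deriv_chart[OF F Uc(1), of "c p" t] Uc(2)
    by simp
qed

lemma line_deriv_smooth [simp]:
  assumes F: "F \<in> smooth_functions A'"
  shows "line_deriv F \<in> smooth_functions A'"
proof (rule smooth_times_lineI)
  fix U c assume Uc: "(U, c) \<in> A"
  let ?F = "\<lambda>p. F (inv_into U c (fst p), snd p)"
  have o: "open (c ` U \<times> (UNIV :: real set))" using chart(2)[OF Uc] by (simp add: open_Times)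
  have "smooth_on (c ` U \<times> UNIV) ?F" using F Uc by (auto simp: smooth_times_line_iff)
  then have "smooth_on (c ` U \<times> UNIV) (\<lambda>p. frechet_derivative ?F (at p) (0, 1))"
    by (rule smooth_on_frechet)
  moreover have "smooth_on (c ` U \<times> UNIV) (\<lambda>p. frechet_derivative ?F (at p) (0, 1)) \<longleftrightarrow>
      smooth_on (c ` U \<times> UNIV) (\<lambda>p. line_deriv F (inv_into U c (fst p), snd p))"
  proof (rule smooth_on_cong[OF o])
    fix p assume "p \<in> c ` U \<times> (UNIV :: real set)"
    then show "frechet_derivative ?F (at p) (0, 1) = line_deriv F (inv_into U c (fst p), snd p)"
      using line_deriv_chart[OF F Uc, of "fst p" "snd p"] by auto
  qed
  ultimately show "smooth_on (c ` U \<times> UNIV) (\<lambda>p. line_deriv F (inv_into U c (fst p), snd p))"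
    by (rule iffD1[rotated])
qed

text \<open>G is the mean of the t-derivative of F over the segment from t to s. It serves to split
  tangent vectors of M x R and to commute lifted fields with the t-derivative.\<close>

lemma hadamard_line:
  assumes F: "F \<in> smooth_functions A'"
  obtains G where "G \<in> smooth_functions A'" "\<And>p s. F (p, s) - F (p, t) = (s - t) * G (p, s)"
    "\<And>p. G (p, t) = line_deriv F (p, t)"
proof
  define G where "G p = integral {0..1} (\<lambda>u. line_deriv F (fst p, t + u * (snd p - t)))" for p :: "'a \<times> real"
  show "G \<in> smooth_functions A'"
  proof (rule smooth_times_lineI)
    fix U c assume Uc: "(U, c) \<in> A"
    let ?D = "\<lambda>p. line_deriv F (inv_into U c (fst p), snd p)"
    have D: "smooth_on (c ` U \<times> UNIV) ?D"
      using line_deriv_smooth[OF F] Uc unfolding smooth_times_line_iff by blast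
    show "smooth_on (c ` U \<times> UNIV) (\<lambda>p. G (inv_into U c (fst p), snd p))"
    \<comment> \<open>\<open>smooth_on_integral\<close> is for convex parameter domains, hence the
      restriction to balls.\<close>
    proof (rule smooth_on_local)
      fix z :: "'e \<times> real" assume z: "z \<in> c ` U \<times> UNIV"
      then obtain e where e: "e > 0" "ball (fst z) e \<subseteq> c ` U"
        using chart(2)[OF Uc] open_contains_ball by (metis mem_Times_iff)
      let ?V = "ball (fst z) e \<times> (UNIV :: real set)"
      let ?W = "UNIV \<times> ?V :: (real \<times> 'e \<times> real) set"
      let ?l = "\<lambda>q :: real \<times> 'e \<times> real. (fst (snd q), t + fst q * (snd (snd q) - t))"
      have V: "open ?V" "convex ?V" by (auto simp: open_Times convex_Times)
      have W: "open ?W" using V by (simp add: open_Times)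
      have 1: "smooth_on ?W (\<lambda>q. fst (snd q))" "smooth_on ?W (\<lambda>q. snd (snd q))"
        by (intro smooth_on_linear[OF W bounded_linear_fst] smooth_on_linear[OF W bounded_linear_snd] smooth_on_snd W)+
      have "smooth_on ?W ?l"
        by (intro smooth_on_Pair smooth_on_add smooth_on_mult smooth_on_minus 1 smooth_on_const smooth_on_fst W)
      then have "smooth_on ?W (\<lambda>q. ?D (?l q))"
        by (rule smooth_on_compose[OF W D]) (use e in auto)
      then have "smooth_on ?V (\<lambda>p. integral {0..1} (\<lambda>u. ?D (?l (u, p))))"
        by (intro smooth_on_integral[OF V W]) auto
      then have "smooth_on ?V (\<lambda>p. G (inv_into U c (fst p), snd p))"
        by (simp add: G_def)
      then show "\<exists>T. open T \<and> z \<in> T \<and> smooth_on T (\<lambda>p. G (inv_into U c (fst p), snd p))"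
        using V(1) e(1) by (intro exI[of _ ?V]) (auto simp: mem_Times_iff)
    qed
  qed
  fix p
  show "G (p, t) = line_deriv F (p, t)" by (simp add: G_def)
  fix s
  let ?g = "\<lambda>u. line_deriv F (p, t + u * (s - t))"
  have d: "((\<lambda>u. F (p, t + u * (s - t))) has_vector_derivative (s - t) * ?g u) (at u within {0..1})" for u
  proof -
    have "((\<lambda>u. t + u * (s - t)) has_real_derivative (s - t)) (at u)"
      by (auto intro!: derivative_eq_intros)
    from DERIV_chain2[OF line_deriv_has_derivative[OF F] this]
    have "((\<lambda>u. F (p, t + u * (s - t))) has_real_derivative ?g u * (s - t)) (at u)" .
    then show ?thesis
      by (metis has_real_derivative_iff_has_vector_derivative has_vector_derivative_at_within mult.commute)
  qed
  have "((\<lambda>u. (s - t) * ?g u) has_integral F (p, t + 1 * (s - t)) - F (p, t + 0 * (s - t))) {0..1}"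
    by (rule fundamental_theorem_of_calculus) (use d in auto)
  moreover have "continuous_on {0..1} ?g"
  proof -
    have "continuous_on UNIV (\<lambda>s. line_deriv F (p, s))"
      by (intro continuous_at_imp_continuous_on ballI)
        (rule DERIV_isCont[OF line_deriv_has_derivative[OF line_deriv_smooth[OF F]]])
    then show ?thesis
      by (rule continuous_on_compose2) (auto intro!: continuous_intros)
  qed
  then have "((\<lambda>u. (s - t) * ?g u) has_integral (s - t) * G (p, s)) {0..1}"
    unfolding G_def fst_conv snd_conv
    by (intro has_integral_mult_right integrable_integral integrable_continuous_interval)
  ultimately have "F (p, t + 1 * (s - t)) - F (p, t + 0 * (s - t)) = (s - t) * G (p, s)"
    by (rule has_integral_unique)
  then show "F (p, s) - F (p, t) = (s - t) * G (p, s)" by simp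
qed

text \<open>F differs from its slice at t by the product of \<open>snd\<close> - t, which vanishes
  at (p, t), and a smooth function that equals the t-derivative of F there.\<close>

lemma tangent_times_line:
  assumes w: "w \<in> tangent_space A' (p, t)" and F: "F \<in> smooth_functions A'"
  shows "w F = w ((\<lambda>q. F (q, t)) \<circ> fst) + w snd * line_deriv F (p, t)"
proof -
  obtain G where G: "G \<in> smooth_functions A'" "\<And>p s. F (p, s) - F (p, t) = (s - t) * G (p, s)"
    "\<And>p. G (p, t) = line_deriv F (p, t)" using hadamard_line[OF F] by blast
  have s: "(\<lambda>q. F (q, t)) \<circ> fst \<in> smooth_functions A'"
    using smooth_slice[OF F] by (simp add: smooth_fst_iff)
  have "F - ((\<lambda>q. F (q, t)) \<circ> fst) = (snd - (\<lambda>_. t)) * G"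
    using G(2) by auto
  then have "w (F - ((\<lambda>q. F (q, t)) \<circ> fst)) = w ((snd - (\<lambda>_. t)) * G)" by simp
  moreover have "w ((snd - (\<lambda>_. t)) * G) = w snd * line_deriv F (p, t)"
    using G(1,3) smooth_snd
    by (simp add: line.tangent_mult[OF w] line.tangent_diff[OF w] line.tangent_const[OF w])
  ultimately show ?thesis
    using F s by (simp add: line.tangent_diff[OF w])
qed

lemma tangent_fst:
  assumes w: "w \<in> tangent_space A' (p, t)"
  shows "(\<lambda>f. w (f \<circ> fst)) \<in> tangent_space A p"
proof -
  have 1: "w ((f + g) \<circ> fst) = w (f \<circ> fst) + w (g \<circ> fst)"
    if "f \<in> smooth_functions A" "g \<in> smooth_functions A" for f g
    using line.tangent_add[OF w smooth_fst_iff[THEN iffD2, OF that(1)] smooth_fst_iff[THEN iffD2, OF that(2)]]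
    by (simp add: o_def plus_fun_def)
  have 2: "w ((\<lambda>q. r * f q) \<circ> fst) = r * w (f \<circ> fst)" if "f \<in> smooth_functions A" for f r
    using line.tangent_cmult[OF w smooth_fst_iff[THEN iffD2, OF that], of r] by (simp add: o_def)
  have 3: "w ((f * g) \<circ> fst) = w (f \<circ> fst) * g p + f p * w (g \<circ> fst)"
    if "f \<in> smooth_functions A" "g \<in> smooth_functions A" for f g
    using line.tangent_mult[OF w smooth_fst_iff[THEN iffD2, OF that(1)] smooth_fst_iff[THEN iffD2, OF that(2)]]
    by (simp add: o_def times_fun_def)
  have 4: "w (f \<circ> fst) = 0" if "f \<notin> smooth_functions A" for f
    using line.tangent_nonsmooth[OF w, of "f \<circ> fst"] that by (simp add: smooth_fst_iff)
  show ?thesis using 1 2 3 4 by (simp add: tangent_space_def)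
qed

definition lift :: "'a vfield \<Rightarrow> ('a \<times> real) vfield" where
  "lift X = field_pair A (\<lambda>_. X) (\<lambda>_. 0)"

definition dt :: "('a \<times> real) vfield" where
  "dt = field_pair A (\<lambda>_. 0) (\<lambda>_. 1)"

lemma lift_apply: "lift X (p, t) F = (if F \<in> smooth_functions A' then X p (\<lambda>q. F (q, t)) else 0)"
  by (simp add: lift_def field_pair_def)

lemma dt_apply: "dt z F = (if F \<in> smooth_functions A' then line_deriv F z else 0)"
  by (cases z) (simp add: dt_def field_pair_def line_deriv_def)

lemma dt_field [simp]: "dt \<in> vector_fields A'"
proof -
  have "dt z \<in> tangent_space A' z" for z
  proof (cases z)
    case (Pair p t)
    have D: "line_deriv F (p, t) = deriv (\<lambda>s. F (p, s)) t" for F by (simp add: line_deriv_def)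
    note d = line_deriv_has_derivative
    have "line_deriv (F + G) (p, t) = line_deriv F (p, t) + line_deriv G (p, t)"
      if "F \<in> smooth_functions A'" "G \<in> smooth_functions A'" for F G
      using DERIV_imp_deriv[OF DERIV_add[OF d[OF that(1)] d[OF that(2)]]] by (simp add: D)
    moreover have "line_deriv (\<lambda>q. r * F q) (p, t) = r * line_deriv F (p, t)"
      if "F \<in> smooth_functions A'" for F r
      using DERIV_imp_deriv[OF DERIV_cmult[OF d[OF that]]] by (simp add: D)
    moreover have "line_deriv (F * G) (p, t) = line_deriv F (p, t) * G (p, t) + F (p, t) * line_deriv G (p, t)"
      if "F \<in> smooth_functions A'" "G \<in> smooth_functions A'" for F G
      using DERIV_imp_deriv[OF DERIV_mult[OF d[OF that(1)] d[OF that(2)]]] by (simp add: D)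
    ultimately show ?thesis by (simp add: Pair tangent_space_def dt_apply)
  qed
  then show ?thesis by (simp add: vector_fields_def dt_apply)
qed

lemma lift_field:
  assumes X: "X \<in> vector_fields A"
    and smooth: "\<And>F. F \<in> smooth_functions A' \<Longrightarrow> (\<lambda>(p, t). X p (\<lambda>q. F (q, t))) \<in> smooth_functions A'"
  shows "lift X \<in> vector_fields A'"
proof -
  have "lift X z \<in> tangent_space A' z" for z
  proof (cases z)
    case (Pair p t)
    have v: "X p \<in> tangent_space A p" by (rule field_tangent[OF X])
    have "X p (\<lambda>q. (F + G) (q, t)) = X p (\<lambda>q. F (q, t)) + X p (\<lambda>q. G (q, t))"
      if "F \<in> smooth_functions A'" "G \<in> smooth_functions A'" for F G
      using tangent_add[OF v smooth_slice[OF that(1)] smooth_slice[OF that(2)]] by (simp add: plus_fun_def)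
    moreover have "X p (\<lambda>q. r * F (q, t)) = r * X p (\<lambda>q. F (q, t))" if "F \<in> smooth_functions A'" for F r
      using tangent_cmult[OF v smooth_slice[OF that]] by simp
    moreover have "X p (\<lambda>q. (F * G) (q, t)) = X p (\<lambda>q. F (q, t)) * G (p, t) + F (p, t) * X p (\<lambda>q. G (q, t))"
      if "F \<in> smooth_functions A'" "G \<in> smooth_functions A'" for F G
      using tangent_mult[OF v smooth_slice[OF that(1)] smooth_slice[OF that(2)]] by (simp add: times_fun_def)
    ultimately show ?thesis by (simp add: Pair tangent_space_def lift_apply)
  qed
  moreover have "(\<lambda>z. lift X z F) \<in> smooth_functions A'" if "F \<in> smooth_functions A'" for F
  proof -
    have "(\<lambda>z. lift X z F) = (\<lambda>(p, t). X p (\<lambda>q. F (q, t)))" using that by (auto simp: lift_apply)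
    then show ?thesis using smooth[OF that] by simp
  qed
  ultimately show ?thesis by (simp add: vector_fields_def)
qed

end

section \<open>Lifts and expansions of fields over a compact manifold\<close>

locale compact_manifold = manifold A for A :: "('a::{t2_space,second_countable_topology}, 'e::euclidean_space) atlas" +
  assumes compact_UNIV: "compact (UNIV :: 'a set)"
begin

definition frame :: "(('a \<Rightarrow> real) \<times> 'a vfield) list" where
  "frame = (SOME L. set L \<subseteq> smooth_functions A \<times> liftable_fields \<and>
    (\<forall>p. \<forall>v\<in>tangent_space A p. \<forall>f\<in>smooth_functions A. v f = (\<Sum>(x, E)\<leftarrow>L. v x * E p f)))"

lemma frame: "set frame \<subseteq> smooth_functions A \<times> liftable_fields"
  and frame_expansion: "v \<in> tangent_space A p \<Longrightarrow> f \<in> smooth_functions A \<Longrightarrow>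
    v f = (\<Sum>(x, E)\<leftarrow>frame. v x * E p f)"
proof -
  obtain L where "set L \<subseteq> smooth_functions A \<times> liftable_fields"
    "\<And>p v f. v \<in> tangent_space A p \<Longrightarrow> f \<in> smooth_functions A \<Longrightarrow> v f = (\<Sum>(x, E)\<leftarrow>L. v x * E p f)"
    using global_frame[OF compact_UNIV] by metis
  then have "\<exists>L. set L \<subseteq> smooth_functions A \<times> liftable_fields \<and>
    (\<forall>p. \<forall>v\<in>tangent_space A p. \<forall>f\<in>smooth_functions A. v f = (\<Sum>(x, E)\<leftarrow>L. v x * E p f))" by blast
  from someI_ex[OF this] show "set frame \<subseteq> smooth_functions A \<times> liftable_fields"
    "v \<in> tangent_space A p \<Longrightarrow> f \<in> smooth_functions A \<Longrightarrow> v f = (\<Sum>(x, E)\<leftarrow>frame. v x * E p f)"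
    unfolding frame_def by blast+
qed

lemma frame_field: "(x, E) \<in> set frame \<Longrightarrow> x \<in> smooth_functions A \<and> E \<in> vector_fields A"
  using frame by (auto simp: liftable_fields_def)

lemma sum_list_apply: "(\<Sum>x\<leftarrow>xs. F x) p = (\<Sum>x\<leftarrow>xs. F x p)"
  for F :: "'b \<Rightarrow> 'c \<Rightarrow> 'd::comm_monoid_add"
  by (induction xs) auto

text \<open>In the expansion X = SUM X(x) E the coefficients depend on p only and the fields E are
  liftable, so the sum acts smoothly in (p, t).\<close>

lemma lift_field' [simp]:
  assumes X: "X \<in> vector_fields A"
  shows "lift X \<in> vector_fields A'"
proof (rule lift_field[OF X])
  fix F assume F: "F \<in> smooth_functions A'"
  have "(\<Sum>(x, E)\<leftarrow>frame. (deriv_along X x \<circ> fst) * (\<lambda>(p, t). E p (\<lambda>q. F (q, t)))) \<in> smooth_functions A'"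
    using frame X F frame_field
    by (intro line.smooth_sum_list) (auto simp: smooth_fst_iff liftable_fields_def intro!: line.smooth_mult)
  also have "(\<Sum>(x, E)\<leftarrow>frame. (deriv_along X x \<circ> fst) * (\<lambda>(p, t). E p (\<lambda>q. F (q, t)))) =
      (\<lambda>(p, t). X p (\<lambda>q. F (q, t)))"
  proof
    fix z :: "'a \<times> real"
    obtain p t where z: "z = (p, t)" by (cases z)
    show "(\<Sum>(x, E)\<leftarrow>frame. (deriv_along X x \<circ> fst) * (\<lambda>(p, t). E p (\<lambda>q. F (q, t)))) z =
        (case z of (p, t) \<Rightarrow> X p (\<lambda>q. F (q, t)))"
      unfolding z split_conv frame_expansion[OF field_tangent[OF X] smooth_slice[OF F]]
      by (simp add: sum_list_apply deriv_along_def case_prod_unfold)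
  qed
  finally show "(\<lambda>(p, t). X p (\<lambda>q. F (q, t))) \<in> smooth_functions A'" .
qed

text \<open>Split each tangent vector by \<open>tangent_times_line\<close> and expand its
  push-forward to M in the frame.\<close>

lemma field_times_line_expansion:
  assumes Z: "Z \<in> vector_fields A'"
  shows "Z = (\<Sum>(x, E)\<leftarrow>frame. deriv_along Z (x \<circ> fst) \<cdot> lift E) + deriv_along Z snd \<cdot> dt"
proof (rule vfield_eqI)
  fix z :: "'a \<times> real" and F
  obtain p t where z: "z = (p, t)" by (cases z)
  have w: "Z (p, t) \<in> tangent_space A' (p, t)" by (rule line.field_tangent[OF Z])
  show "Z z F = ((\<Sum>(x, E)\<leftarrow>frame. deriv_along Z (x \<circ> fst) \<cdot> lift E) + deriv_along Z snd \<cdot> dt) z F"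
  proof (cases "F \<in> smooth_functions A'")
    case False
    then show ?thesis
      using line.tangent_nonsmooth[OF w False]
      by (simp add: z dt_apply sum_list_apply lift_apply split_beta)
  next
    case True
    have "Z (p, t) ((\<lambda>q. F (q, t)) \<circ> fst) =
        (\<Sum>(x, E)\<leftarrow>frame. Z (p, t) (x \<circ> fst) * E p (\<lambda>q. F (q, t)))"
      by (rule frame_expansion[OF tangent_fst[OF w] smooth_slice[OF True]])
    then show ?thesis
      using tangent_times_line[OF w True] True
      by (simp add: z dt_apply sum_list_apply lift_apply case_prod_unfold deriv_along_apply)
  qed
qed

text \<open>Tensors on \<open>M \<times> \<real>\<close> are determined by their values on lifted fields and on \<open>\<partial>\<^sub>t\<close>.\<close>

lemma field_times_line_induct:
  assumes Z: "Z \<in> vector_fields A'"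
    and lift: "\<And>X. X \<in> vector_fields A \<Longrightarrow> P (lift X)" and dt: "P dt"
    and add: "\<And>X Y. X \<in> vector_fields A' \<Longrightarrow> Y \<in> vector_fields A' \<Longrightarrow> P X \<Longrightarrow> P Y \<Longrightarrow> P (X + Y)"
    and fmul: "\<And>f X. f \<in> smooth_functions A' \<Longrightarrow> X \<in> vector_fields A' \<Longrightarrow> P X \<Longrightarrow> P (f \<cdot> X)"
  shows "P Z"
proof -
  define G where "G W \<longleftrightarrow> W \<in> vector_fields A' \<and> P W" for W
  have D: "deriv_along Z F \<in> smooth_functions A'" if "F \<in> smooth_functions A'" for F
    using Z that by simp
  have G_add: "G (X + Y)" if "G X" "G Y" for X Y
    using that add by (simp add: G_def)
  have t: "G (deriv_along Z snd \<cdot> dt)"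
    using D smooth_snd dt fmul by (simp add: G_def)
  have "G ((\<Sum>(x, E)\<leftarrow>L. deriv_along Z (x \<circ> fst) \<cdot> lift E) + deriv_along Z snd \<cdot> dt)"
    if "set L \<subseteq> set frame" for L
    using that
  proof (induction L)
    case Nil
    show ?case using t by (simp only: list.map sum_list.Nil add_0)
  next
    case (Cons xE L)
    obtain x E where xE: "xE = (x, E)" by (cases xE)
    then have "x \<in> smooth_functions A" "E \<in> vector_fields A" using Cons.prems frame_field by auto
    then have "G (deriv_along Z (x \<circ> fst) \<cdot> lift E)"
      using D[of "x \<circ> fst"] lift fmul by (simp add: G_def smooth_fst_iff)
    then have "G (deriv_along Z (x \<circ> fst) \<cdot> lift E +
        ((\<Sum>(x, E)\<leftarrow>L. deriv_along Z (x \<circ> fst) \<cdot> lift E) + deriv_along Z snd \<cdot> dt))"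
    proof (rule G_add)
      show "G ((\<Sum>(x, E)\<leftarrow>L. deriv_along Z (x \<circ> fst) \<cdot> lift E) + deriv_along Z snd \<cdot> dt)"
        by (rule Cons.IH) (use Cons.prems in auto)
    qed
    then show ?case by (simp only: list.map sum_list.Cons xE split_conv add.assoc)
  qed
  from this[of frame] show ?thesis
    using field_times_line_expansion[OF Z] by (simp add: G_def)
qed

end

section \<open>Contact metric structures\<close>

lemma fmul_zero [simp]: "(\<lambda>_. 0) \<cdot> X = 0"
  by (simp add: vfield_eqI)

lemma bracket_self [simp]: "bracket X X = 0"
  by (rule vfield_eqI) (simp add: bracket_def)

locale contact_metric_structure = open_atlas A for A :: "('a, 'e::euclidean_space) atlas" +
  fixes \<eta> :: "'a form1" and \<xi> :: "'a vfield" and g :: "'a form2" and \<phi> :: "'a endo"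
  assumes contact_metric: "contact_metric A \<eta> \<xi> g \<phi>"
begin

abbreviation D :: "'a vfield \<Rightarrow> ('a \<Rightarrow> real) \<Rightarrow> 'a \<Rightarrow> real" where "D \<equiv> deriv_along"
abbreviation h :: "'a endo" where "h \<equiv> h_tensor \<xi> \<phi>"

sublocale riemannian A g
  using contact_metric by unfold_locales (simp add: contact_metric_def)

lemma eta_form: "one_form A \<eta>"
  using contact_metric by (simp add: contact_metric_def contact_form_def)

lemma phi_endo: "endo_field A \<phi>"
  using contact_metric by (simp add: contact_metric_def)

lemma xi_field [simp]: "\<xi> \<in> vector_fields A"
  using contact_metric by (simp add: contact_metric_def reeb_field_def)

lemma phi_field [simp]: "X \<in> vector_fields A \<Longrightarrow> \<phi> X \<in> vector_fields A"
  by (simp add: endo_field_field phi_endo)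

lemma eta_smooth [simp]: "X \<in> vector_fields A \<Longrightarrow> \<eta> X \<in> smooth_functions A"
  by (simp add: one_form_smooth eta_form)

lemmas eta_simps = one_form_add[OF eta_form] one_form_diff[OF eta_form] one_form_uminus[OF eta_form]
  one_form_cmul[OF eta_form] one_form_fmul[OF eta_form] one_form_zero[OF eta_form]

lemmas phi_simps = endo_add[OF phi_endo] endo_diff[OF phi_endo] endo_uminus[OF phi_endo]
  endo_cmul[OF phi_endo] endo_fmul[OF phi_endo] endo_zero[OF phi_endo]

lemmas bracket_simps = bracket_add_right bracket_diff_right bracket_uminus_right bracket_cmul_right
  bracket_zero_right

lemma eta_xi [simp]: "\<eta> \<xi> = (\<lambda>_. 1)"
  using contact_metric by (simp add: contact_metric_def reeb_field_def)

lemma deta_xi: "X \<in> vector_fields A \<Longrightarrow> ext_deriv \<eta> \<xi> X = (\<lambda>_. 0)"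
  using contact_metric unfolding contact_metric_def reeb_field_def by blast

lemma metric_xi: "X \<in> vector_fields A \<Longrightarrow> g \<xi> X = \<eta> X" "X \<in> vector_fields A \<Longrightarrow> g X \<xi> = \<eta> X"
  using contact_metric metric_sym[of X \<xi>] by (simp_all add: contact_metric_def)

lemma phi_phi: "X \<in> vector_fields A \<Longrightarrow> \<phi> (\<phi> X) = \<eta> X \<cdot> \<xi> - X"
  using contact_metric by (simp add: contact_metric_def)

lemma deta: "X \<in> vector_fields A \<Longrightarrow> Y \<in> vector_fields A \<Longrightarrow> ext_deriv \<eta> X Y = g X (\<phi> Y)"
  using contact_metric by (simp add: contact_metric_def)

lemma deta_antisym:
  assumes "X \<in> vector_fields A" "Y \<in> vector_fields A"
  shows "ext_deriv \<eta> X Y p = - ext_deriv \<eta> Y X p"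
  using assms by (subst (1) ext_deriv_def, subst (1) ext_deriv_def, subst bracket_antisym)
    (simp add: eta_simps field_simps)

lemma phi_skew:
  assumes "X \<in> vector_fields A" "Y \<in> vector_fields A"
  shows "g X (\<phi> Y) p = - g (\<phi> X) Y p"
  using deta_antisym[OF assms, of p] assms by (simp add: deta metric_sym[of Y])

lemma phi_xi [simp]: "\<phi> \<xi> = 0"
proof (rule metric_nondegenerate)
  fix Z p assume "Z \<in> vector_fields A"
  then show "g (\<phi> \<xi>) Z p = 0"
    using phi_skew[of \<xi> Z p] by (simp flip: deta add: deta_xi)
qed simp

lemma eta_phi [simp]: "X \<in> vector_fields A \<Longrightarrow> \<eta> (\<phi> X) = (\<lambda>_. 0)"
  using metric_xi(1)[of "\<phi> X"] by (simp flip: deta add: deta_xi)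

lemma phi_phi_phi: "X \<in> vector_fields A \<Longrightarrow> \<phi> (\<phi> (\<phi> X)) = - \<phi> X"
  using phi_phi[of "\<phi> X"] by simp

lemma phi_isometry:
  assumes "X \<in> vector_fields A" "Y \<in> vector_fields A"
  shows "g (\<phi> X) (\<phi> Y) p = g X Y p - \<eta> X p * \<eta> Y p"
  using phi_skew[of "\<phi> X" Y p] assms by (simp add: phi_phi metric_simps metric_xi)

text \<open>This is L_\<xi> \<eta> = 0, which follows from d\<eta>(\<xi>, .) = 0 because
  \<eta>(\<xi>) is constant.\<close>

lemma eta_bracket_xi:
  assumes "X \<in> vector_fields A"
  shows "\<eta> (bracket \<xi> X) = D \<xi> (\<eta> X)"
proof
  fix p
  show "\<eta> (bracket \<xi> X) p = D \<xi> (\<eta> X) p"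
    using fun_cong[OF deta_xi[OF assms], of p] assms by (simp add: ext_deriv_def)
qed

text \<open>This is L_\<xi> d\<eta> = 0: since L_\<xi> \<eta> = 0, each of the three terms of
  d\<eta> can be differentiated along \<xi>, and the Jacobi identity puts the results
  together.\<close>

lemma lie_deta:
  assumes X: "X \<in> vector_fields A" and Y: "Y \<in> vector_fields A"
  shows "D \<xi> (g X (\<phi> Y)) p = g (bracket \<xi> X) (\<phi> Y) p + g X (\<phi> (bracket \<xi> Y)) p"
proof -
  define F where "F = D X (\<eta> Y) - D Y (\<eta> X) - \<eta> (bracket X Y)"
  have "F \<in> smooth_functions A" using X Y by (simp add: F_def)
  then have "D \<xi> (\<lambda>p. (1/2) * F p) = (\<lambda>p. (1/2) * D \<xi> F p)"
    by (intro deriv_along_cmult) simp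
  moreover have "ext_deriv \<eta> X Y = (\<lambda>p. (1/2) * F p)"
    by (auto simp: ext_deriv_def F_def)
  ultimately have "D \<xi> (g X (\<phi> Y)) p =
      (1/2) * (D \<xi> (D X (\<eta> Y)) - D \<xi> (D Y (\<eta> X)) - D \<xi> (\<eta> (bracket X Y))) p"
    using X Y by (simp add: deta[symmetric] deriv_along_diff F_def)
  also have "D \<xi> (\<eta> (bracket X Y)) = \<eta> (bracket (bracket \<xi> X) Y) + \<eta> (bracket X (bracket \<xi> Y))"
    using X Y by (simp add: eta_bracket_xi[symmetric] jacobi[of \<xi>] eta_simps)
  also have "D \<xi> (D X (\<eta> Y)) = D (bracket \<xi> X) (\<eta> Y) + D X (\<eta> (bracket \<xi> Y))"
    using Y by (simp add: deriv_along_bracket eta_bracket_xi)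
  also have "D \<xi> (D Y (\<eta> X)) = D (bracket \<xi> Y) (\<eta> X) + D Y (\<eta> (bracket \<xi> X))"
    using X by (simp add: deriv_along_bracket eta_bracket_xi)
  finally have "D \<xi> (g X (\<phi> Y)) p = ext_deriv \<eta> (bracket \<xi> X) Y p + ext_deriv \<eta> X (bracket \<xi> Y) p"
    by (simp add: ext_deriv_def field_simps)
  then show ?thesis using X Y by (simp add: deta)
qed

lemma bracket_xi_phi: "bracket \<xi> (\<phi> X) = \<phi> (bracket \<xi> X) + 2 \<cdot>\<^sub>\<real> h X"
  by (auto simp: h_tensor_def lie_deriv_endo_def field_simps intro!: vfield_eqI)

lemma h_eq: "h X = (1/2) \<cdot>\<^sub>\<real> (bracket \<xi> (\<phi> X) - \<phi> (bracket \<xi> X))"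
  by (simp add: h_tensor_def lie_deriv_endo_def)

lemma h_field [simp]: "X \<in> vector_fields A \<Longrightarrow> h X \<in> vector_fields A"
  by (simp add: h_eq)

lemma h_endo: "endo_field A h"
  unfolding endo_field_def
proof (intro conjI ballI)
  fix X Y assume "X \<in> vector_fields A" "Y \<in> vector_fields A"
  then show "h (X + Y) = h X + h Y"
    by (auto simp: h_eq phi_simps bracket_simps algebra_simps intro!: vfield_eqI)
next
  fix f X assume "f \<in> smooth_functions A" "X \<in> vector_fields A"
  then show "h (f \<cdot> X) = f \<cdot> h X"
    by (auto simp: h_eq phi_simps bracket_fmul_right algebra_simps intro!: vfield_eqI)
qed simp

lemmas h_simps = endo_add[OF h_endo] endo_diff[OF h_endo] endo_uminus[OF h_endo]
  endo_cmul[OF h_endo] endo_fmul[OF h_endo] endo_zero[OF h_endo]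

lemma h_xi [simp]: "h \<xi> = 0"
  by (auto simp: h_eq phi_simps bracket_simps intro!: vfield_eqI)

lemma eta_h [simp]: "X \<in> vector_fields A \<Longrightarrow> \<eta> (h X) = (\<lambda>_. 0)"
  by (simp add: h_eq eta_simps eta_bracket_xi)

text \<open>Apply L_\<xi> to \<phi>^2 = - I + \<eta> \<otimes> \<xi>, whose right side is
  invariant.\<close>

lemma h_phi: "X \<in> vector_fields A \<Longrightarrow> h (\<phi> X) = - \<phi> (h X)"
proof -
  assume X: "X \<in> vector_fields A"
  have "bracket \<xi> (\<phi> (\<phi> X)) = \<phi> (\<phi> (bracket \<xi> X)) + 2 \<cdot>\<^sub>\<real> \<phi> (h X) + 2 \<cdot>\<^sub>\<real> h (\<phi> X)"
    using X by (simp add: bracket_xi_phi phi_simps)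
  also have "bracket \<xi> (\<phi> (\<phi> X)) = \<phi> (\<phi> (bracket \<xi> X))"
    using X by (auto simp: phi_phi bracket_simps bracket_fmul_right eta_bracket_xi intro!: vfield_eqI)
  finally have e: "\<phi> (\<phi> (bracket \<xi> X)) =
    \<phi> (\<phi> (bracket \<xi> X)) + 2 \<cdot>\<^sub>\<real> \<phi> (h X) + 2 \<cdot>\<^sub>\<real> h (\<phi> X)" .
  show ?thesis
  proof (rule vfield_eqI)
    fix p u
    show "h (\<phi> X) p u = (- \<phi> (h X)) p u"
      using vfield_eqD[OF e, of p u] by simp
  qed
qed

text \<open>With d\<eta>(X, Z) = g(X, \<phi> Z), the invariance of d\<eta> gives - 2 g(X, h Z) as
  the value of L_\<xi> g on (X, \<phi> Z). For Z = \<phi> Y this determines the value on (X, Y), as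
  the \<xi>-direction contributes nothing.\<close>

lemma lie_metric:
  assumes X: "X \<in> vector_fields A" and Y: "Y \<in> vector_fields A"
  shows "lie_deriv_metric \<xi> g X Y p = 2 * g X (h (\<phi> Y)) p"
proof -
  have *: "lie_deriv_metric \<xi> g X (\<phi> Z) p = - 2 * g X (h Z) p" if "Z \<in> vector_fields A" for Z
    using lie_deta[OF X that, of p] X that
    by (simp add: lie_deriv_metric_def bracket_xi_phi metric_simps)
  have "lie_deriv_metric \<xi> g X (\<eta> Y \<cdot> \<xi>) p = 0"
  proof -
    have "g X (\<eta> Y \<cdot> \<xi>) = \<eta> Y * \<eta> X" using X Y by (auto simp: metric_simps metric_xi)
    then show ?thesis using X Y
      by (simp add: lie_deriv_metric_def bracket_fmul_right metric_simps metric_xi deriv_along_mult eta_bracket_xi)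
  qed
  moreover have "lie_deriv_metric \<xi> g X (\<eta> Y \<cdot> \<xi> - Y) p =
      lie_deriv_metric \<xi> g X (\<eta> Y \<cdot> \<xi>) p - lie_deriv_metric \<xi> g X Y p"
  proof -
    have "g X (\<eta> Y \<cdot> \<xi> - Y) = g X (\<eta> Y \<cdot> \<xi>) - g X Y" using X Y by (auto simp: metric_simps)
    then show ?thesis
      using X Y by (simp add: lie_deriv_metric_def deriv_along_diff bracket_simps metric_simps)
  qed
  ultimately show ?thesis using *[of "\<phi> Y"] Y by (simp add: phi_phi)
qed

lemma lie_metric_sym:
  assumes X: "X \<in> vector_fields A" and Y: "Y \<in> vector_fields A"
  shows "lie_deriv_metric \<xi> g X Y p = lie_deriv_metric \<xi> g Y X p"
  using X Y by (simp add: lie_deriv_metric_def metric_sym[of X] metric_sym[of "bracket \<xi> X"])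

text \<open>The symmetry of L_\<xi> g is carried over to h by \<open>lie_metric\<close>, with \<phi>
  moved across g and across h.\<close>

lemma h_sym:
  assumes X: "X \<in> vector_fields A" and Y: "Y \<in> vector_fields A"
  shows "g X (h Y) p = g (h X) Y p"
proof -
  have "g X (h (\<phi> (\<phi> Y))) p = g (\<phi> Y) (h (\<phi> X)) p"
    using lie_metric_sym[of X "\<phi> Y" p] X Y by (simp add: lie_metric)
  also have "\<dots> = - g Y (\<phi> (h (\<phi> X))) p"
    using phi_skew[of Y "h (\<phi> X)" p] X Y by simp
  also have "\<dots> = - g (h X) Y p"
    using X Y by (simp add: h_phi phi_simps phi_phi metric_simps metric_sym[of Y])
  finally show ?thesis using X Y by (simp add: phi_phi h_simps metric_simps)
qed

text \<open>Both sides say h = 0, the left one through \<open>lie_metric\<close> and the right one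
  through 2 h = L_\<xi> \<phi>. The right side is the form in which the canonical structure and a
  competing one are treated.\<close>

lemma K_contact_iff:
  "K_contact A \<eta> \<xi> g \<phi> \<longleftrightarrow> (\<forall>X\<in>vector_fields A. bracket \<xi> (\<phi> X) = \<phi> (bracket \<xi> X))"
proof
  assume K: "K_contact A \<eta> \<xi> g \<phi>"
  show "\<forall>X\<in>vector_fields A. bracket \<xi> (\<phi> X) = \<phi> (bracket \<xi> X)"
  proof
    fix X assume X: "X \<in> vector_fields A"
    have "h X = 0"
    proof (rule metric_nondegenerate)
      fix Z p assume Z: "Z \<in> vector_fields A"
      have "g Z (h (\<phi> (\<phi> X))) p = 0"
        using K lie_metric[OF Z, of "\<phi> X" p] X Z by (simp add: K_contact_def)
      then show "g (h X) Z p = 0"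
        using X Z by (simp add: phi_phi h_simps metric_simps metric_sym[of Z])
    qed (simp add: X)
    then show "bracket \<xi> (\<phi> X) = \<phi> (bracket \<xi> X)"
      by (simp add: bracket_xi_phi) (simp add: vfield_eqI)
  qed
next
  assume "\<forall>X\<in>vector_fields A. bracket \<xi> (\<phi> X) = \<phi> (bracket \<xi> X)"
  then have "h X = 0" if "X \<in> vector_fields A" for X
    using that by (auto simp: h_eq intro!: vfield_eqI)
  then show "K_contact A \<eta> \<xi> g \<phi>"
    using contact_metric by (auto simp: K_contact_def lie_metric metric_simps)
qed

text \<open>Eigenvectors at every point, so that identities hold between fields. Eigenvectors at a
  single point, as in \<open>eigen_distribution\<close>, enter only when orthogonality of the
  distributions is proved or used.\<close>

definition eig :: "real \<Rightarrow> 'a vfield set" where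
  "eig r = {X \<in> vector_fields A. h X = r \<cdot>\<^sub>\<real> X}"

lemma eig_field: "X \<in> eig r \<Longrightarrow> X \<in> vector_fields A"
  by (simp add: eig_def)

lemma eig_h: "X \<in> eig r \<Longrightarrow> h X = r \<cdot>\<^sub>\<real> X"
  by (simp add: eig_def)

lemma eig_phi: "X \<in> eig r \<Longrightarrow> \<phi> X \<in> eig (- r)"
  by (auto simp: eig_def h_phi phi_simps intro!: vfield_eqI)

lemma eig_phi': "X \<in> eig (- r) \<Longrightarrow> \<phi> X \<in> eig r"
  using eig_phi[of X "- r"] by simp

lemma eig_eta:
  assumes "X \<in> eig r" "r \<noteq> 0"
  shows "\<eta> X = (\<lambda>_. 0)"
proof
  fix p show "\<eta> X p = 0"
    using fun_cong[OF eta_h[of X], of p] assms eig_field[OF assms(1)] by (simp add: eig_h eta_simps)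
qed

lemma eig_phi_phi: "X \<in> eig r \<Longrightarrow> r \<noteq> 0 \<Longrightarrow> \<phi> (\<phi> X) = - X"
  using eig_field[of X r] by (simp add: phi_phi eig_eta)

lemma eig_orth:
  assumes "X \<in> eig r" "Y \<in> eig (- r)" "r \<noteq> 0"
  shows "g X Y p = 0"
  using h_sym[of X Y p] assms eig_field[OF assms(1)] eig_field[OF assms(2)]
  by (simp add: eig_h metric_simps)

lemma eig_legendrian:
  assumes "X \<in> eig r" "Y \<in> eig r" "r \<noteq> 0"
  shows "g X (\<phi> Y) p = 0"
  using eig_orth[of X r "\<phi> Y"] eig_phi assms by blast

lemma eig_eta_bracket:
  assumes "X \<in> eig r" "Y \<in> eig r" "r \<noteq> 0"
  shows "\<eta> (bracket X Y) = (\<lambda>_. 0)"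
proof
  fix p
  have X: "X \<in> vector_fields A" and Y: "Y \<in> vector_fields A"
    using assms eig_field by blast+
  have "ext_deriv \<eta> X Y p = 0" using X Y assms by (simp add: deta eig_legendrian)
  then show "\<eta> (bracket X Y) p = 0"
    using X Y eig_eta[OF assms(1,3)] eig_eta[OF assms(2,3)] by (simp add: ext_deriv_def)
qed

end

section \<open>Contact metric structures with the nullity condition\<close>

text \<open>Here \<open>b\<close> and \<open>c\<close> are \<open>1 + r\<close> and \<open>1 - r\<close> for an eigenvalue \<open>r\<close> of \<open>h\<close>, and the other variables are the
  values of one trilinear form at the permutations of three vectors.\<close>

lemma six_permutations_zero:
  fixes b c p q r s t u :: real
  assumes "b * (t - q) = c * (p - s)" "b * (s - r) = c * (q - u)" "b * (u - p) = c * (r - t)"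
    and "b * (t + r) = c * (p + u)" "b * (s + p) = c * (q + t)" "b * (u + q) = c * (r + s)"
    and cyc: "p + q + r = s + t + u" and bc: "b\<^sup>2 \<noteq> c\<^sup>2"
  shows "p = 0"
proof -
  have "b \<noteq> c" using bc by auto
  \<comment> \<open>Adding the three symmetric equations makes the total sum vanish; by the cyclic
    identity each half vanishes too. Differences of paired equations then relate two unknowns at a
    time, ending with b^2 p = c^2 p.\<close>
  have "(b - c) * (p + q + r + s + t + u) = 0"
    using assms(4-6) by (simp add: algebra_simps)
  then have z: "p + q + r = 0" "s + t + u = 0"
    using cyc \<open>b \<noteq> c\<close> by auto
  have "b * (r + q) = c * (u + s)"
    using assms(1,4) by (simp add: algebra_simps)
  moreover have "r + q = - p" "u + s = - t" using z by auto
  ultimately have 1: "b * p = c * t" by simp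
  have "b * (p + r) = c * (t + u)"
    using assms(2,5) by (simp add: algebra_simps)
  moreover have "p + r = - q" "t + u = - s" using z by auto
  ultimately have 2: "b * q = c * s" by simp
  have "b * t = c * p"
    using assms(1) 2 by (simp add: algebra_simps)
  then have "b * (b * p) = c * (c * p)"
    using 1 by (metis mult.left_commute)
  then have "(b\<^sup>2 - c\<^sup>2) * p = 0"
    by (simp add: power2_eq_square algebra_simps)
  then show ?thesis using bc by simp
qed

locale kappa_mu_structure = contact_metric_structure A \<eta> \<xi> g \<phi>
  for A :: "('a, 'e::euclidean_space) atlas" and \<eta> \<xi> g \<phi> +
  fixes nabla :: "'a vfield \<Rightarrow> 'a vfield \<Rightarrow> 'a vfield" and \<kappa> \<mu> :: real
  assumes levi_civita: "levi_civita A g nabla"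
    and curvature_xi: "\<And>X Y. X \<in> vector_fields A \<Longrightarrow> Y \<in> vector_fields A \<Longrightarrow>
          curvature nabla X Y \<xi> =
            \<kappa> \<cdot>\<^sub>\<real> (\<eta> Y \<cdot> X - \<eta> X \<cdot> Y) +
            \<mu> \<cdot>\<^sub>\<real> (\<eta> Y \<cdot> h_tensor \<xi> \<phi> X - \<eta> X \<cdot> h_tensor \<xi> \<phi> Y)"
    and kappa_less_1: "\<kappa> < 1"
begin

section \<open>The nullity condition in the direction of \<xi>\<close>

lemma nabla_field [simp]: "X \<in> vector_fields A \<Longrightarrow> Y \<in> vector_fields A \<Longrightarrow> nabla X Y \<in> vector_fields A"
  using levi_civita by (simp add: levi_civita_def)

lemma nabla_add_right:
  "X \<in> vector_fields A \<Longrightarrow> Y \<in> vector_fields A \<Longrightarrow> Z \<in> vector_fields A \<Longrightarrow> nabla X (Y + Z) = nabla X Y + nabla X Z"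
  using levi_civita unfolding levi_civita_def by blast

lemma nabla_cmul_right:
  assumes "X \<in> vector_fields A" "Y \<in> vector_fields A"
  shows "nabla X (r \<cdot>\<^sub>\<real> Y) = r \<cdot>\<^sub>\<real> nabla X Y"
proof -
  have "nabla X ((\<lambda>_. r) \<cdot> Y) = D X (\<lambda>_. r) \<cdot> Y + (\<lambda>_. r) \<cdot> nabla X Y"
    using levi_civita smooth_const assms unfolding levi_civita_def by blast
  then show ?thesis using assms by (auto simp: cmul_def intro!: vfield_eqI)
qed

lemma nabla_zero_right: "X \<in> vector_fields A \<Longrightarrow> nabla X 0 = 0"
  using nabla_add_right[of X 0 0] by simp

lemma nabla_torsion: "X \<in> vector_fields A \<Longrightarrow> Y \<in> vector_fields A \<Longrightarrow> bracket X Y = nabla X Y - nabla Y X"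
  using levi_civita unfolding levi_civita_def by metis

lemma nabla_metric:
  "X \<in> vector_fields A \<Longrightarrow> Y \<in> vector_fields A \<Longrightarrow> Z \<in> vector_fields A \<Longrightarrow>
    D X (g Y Z) p = g (nabla X Y) Z p + g Y (nabla X Z) p"
  using levi_civita unfolding levi_civita_def by (metis plus_fun_apply)

text \<open>d\<eta> determines the skew part of the derivative of \<xi>, and L_\<xi> g its symmetric
  part.\<close>

lemma nabla_xi:
  assumes X: "X \<in> vector_fields A"
  shows "nabla X \<xi> = - \<phi> X - \<phi> (h X)"
proof (rule metric_ext)
  fix Y p assume Y: "Y \<in> vector_fields A"
  have "2 * ext_deriv \<eta> X Y p = D X (g \<xi> Y) p - D Y (g \<xi> X) p - g \<xi> (bracket X Y) p"
    using X Y by (simp add: ext_deriv_def metric_xi)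
  also have "\<dots> = g (nabla X \<xi>) Y p - g X (nabla Y \<xi>) p"
    using X Y by (simp add: nabla_metric nabla_torsion metric_simps metric_sym[of X])
  finally have skew: "g (nabla X \<xi>) Y p - g X (nabla Y \<xi>) p = 2 * g X (\<phi> Y) p"
    using X Y by (simp add: deta)
  have "2 * g X (h (\<phi> Y)) p = lie_deriv_metric \<xi> g X Y p"
    using X Y by (simp add: lie_metric)
  also have "\<dots> = g (nabla X \<xi>) Y p + g X (nabla Y \<xi>) p"
    using X Y by (simp add: lie_deriv_metric_def nabla_metric nabla_torsion metric_simps)
  finally have "g (nabla X \<xi>) Y p = g X (\<phi> Y) p + g X (h (\<phi> Y)) p"
    using skew by simp
  also have "\<dots> = g (- \<phi> X - \<phi> (h X)) Y p"
    using X Y by (simp add: phi_skew h_sym metric_simps)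
  finally show "g (nabla X \<xi>) Y p = g (- \<phi> X - \<phi> (h X)) Y p" .
qed (use X in simp_all)

text \<open>This is L_\<xi> h.\<close>

definition k :: "'a endo" where "k X = bracket \<xi> (h X) - h (bracket \<xi> X)"

lemma k_field [simp]: "X \<in> vector_fields A \<Longrightarrow> k X \<in> vector_fields A"
  by (simp add: k_def)

lemma bracket_xi_h: "bracket \<xi> (h X) = h (bracket \<xi> X) + k X"
  by (simp add: k_def)

lemma eta_k: "X \<in> vector_fields A \<Longrightarrow> \<eta> (k X) = (\<lambda>_. 0)"
  by (rule ext) (simp add: k_def eta_simps eta_bracket_xi)

text \<open>R(X, \<xi>)\<xi> is evaluated twice: from its definition, where T is the derivative of
  \<xi>, T \<xi> = 0 and the derivative of T X along \<xi> is [\<xi>, T X] + T (T X); and from the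
  nullity condition.\<close>

lemma jacobi_operator:
  assumes X: "X \<in> vector_fields A"
  shows "\<phi> (k X) p u = (\<mu> - 2) * h X p u - h (h X) p u + (1 - \<kappa>) * \<phi> (\<phi> X) p u"
proof -
  define T where "T X = - \<phi> X - \<phi> (h X)" for X
  have T: "T X \<in> vector_fields A" "nabla X \<xi> = T X" if "X \<in> vector_fields A" for X
    using that by (simp_all add: T_def nabla_xi)
  have "nabla \<xi> (T X) = bracket \<xi> (T X) + T (T X)"
    using X T by (simp add: nabla_torsion)
  moreover have "T \<xi> = 0" by (simp add: T_def phi_simps)
  ultimately have "curvature nabla X \<xi> \<xi> = - bracket \<xi> (T X) - T (T X) + T (bracket \<xi> X)"
    using X T bracket_antisym[of X \<xi>]
    by (auto simp: curvature_def nabla_zero_right T_def phi_simps h_simps intro!: vfield_eqI)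
  moreover have "bracket \<xi> (T X) p u = T (bracket \<xi> X) p u - 2 * h X p u - \<phi> (k X) p u - 2 * h (h X) p u"
    using X by (simp add: T_def bracket_simps bracket_xi_phi bracket_xi_h phi_simps)
  moreover have "T (T X) p u = \<phi> (\<phi> X) p u + h (h X) p u"
    using X by (simp add: T_def phi_simps h_simps h_phi phi_phi)
  ultimately have "curvature nabla X \<xi> \<xi> p u = 2 * h X p u + \<phi> (k X) p u + h (h X) p u - \<phi> (\<phi> X) p u"
    by simp
  moreover have "curvature nabla X \<xi> \<xi> p u = \<mu> * h X p u - \<kappa> * \<phi> (\<phi> X) p u"
    using X by (simp add: curvature_xi phi_phi algebra_simps)
  ultimately show ?thesis by (simp add: algebra_simps)
qed

lemma k_eq_aux:
  assumes X: "X \<in> vector_fields A"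
  shows "k X p u = (2 - \<mu>) * \<phi> (h X) p u + \<phi> (h (h X)) p u + (1 - \<kappa>) * \<phi> X p u"
proof -
  have "\<phi> (k X) = (\<mu> - 2) \<cdot>\<^sub>\<real> h X - h (h X) + (1 - \<kappa>) \<cdot>\<^sub>\<real> \<phi> (\<phi> X)"
    by (rule vfield_eqI) (simp add: jacobi_operator X)
  then have "\<phi> (\<phi> (k X)) = \<phi> ((\<mu> - 2) \<cdot>\<^sub>\<real> h X - h (h X) + (1 - \<kappa>) \<cdot>\<^sub>\<real> \<phi> (\<phi> X))"
    by simp
  then have "- k X = (\<mu> - 2) \<cdot>\<^sub>\<real> \<phi> (h X) - \<phi> (h (h X)) + (1 - \<kappa>) \<cdot>\<^sub>\<real> (- \<phi> X)"
    using X phi_phi[of "k X"] phi_phi_phi[of X] by (simp add: phi_simps eta_k)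
  from vfield_eqD[OF this, of p u] show ?thesis
    by (simp add: algebra_simps)
qed

text \<open>L_\<xi> turns h \<phi> + \<phi> h = 0 into k \<phi> + \<phi> k + 4 h^2 = 0. When the
  formulas for k are inserted, the terms linear in h cancel and an equation for h^2 alone is
  left.\<close>

lemma h_h:
  assumes X: "X \<in> vector_fields A"
  shows "h (h X) = (\<kappa> - 1) \<cdot>\<^sub>\<real> \<phi> (\<phi> X)"
proof (rule vfield_eqI)
  fix p u
  have z: "h (\<phi> X) + \<phi> (h X) = 0" using X by (simp add: h_phi)
  have "bracket \<xi> (h (\<phi> X)) + bracket \<xi> (\<phi> (h X)) = bracket \<xi> 0"
    unfolding z[symmetric] using X by (simp add: bracket_simps)
  then have "bracket \<xi> (h (\<phi> X)) + bracket \<xi> (\<phi> (h X)) = 0"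
    by (simp add: bracket_simps)
  from vfield_eqD[OF this, of p u]
  have "bracket \<xi> (h (\<phi> X)) p u + bracket \<xi> (\<phi> (h X)) p u = 0" by simp
  moreover have "h (\<phi> (bracket \<xi> X)) p u + \<phi> (h (bracket \<xi> X)) p u = 0" using X by (simp add: h_phi)
  ultimately have "k (\<phi> X) p u + \<phi> (k X) p u + 4 * h (h X) p u = 0"
    using X by (simp add: bracket_simps bracket_xi_h bracket_xi_phi h_simps phi_simps)
  moreover have "\<phi> (h (\<phi> X)) = h X" "\<phi> (h (h (\<phi> X))) = - h (h X)"
    using X by (simp_all add: h_phi phi_simps h_simps phi_phi)
  then have "k (\<phi> X) p u = (2 - \<mu>) * h X p u - h (h X) p u + (1 - \<kappa>) * \<phi> (\<phi> X) p u"
    using X by (simp add: k_eq_aux)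
  ultimately have "2 * h (h X) p u + 2 * ((1 - \<kappa>) * \<phi> (\<phi> X) p u) = 0"
    using jacobi_operator[OF X, of p u] by (simp add: algebra_simps)
  then show "h (h X) p u = ((\<kappa> - 1) \<cdot>\<^sub>\<real> \<phi> (\<phi> X)) p u"
    by (simp add: algebra_simps)
qed

lemma k_eq:
  assumes X: "X \<in> vector_fields A"
  shows "k X = (2 - \<mu>) \<cdot>\<^sub>\<real> \<phi> (h X) + (2 * (1 - \<kappa>)) \<cdot>\<^sub>\<real> \<phi> X"
proof (rule vfield_eqI)
  fix p u
  have "\<phi> (h (h X)) = (1 - \<kappa>) \<cdot>\<^sub>\<real> \<phi> X"
    using X phi_phi_phi[OF X] by (auto simp: h_h phi_simps intro!: vfield_eqI) (simp add: algebra_simps)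
  then show "k X p u = ((2 - \<mu>) \<cdot>\<^sub>\<real> \<phi> (h X) + (2 * (1 - \<kappa>)) \<cdot>\<^sub>\<real> \<phi> X) p u"
    using X by (simp add: k_eq_aux algebra_simps)
qed

section \<open>The nullity condition on Ker \<eta> and the second fundamental forms\<close>

lemma curvature_kernel:
  assumes X: "X \<in> vector_fields A" and Y: "Y \<in> vector_fields A"
    and "\<eta> X = (\<lambda>_. 0)" "\<eta> Y = (\<lambda>_. 0)"
  shows "nabla X (nabla Y \<xi>) - nabla Y (nabla X \<xi>) = nabla (bracket X Y) \<xi>"
proof -
  have "curvature nabla X Y \<xi> = 0"
    using assms by (auto simp: curvature_xi intro!: vfield_eqI)
  then show ?thesis by (simp add: curvature_def)
qed

lemma eig_nabla_xi:
  assumes "X \<in> eig r" shows "nabla X \<xi> = (- 1 - r) \<cdot>\<^sub>\<real> \<phi> X"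
  using assms eig_field[OF assms]
  by (auto simp: nabla_xi eig_h phi_simps algebra_simps intro!: vfield_eqI)

lemma metric_nabla_xi:
  assumes "X \<in> eig r" "U \<in> vector_fields A"
  shows "g (nabla U \<xi>) X p = (1 - r) * g U (\<phi> X) p"
proof -
  note f = assms(2) eig_field[OF assms(1)]
  have "g (\<phi> (h U)) X p = - g U (h (\<phi> X)) p"
    using f phi_skew[of "h U" X p] by (simp add: h_sym)
  then show ?thesis
    using f phi_skew[of U X p] by (simp add: nabla_xi metric_simps eig_h[OF eig_phi[OF assms(1)]] algebra_simps)
qed

lemma nabla_metric_zero:
  assumes "X \<in> vector_fields A" "Y \<in> vector_fields A" "Z \<in> vector_fields A" "\<And>p. g Y Z p = 0"
  shows "g (nabla X Y) Z p = - g Y (nabla X Z) p"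
proof -
  have "g Y Z = (\<lambda>_. 0)" using assms(4) by auto
  then show ?thesis using nabla_metric[OF assms(1-3), of p] assms(1) by simp
qed

text \<open>On fields of one eigendistribution this is its second fundamental form: its normal space in \<open>Ker \<eta>\<close>
  is its image under \<open>\<phi>\<close>.\<close>

definition a :: "'a vfield \<Rightarrow> 'a vfield \<Rightarrow> 'a vfield \<Rightarrow> 'a \<Rightarrow> real" where
  "a X Y Z p = g (nabla X Y) (\<phi> Z) p"

lemma a_skew:
  assumes "X \<in> vector_fields A" "Y \<in> eig r" "Z \<in> eig r" "r \<noteq> 0"
  shows "g (nabla X (\<phi> Y)) Z p = - a X Z Y p"
proof -
  have "g (\<phi> Y) Z p = 0" for p
    using eig_legendrian[OF assms(3,2,4)] eig_field[OF assms(2)] eig_field[OF assms(3)]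
    by (simp add: metric_sym[of "\<phi> Y"])
  then show ?thesis
    using nabla_metric_zero[of X "\<phi> Y" Z p] assms(1) eig_field[OF assms(2)] eig_field[OF assms(3)]
    by (simp add: a_def metric_sym[of "\<phi> Y"])
qed

text \<open>Pair R(X, Y)\<xi> = 0 with Z. On D(r) the derivative of \<xi> is - (1 + r) \<phi>, while
  for arbitrary U its inner product with Z in D(r) carries the factor 1 - r, because \<phi> Z lies
  in D(- r).\<close>

lemma a_curvature:
  assumes X: "X \<in> eig r" and Y: "Y \<in> eig r" and Z: "Z \<in> eig r" and r: "r \<noteq> 0"
  shows "(1 + r) * (a X Z Y p - a Y Z X p) = (1 - r) * (a X Y Z p - a Y X Z p)"
proof -
  note f = eig_field[OF X] eig_field[OF Y] eig_field[OF Z]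
  have "nabla X ((- 1 - r) \<cdot>\<^sub>\<real> \<phi> Y) - nabla Y ((- 1 - r) \<cdot>\<^sub>\<real> \<phi> X) = nabla (bracket X Y) \<xi>"
    using curvature_kernel[OF f(1,2) eig_eta[OF X r] eig_eta[OF Y r]]
    by (simp add: eig_nabla_xi[OF X] eig_nabla_xi[OF Y])
  then have "(- 1 - r) * g (nabla X (\<phi> Y)) Z p - (- 1 - r) * g (nabla Y (\<phi> X)) Z p =
      g (nabla (bracket X Y) \<xi>) Z p"
    using f by (simp add: nabla_cmul_right metric_simps flip: metric_left metric_left')
  also have "\<dots> = (1 - r) * (a X Y Z p - a Y X Z p)"
    using f by (simp add: metric_nabla_xi[OF Z] a_def nabla_torsion metric_simps)
  finally show ?thesis
    using f by (simp add: a_skew[OF _ _ Z r] X Y algebra_simps)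
qed

text \<open>Pair R(X, \<phi> V)\<xi> = 0 with \<phi> Z. Besides \<open>a\<close> this involves
  derivatives along \<phi> V, which disappear after symmetrisation.\<close>

lemma a_curvature':
  assumes X: "X \<in> eig r" and V: "V \<in> eig r" and Z: "Z \<in> eig r" and r: "r \<noteq> 0"
  shows "(1 - r) * a X V Z p + (1 + r) * g (nabla (\<phi> V) (\<phi> X)) (\<phi> Z) p =
    (1 + r) * a X Z V p + (1 + r) * g (nabla (\<phi> V) X) Z p"
proof -
  note f = eig_field[OF X] eig_field[OF V] eig_field[OF Z]
  have "nabla (\<phi> V) \<xi> = (1 - r) \<cdot>\<^sub>\<real> V"
    using eig_nabla_xi[OF eig_phi[OF V]] eig_phi_phi[OF V r]
    by (auto simp: algebra_simps intro!: vfield_eqI)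
  then have "nabla X ((1 - r) \<cdot>\<^sub>\<real> V) - nabla (\<phi> V) ((- 1 - r) \<cdot>\<^sub>\<real> \<phi> X) = nabla (bracket X (\<phi> V)) \<xi>"
    using curvature_kernel[OF f(1) phi_field[OF f(2)] eig_eta[OF X r] eta_phi[OF f(2)]]
    by (simp add: eig_nabla_xi[OF X])
  then have e: "(1 - r) \<cdot>\<^sub>\<real> nabla X V - (- 1 - r) \<cdot>\<^sub>\<real> nabla (\<phi> V) (\<phi> X) = nabla (bracket X (\<phi> V)) \<xi>"
    using f by (simp add: nabla_cmul_right)
  have "(1 - r) * a X V Z p - (- 1 - r) * g (nabla (\<phi> V) (\<phi> X)) (\<phi> Z) p =
      g ((1 - r) \<cdot>\<^sub>\<real> nabla X V - (- 1 - r) \<cdot>\<^sub>\<real> nabla (\<phi> V) (\<phi> X)) (\<phi> Z) p"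
    using f by (simp add: metric_simps a_def)
  also have "\<dots> = (1 + r) * g (bracket X (\<phi> V)) (\<phi> (\<phi> Z)) p"
    unfolding e using f metric_nabla_xi[OF eig_phi[OF Z]] by simp
  also have "\<dots> = - (1 + r) * (g (nabla X (\<phi> V)) Z p - g (nabla (\<phi> V) X) Z p)"
    using f by (simp add: eig_phi_phi[OF Z r] metric_simps nabla_torsion algebra_simps)
  finally show ?thesis
    using f by (simp add: a_skew[OF f(1) V Z r] algebra_simps)
qed

text \<open>Add \<open>a_curvature'\<close> for (X, V, Z) and for (Z, V, X). The derivatives along
  \<phi> V combine to those of g(\<phi> X, \<phi> Z) and of g(X, Z), which agree because \<phi> is
  an isometry on Ker \<eta>.\<close>

lemma a_curvature_sym:
  assumes X: "X \<in> eig r" and V: "V \<in> eig r" and Z: "Z \<in> eig r" and r: "r \<noteq> 0"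
  shows "(1 + r) * (a X Z V p + a Z X V p) = (1 - r) * (a X V Z p + a Z V X p)"
proof -
  note f = eig_field[OF X] eig_field[OF V] eig_field[OF Z]
  have "g (\<phi> X) (\<phi> Z) = g X Z"
    using f eig_eta[OF X r] by (auto simp: phi_isometry)
  then have "g (nabla (\<phi> V) (\<phi> X)) (\<phi> Z) p + g (nabla (\<phi> V) (\<phi> Z)) (\<phi> X) p =
      g (nabla (\<phi> V) X) Z p + g (nabla (\<phi> V) Z) X p"
    using f nabla_metric[of "\<phi> V" "\<phi> X" "\<phi> Z" p] nabla_metric[of "\<phi> V" X Z p]
    by (simp add: metric_sym[of "\<phi> X" "nabla _ _"] metric_sym[of X "nabla _ _"])
  then have "(1 + r) * (g (nabla (\<phi> V) (\<phi> X)) (\<phi> Z) p + g (nabla (\<phi> V) (\<phi> Z)) (\<phi> X) p) =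
      (1 + r) * (g (nabla (\<phi> V) X) Z p + g (nabla (\<phi> V) Z) X p)"
    by simp
  then show ?thesis
    using a_curvature'[OF X V Z r, of p] a_curvature'[OF Z V X r, of p] by (simp add: algebra_simps)
qed

text \<open>This is \<open>d(d\<eta>) = 0\<close> on an eigendistribution.\<close>

lemma a_cyclic:
  assumes X: "X \<in> eig r" and Y: "Y \<in> eig r" and Z: "Z \<in> eig r" and r: "r \<noteq> 0"
  shows "a X Y Z p + a Y Z X p + a Z X Y p = a Y X Z p + a X Z Y p + a Z Y X p"
proof -
  note f = eig_field[OF X] eig_field[OF Y] eig_field[OF Z]
  have *: "\<eta> (bracket (bracket U V) W) p = - 2 * (a U V W p - a V U W p)"
    if "U \<in> eig r" "V \<in> eig r" "W \<in> eig r" for U V W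
  proof -
    note f = eig_field[OF that(1)] eig_field[OF that(2)] eig_field[OF that(3)]
    have "\<eta> (bracket (bracket U V) W) p = - 2 * ext_deriv \<eta> (bracket U V) W p"
      using f eig_eta[OF that(3) r] eig_eta_bracket[OF that(1,2) r] by (simp add: ext_deriv_def)
    then show ?thesis using f by (simp add: deta nabla_torsion metric_simps a_def)
  qed
  have "bracket (bracket X Y) Z + bracket (bracket Y Z) X + bracket (bracket Z X) Y = 0"
  proof (rule vfield_eqI)
    fix p u
    have "bracket (bracket Z X) Y = bracket Y (bracket X Z)"
      using f by (simp add: bracket_antisym[of Z X] bracket_uminus_left bracket_antisym[of "bracket X Z" Y])
    moreover have "bracket (bracket Y Z) X p u = - bracket X (bracket Y Z) p u"
      by (subst bracket_antisym) simp
    ultimately show "(bracket (bracket X Y) Z + bracket (bracket Y Z) X + bracket (bracket Z X) Y) p u = 0 p u"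
      using vfield_eqD[OF jacobi[OF f], of p u] by simp
  qed
  then have "\<eta> (bracket (bracket X Y) Z + bracket (bracket Y Z) X + bracket (bracket Z X) Y) p = 0"
    by (simp add: eta_simps)
  then show ?thesis
    using f *[OF X Y Z] *[OF Y Z X] *[OF Z X Y] by (simp add: eta_simps)
qed

text \<open>For one triple the six values of \<open>a\<close> satisfy a homogeneous system: three
  instances of each of the two curvature identities, and the cyclic identity. It is nonsingular
  because 1 + r and 1 - r have different squares.\<close>

lemma a_zero:
  assumes X: "X \<in> eig r" and Y: "Y \<in> eig r" and Z: "Z \<in> eig r" and r: "r \<noteq> 0"
  shows "a X Y Z p = 0"
proof (rule six_permutations_zero)
  show "(1 + r) * (a X Z Y p - a Y Z X p) = (1 - r) * (a X Y Z p - a Y X Z p)"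
    "(1 + r) * (a Y X Z p - a Z X Y p) = (1 - r) * (a Y Z X p - a Z Y X p)"
    "(1 + r) * (a Z Y X p - a X Y Z p) = (1 - r) * (a Z X Y p - a X Z Y p)"
    by (rule a_curvature; fact)+
  show "(1 + r) * (a X Z Y p + a Z X Y p) = (1 - r) * (a X Y Z p + a Z Y X p)"
    "(1 + r) * (a Y X Z p + a X Y Z p) = (1 - r) * (a Y Z X p + a X Z Y p)"
    "(1 + r) * (a Z Y X p + a Y Z X p) = (1 - r) * (a Z X Y p + a Y X Z p)"
    by (rule a_curvature_sym; fact)+
  show "a X Y Z p + a Y Z X p + a Z X Y p = a Y X Z p + a X Z Y p + a Z Y X p"
    by (rule a_cyclic; fact)
  show "(1 + r)\<^sup>2 \<noteq> (1 - r)\<^sup>2"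
    using r by (auto simp: power2_eq_square algebra_simps)
qed

lemma eig_nabla_orth:
  assumes X: "X \<in> eig r" and Y: "Y \<in> eig r" and W: "W \<in> eig (- r)" and r: "r \<noteq> 0"
  shows "g (nabla X Y) W p = 0"
proof -
  have "\<phi> (\<phi> W) = - W" using eig_phi_phi[OF W] r by simp
  then show ?thesis
    using a_zero[OF X Y eig_phi'[OF W] r, of p] eig_field[OF X] eig_field[OF Y] eig_field[OF W]
    by (simp add: a_def metric_simps)
qed

end

section \<open>The Nijenhuis torsion of a contact metric structure\<close>

context contact_metric_structure
begin

text \<open>This is [\<phi>, \<phi>] + 2 d\<eta> \<otimes> \<xi>, with d\<eta>(X, Y) written as g(X,
  \<phi> Y).\<close>

definition nijenhuis :: "'a vfield \<Rightarrow> 'a vfield \<Rightarrow> 'a vfield" where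
  "nijenhuis X Y = bracket (\<phi> X) (\<phi> Y) - \<phi> (bracket (\<phi> X) Y) - \<phi> (bracket X (\<phi> Y)) +
     \<phi> (\<phi> (bracket X Y)) + 2 \<cdot>\<^sub>\<real> (g X (\<phi> Y) \<cdot> \<xi>)"

lemma nijenhuis_antisym:
  assumes "X \<in> vector_fields A" "Y \<in> vector_fields A"
  shows "nijenhuis X Y = - nijenhuis Y X"
proof (rule vfield_eqI)
  fix p u
  have "g X (\<phi> Y) p = - g Y (\<phi> X) p"
    using assms phi_skew[of X Y p] by (simp add: metric_sym[of Y])
  then show "nijenhuis X Y p u = (- nijenhuis Y X) p u"
    using assms
    by (simp add: nijenhuis_def bracket_antisym[of "\<phi> Y" "\<phi> X"] bracket_antisym[of "\<phi> Y" X]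
        bracket_antisym[of Y "\<phi> X"] bracket_antisym[of Y X] phi_simps)
qed

lemma nijenhuis_add_right:
  assumes "X \<in> vector_fields A" "Y \<in> vector_fields A" "Z \<in> vector_fields A"
  shows "nijenhuis X (Y + Z) = nijenhuis X Y + nijenhuis X Z"
  using assms
  by (auto simp: nijenhuis_def bracket_simps phi_simps metric_simps algebra_simps intro!: vfield_eqI)

lemma nijenhuis_add_left:
  assumes "X \<in> vector_fields A" "Y \<in> vector_fields A" "Z \<in> vector_fields A"
  shows "nijenhuis (X + Y) Z = nijenhuis X Z + nijenhuis Y Z"
  using assms by (simp add: nijenhuis_antisym[of _ Z] nijenhuis_add_right)

lemma nijenhuis_fmul_right:
  assumes "X \<in> vector_fields A" "Y \<in> vector_fields A" "f \<in> smooth_functions A"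
  shows "nijenhuis X (f \<cdot> Y) = f \<cdot> nijenhuis X Y"
  using assms
  by (auto simp: nijenhuis_def bracket_fmul_right phi_simps metric_simps algebra_simps intro!: vfield_eqI)

lemma nijenhuis_xi:
  assumes "K_contact A \<eta> \<xi> g \<phi>" and X: "X \<in> vector_fields A"
  shows "nijenhuis X \<xi> = 0"
proof -
  have "bracket (\<phi> X) \<xi> = \<phi> (bracket X \<xi>)"
    using assms by (simp add: K_contact_iff bracket_antisym[of _ \<xi>] phi_simps)
  then show ?thesis
    using X by (auto simp: nijenhuis_def bracket_simps phi_simps metric_simps intro!: vfield_eqI)
qed

text \<open>On Ker \<eta> the torsion behaves like that of an almost complex structure. The
  \<xi>-component that \<phi>^2 leaves behind is \<eta>([\<phi> X, V]) = - 2 g(X, V), and the term 2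
  d\<eta> \<otimes> \<xi> accounts for it.\<close>

lemma nijenhuis_phi:
  assumes X: "X \<in> vector_fields A" and V: "V \<in> vector_fields A"
    and 0: "\<eta> X = (\<lambda>_. 0)" "\<eta> V = (\<lambda>_. 0)"
  shows "nijenhuis X (\<phi> V) = - \<phi> (nijenhuis X V)"
proof (rule vfield_eqI)
  fix p u
  have pp: "\<phi> (\<phi> V) = - V" using V 0 by (simp add: phi_phi)
  have "2 * ext_deriv \<eta> (\<phi> X) V p = - \<eta> (bracket (\<phi> X) V) p"
    using X V 0 by (simp add: ext_deriv_def)
  then have "\<eta> (bracket (\<phi> X) V) p = - 2 * g X V p"
    using X V 0 by (simp add: deta phi_isometry)
  moreover have "\<phi> (\<phi> (bracket (\<phi> X) V)) p u = \<eta> (bracket (\<phi> X) V) p * \<xi> p u - bracket (\<phi> X) V p u"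
    using X V by (simp add: phi_phi)
  moreover have "\<phi> (\<phi> (\<phi> (bracket X V))) = - \<phi> (bracket X V)"
    using X V by (intro phi_phi_phi) simp
  ultimately show "nijenhuis X (\<phi> V) p u = (- \<phi> (nijenhuis X V)) p u"
    using X V pp by (simp add: nijenhuis_def bracket_simps phi_simps metric_simps algebra_simps)
qed

text \<open>\<open>nijenhuis_phi\<close> and antisymmetry carry the vanishing from pairs in S to
  pairs from S and \<phi> S, and \<open>nijenhuis_xi\<close> covers the direction \<xi>. It is meant
  for S the eigenfields of one eigenvalue and for \<open>phibar\<close> in place of \<phi>.\<close>

lemma nijenhuis_zero:
  assumes K: "K_contact A \<eta> \<xi> g \<phi>"
    and S: "\<And>X. X \<in> S \<Longrightarrow> X \<in> vector_fields A \<and> \<eta> X = (\<lambda>_. 0)"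
    and decomp: "\<And>T. T \<in> vector_fields A \<Longrightarrow> \<exists>X\<in>S. \<exists>Y\<in>S. T = X + \<phi> Y + \<eta> T \<cdot> \<xi>"
    and N: "\<And>X Y. X \<in> S \<Longrightarrow> Y \<in> S \<Longrightarrow> nijenhuis X Y = 0"
    and T: "T \<in> vector_fields A" "T' \<in> vector_fields A"
  shows "nijenhuis T T' = 0"
proof -
  have 1: "nijenhuis X (\<phi> Y) = 0" if "X \<in> S" "Y \<in> S" for X Y
    using that S N by (simp add: nijenhuis_phi phi_simps)
  have 2: "nijenhuis (\<phi> X) Y = 0" if "X \<in> S" "Y \<in> S" for X Y
    using that S 1[of Y X] by (simp add: nijenhuis_antisym[of "\<phi> X" Y])
  have 3: "nijenhuis (\<phi> X) (\<phi> Y) = 0" if "X \<in> S" "Y \<in> S" for X Y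
    using that S 2[of X Y] by (simp add: nijenhuis_phi phi_simps)
  have 4: "nijenhuis X (f \<cdot> \<xi>) = 0" if "X \<in> vector_fields A" "f \<in> smooth_functions A" for X f
    using that by (auto simp: nijenhuis_fmul_right nijenhuis_xi[OF K] intro!: vfield_eqI)
  have 5: "nijenhuis (f \<cdot> \<xi>) X = 0" if "X \<in> vector_fields A" "f \<in> smooth_functions A" for X f
    using that 4 by (simp add: nijenhuis_antisym[of _ X])
  obtain X Y where XY: "X \<in> S" "Y \<in> S" "T = X + \<phi> Y + \<eta> T \<cdot> \<xi>" using decomp[OF T(1)] by blast
  obtain X' Y' where XY': "X' \<in> S" "Y' \<in> S" "T' = X' + \<phi> Y' + \<eta> T' \<cdot> \<xi>" using decomp[OF T(2)] by blast
  have "nijenhuis (X + \<phi> Y + \<eta> T \<cdot> \<xi>) (X' + \<phi> Y' + \<eta> T' \<cdot> \<xi>) = 0"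
    using XY(1,2) XY'(1,2) S T by (simp add: nijenhuis_add_left nijenhuis_add_right 1 2 3 4 5 N)
  then show ?thesis using XY(3) XY'(3) by simp
qed

end

section \<open>Projections to the eigendistributions, and their total geodesy\<close>

context kappa_mu_structure
begin

definition lam :: real where "lam = sqrt (1 - \<kappa>)"

lemma lam_pos: "lam > 0" and lam_sq: "lam\<^sup>2 = 1 - \<kappa>"
  using kappa_less_1 by (auto simp: lam_def)

lemma h_h':
  assumes "X \<in> vector_fields A" "r\<^sup>2 = 1 - \<kappa>"
  shows "h (h X) = (r\<^sup>2) \<cdot>\<^sub>\<real> (X - \<eta> X \<cdot> \<xi>)"
  unfolding assms(2) using assms(1) by (auto simp: h_h phi_phi algebra_simps intro!: vfield_eqI)

text \<open>When \<open>r\<^sup>2 = 1 - \<kappa>\<close>, this is \<open>2 r\<close> times the projection to the eigendistribution of \<open>r\<close>.\<close>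

definition eig_part :: "real \<Rightarrow> 'a vfield \<Rightarrow> 'a vfield" where
  "eig_part r T = h T + r \<cdot>\<^sub>\<real> (T - \<eta> T \<cdot> \<xi>)"

lemma eig_part_eig:
  assumes T: "T \<in> vector_fields A" and r: "r\<^sup>2 = 1 - \<kappa>"
  shows "eig_part r T \<in> eig r"
  using T h_h'[OF T r]
  by (auto simp: eig_part_def eig_def h_simps power2_eq_square algebra_simps intro!: vfield_eqI)

text \<open>\<open>eig_part (- r) T\<close> lies in D(- r) for every T, and for Z in Ker \<eta> its
  inner product with Z is g(h Z - r Z, T), because h is symmetric.\<close>

lemma eigI:
  assumes Z: "Z \<in> vector_fields A" "\<eta> Z = (\<lambda>_. 0)" and r: "r\<^sup>2 = 1 - \<kappa>"
    and orth: "\<And>W p. W \<in> eig (- r) \<Longrightarrow> g Z W p = 0"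
  shows "Z \<in> eig r"
proof -
  have "h Z = r \<cdot>\<^sub>\<real> Z"
  proof (rule metric_ext)
    fix T p assume T: "T \<in> vector_fields A"
    have "g Z (eig_part (- r) T) p = 0"
      using eig_part_eig[OF T, of "- r"] r by (intro orth) simp
    then show "g (h Z) T p = g (r \<cdot>\<^sub>\<real> Z) T p"
      using Z T by (simp add: eig_part_def metric_simps metric_xi h_sym)
  qed (use Z in simp_all)
  then show ?thesis using Z by (simp add: eig_def)
qed

lemma eig_zeroI:
  assumes Z: "Z \<in> vector_fields A" "\<eta> Z = (\<lambda>_. 0)"
    and "\<And>W p. W \<in> eig lam \<Longrightarrow> g Z W p = 0" "\<And>W p. W \<in> eig (- lam) \<Longrightarrow> g Z W p = 0"
  shows "Z = 0"
proof -
  have "Z \<in> eig lam" "Z \<in> eig (- lam)"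
    using assms lam_sq by (auto intro!: eigI[OF Z])
  then have "lam \<cdot>\<^sub>\<real> Z = (- lam) \<cdot>\<^sub>\<real> Z" using eig_h by metis
  from vfield_eqD[OF this] show ?thesis using lam_pos by (auto intro!: vfield_eqI)
qed

lemma eig_nonzero: "r\<^sup>2 = 1 - \<kappa> \<Longrightarrow> r \<noteq> 0"
  using kappa_less_1 by auto

text \<open>There is no component in D(- r) by \<open>eig_nabla_orth\<close>, and none along \<xi>
  because the derivative of \<xi> along X is a multiple of \<phi> X, which is orthogonal to
  Y.\<close>

lemma eig_nabla:
  assumes X: "X \<in> eig r" and Y: "Y \<in> eig r" and r: "r\<^sup>2 = 1 - \<kappa>"
  shows "nabla X Y \<in> eig r"
proof (rule eigI[OF _ _ r])
  note f = eig_field[OF X] eig_field[OF Y]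
  note r0 = eig_nonzero[OF r]
  show "\<eta> (nabla X Y) = (\<lambda>_. 0)"
  proof
    fix p
    have "g (nabla X Y) \<xi> p = - g Y (nabla X \<xi>) p"
      using f eig_eta[OF Y r0] by (intro nabla_metric_zero) (simp_all add: metric_xi)
    then show "\<eta> (nabla X Y) p = 0"
      using f eig_legendrian[OF Y X r0, of p] by (simp add: metric_xi eig_nabla_xi[OF X] metric_simps)
  qed
  show "g (nabla X Y) W p = 0" if "W \<in> eig (- r)" for W p
    using eig_nabla_orth[OF X Y that r0] .
qed (use eig_field[OF X] eig_field[OF Y] in simp)

lemma eig_diff: "X \<in> eig r \<Longrightarrow> Y \<in> eig r \<Longrightarrow> X - Y \<in> eig r"
  by (auto simp: eig_def h_simps algebra_simps intro!: vfield_eqI)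

lemma eig_add: "X \<in> eig r \<Longrightarrow> Y \<in> eig r \<Longrightarrow> X + Y \<in> eig r"
  by (auto simp: eig_def h_simps algebra_simps intro!: vfield_eqI)

lemma eig_cmul: "X \<in> eig r \<Longrightarrow> c \<cdot>\<^sub>\<real> X \<in> eig r"
  by (auto simp: eig_def h_simps algebra_simps intro!: vfield_eqI)

lemma eig_bracket:
  assumes "X \<in> eig r" "Y \<in> eig r" "r\<^sup>2 = 1 - \<kappa>"
  shows "bracket X Y \<in> eig r"
  using assms eig_field[OF assms(1)] eig_field[OF assms(2)]
  by (simp add: nabla_torsion eig_diff eig_nabla)

text \<open>The difference is paired with both eigendistributions. Against D(lam) both terms vanish
  because D(- lam) is totally geodesic; against \<phi> Z the claim is \<open>a_curvature'\<close>
  with the terms in \<open>a\<close> gone, divided by 1 + lam.\<close>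

lemma nabla_phi_commute:
  assumes X: "X \<in> eig lam" and V: "V \<in> eig lam"
  shows "nabla (\<phi> V) (\<phi> X) = \<phi> (nabla (\<phi> V) X)"
proof -
  note f = eig_field[OF X] eig_field[OF V]
  have l: "lam \<noteq> 0" "(- lam)\<^sup>2 = 1 - \<kappa>" using lam_pos lam_sq by auto
  have m: "nabla (\<phi> V) (\<phi> X) \<in> eig (- lam)"
    by (intro eig_nabla eig_phi X V l)
  have "nabla (\<phi> V) (\<phi> X) - \<phi> (nabla (\<phi> V) X) = 0"
  proof (rule eig_zeroI)
    show "\<eta> (nabla (\<phi> V) (\<phi> X) - \<phi> (nabla (\<phi> V) X)) = (\<lambda>_. 0)"
      using f l(1) eig_eta[OF m] by (auto simp: eta_simps)
    fix Z p assume Z: "Z \<in> eig lam"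
    note fz = eig_field[OF Z]
    have "g (nabla (\<phi> V) (\<phi> X)) Z p = 0"
      using eig_orth[OF Z m l(1), of p] f fz by (simp add: metric_sym)
    moreover have "g (nabla (\<phi> V) X) (\<phi> Z) p = - g X (nabla (\<phi> V) (\<phi> Z)) p"
      using f fz eig_legendrian[OF X Z l(1)] by (intro nabla_metric_zero) simp_all
    moreover have "nabla (\<phi> V) (\<phi> Z) \<in> eig (- lam)"
      by (intro eig_nabla eig_phi Z V l)
    ultimately show "g (nabla (\<phi> V) (\<phi> X) - \<phi> (nabla (\<phi> V) X)) Z p = 0"
      using f fz eig_orth[OF X _ l(1), of "nabla (\<phi> V) (\<phi> Z)" p] phi_skew[of "nabla (\<phi> V) X" Z p]
      by (simp add: metric_simps)
  next
    fix W p assume W: "W \<in> eig (- lam)"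
    define Z where "Z = - \<phi> W"
    have fw: "W \<in> vector_fields A" using eig_field[OF W] .
    have "\<phi> (\<phi> W) = - W" using eig_phi_phi[OF W] l by simp
    then have WZ: "W = \<phi> Z" using fw by (simp add: Z_def phi_simps)
    have Z: "Z \<in> eig lam"
      using eig_cmul[OF eig_phi'[OF W], of "-1"] by (auto simp: Z_def elim!: back_subst[of "\<lambda>X. X \<in> eig lam"] intro!: vfield_eqI)
    note fz = eig_field[OF Z]
    have "(1 + lam) * g (nabla (\<phi> V) (\<phi> X)) (\<phi> Z) p = (1 + lam) * g (nabla (\<phi> V) X) Z p"
      using a_curvature'[OF X V Z l(1), of p] a_zero[OF X V Z l(1), of p] a_zero[OF X Z V l(1), of p] by simp
    then have "g (nabla (\<phi> V) (\<phi> X)) (\<phi> Z) p = g (nabla (\<phi> V) X) Z p"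
      using lam_pos by simp
    then show "g (nabla (\<phi> V) (\<phi> X) - \<phi> (nabla (\<phi> V) X)) W p = 0"
      using f fz l(1) by (simp add: WZ metric_simps phi_isometry eig_eta[OF Z])
  qed (use f in simp)
  then show ?thesis by simp
qed

text \<open>\<open>phibar\<close> acts on the two eigendistributions by different multiples of
  \<phi>, so the mixed terms of its torsion must be split accordingly. The part \<phi> [X, Y] in D(-
  lam) comes from R(X, Y)\<xi> = 0; the part W consists of the derivatives along \<phi> X and \<phi>
  Y, on which \<phi> commutes with differentiation.\<close>

lemma bracket_phi_split:
  assumes X: "X \<in> eig lam" and Y: "Y \<in> eig lam"
  obtains W where "W \<in> eig lam" "bracket (\<phi> X) Y + bracket X (\<phi> Y) = \<phi> (bracket X Y) + W"
    "\<phi> W = bracket (\<phi> X) (\<phi> Y)"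
proof -
  note f = eig_field[OF X] eig_field[OF Y]
  have l: "lam \<noteq> 0" using lam_pos by simp
  define W where "W = nabla (\<phi> X) Y - nabla (\<phi> Y) X"
  have "nabla X ((- 1 - lam) \<cdot>\<^sub>\<real> \<phi> Y) - nabla Y ((- 1 - lam) \<cdot>\<^sub>\<real> \<phi> X) = (- 1 - lam) \<cdot>\<^sub>\<real> \<phi> (bracket X Y)"
    using curvature_kernel[OF f eig_eta[OF X l] eig_eta[OF Y l]] eig_nabla_xi[OF eig_bracket[OF X Y lam_sq]]
    by (simp add: eig_nabla_xi[OF X] eig_nabla_xi[OF Y])
  then have e: "(- 1 - lam) \<cdot>\<^sub>\<real> nabla X (\<phi> Y) - (- 1 - lam) \<cdot>\<^sub>\<real> nabla Y (\<phi> X) = (- 1 - lam) \<cdot>\<^sub>\<real> \<phi> (bracket X Y)"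
    using f by (simp add: nabla_cmul_right)
  have S: "nabla X (\<phi> Y) - nabla Y (\<phi> X) = \<phi> (bracket X Y)"
  proof (rule vfield_eqI)
    fix p u
    have "(- 1 - lam) * (nabla X (\<phi> Y) p u - nabla Y (\<phi> X) p u) = (- 1 - lam) * \<phi> (bracket X Y) p u"
      using vfield_eqD[OF e, of p u] by (simp add: right_diff_distrib)
    then show "(nabla X (\<phi> Y) - nabla Y (\<phi> X)) p u = \<phi> (bracket X Y) p u"
      using lam_pos by simp
  qed
  have split: "bracket (\<phi> X) Y + bracket X (\<phi> Y) = \<phi> (bracket X Y) + W"
    unfolding S[symmetric] W_def using f by (simp add: nabla_torsion)
  have pW: "\<phi> W = bracket (\<phi> X) (\<phi> Y)"
    using f by (simp add: W_def phi_simps nabla_torsion nabla_phi_commute[OF X Y] nabla_phi_commute[OF Y X])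
  have "W \<in> eig lam"
  proof (rule eigI[OF _ _ lam_sq])
    show "\<eta> W = (\<lambda>_. 0)"
    proof
      fix p
      have "\<eta> (bracket (\<phi> X) Y) p = - 2 * ext_deriv \<eta> (\<phi> X) Y p" "\<eta> (bracket X (\<phi> Y)) p = - 2 * ext_deriv \<eta> X (\<phi> Y) p"
        using f by (simp_all add: ext_deriv_def eig_eta[OF X l] eig_eta[OF Y l])
      moreover have "ext_deriv \<eta> (\<phi> X) Y p = g X Y p" "ext_deriv \<eta> X (\<phi> Y) p = - g X Y p"
        using f by (simp_all add: deta phi_isometry eig_eta[OF X l] eig_phi_phi[OF Y l] metric_simps)
      ultimately have "\<eta> (bracket (\<phi> X) Y + bracket X (\<phi> Y)) p = 0" using f by (simp add: eta_simps)
      then show "\<eta> W p = 0" unfolding split using f by (simp add: eta_simps W_def)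
    qed
    fix U p assume U: "U \<in> eig (- lam)"
    note fu = eig_field[OF U]
    have "g (nabla (\<phi> X) Y) U p = 0" if X: "X \<in> eig lam" and Y: "Y \<in> eig lam" for X Y
    proof -
      note f = eig_field[OF X] eig_field[OF Y]
      have m: "nabla (\<phi> X) U \<in> eig (- lam)"
        using lam_sq by (intro eig_nabla eig_phi X U) simp
      show ?thesis
        using f fu nabla_metric_zero[of "\<phi> X" Y U p] eig_orth[OF Y U l] eig_orth[OF Y m l, of p] by simp
    qed
    from this[OF X Y] this[OF Y X] show "g W U p = 0"
      using f fu by (simp add: W_def metric_simps)
  qed (use f in \<open>simp add: W_def\<close>)
  with split pW show ?thesis using that by blast
qed

lemma eig_decomposition:
  assumes T: "T \<in> vector_fields A"
  obtains X Y where "X \<in> eig lam" "Y \<in> eig (- lam)" "T = X + Y + \<eta> T \<cdot> \<xi>"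
proof
  show "(1 / (2 * lam)) \<cdot>\<^sub>\<real> eig_part lam T \<in> eig lam"
    by (intro eig_cmul eig_part_eig T lam_sq)
  show "(- 1 / (2 * lam)) \<cdot>\<^sub>\<real> eig_part (- lam) T \<in> eig (- lam)"
    using lam_sq by (intro eig_cmul eig_part_eig T) simp
  show "T = (1 / (2 * lam)) \<cdot>\<^sub>\<real> eig_part lam T + (- 1 / (2 * lam)) \<cdot>\<^sub>\<real> eig_part (- lam) T + \<eta> T \<cdot> \<xi>"
    using lam_pos by (auto simp: eig_part_def field_simps intro!: vfield_eqI)
qed

end

section \<open>The canonical structure\<close>

locale kappa_mu_large_index = kappa_mu_structure A \<eta> \<xi> g \<phi> nabla \<kappa> \<mu>
  for A :: "('a, 'e::euclidean_space) atlas" and \<eta> \<xi> g \<phi> nabla \<kappa> \<mu> +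
  assumes large_index: "\<bar>boeckx_index \<kappa> \<mu>\<bar> > 1"
begin

section \<open>The constants of the canonical structure\<close>

definition al :: real where "al = 1 - \<mu> / 2"

definition c :: real where
  "c = \<bar>boeckx_index \<kappa> \<mu>\<bar> / sqrt ((boeckx_index \<kappa> \<mu>)\<^sup>2 - 1)"

definition sc :: "real \<Rightarrow> real" where "sc r = c * (1 + r / al)"

lemma index_eq: "boeckx_index \<kappa> \<mu> = al / lam"
  by (simp add: boeckx_index_def al_def lam_def)

lemma al_large: "\<bar>al\<bar> > lam" "al \<noteq> 0"
proof -
  show "\<bar>al\<bar> > lam" using large_index lam_pos by (simp add: index_eq)
  then show "al \<noteq> 0" using lam_pos by auto
qed

text \<open>In terms of \<open>al\<close> and \<open>lam\<close>, c^2 is al^2 / (al^2 -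
  lam^2).\<close>

lemma c_pos: "c > 0" and c_sq: "c * c * (1 - lam\<^sup>2 / al\<^sup>2) = 1"
proof -
  have "(boeckx_index \<kappa> \<mu>)\<^sup>2 > 1" using large_index by (metis one_less_power power2_abs zero_less_numeral)
  then show "c > 0" using large_index by (auto simp: c_def)
  have "c * c = (boeckx_index \<kappa> \<mu>)\<^sup>2 / ((boeckx_index \<kappa> \<mu>)\<^sup>2 - 1)"
    using \<open>_ > 1\<close> by (simp add: c_def power2_eq_square[symmetric] power_divide)
  also have "\<dots> = al\<^sup>2 / (al\<^sup>2 - lam\<^sup>2)"
    using lam_pos by (simp add: index_eq power_divide divide_simps)
  moreover have "al\<^sup>2 > lam\<^sup>2"
    using al_large lam_pos by (metis abs_of_pos abs_le_square_iff linorder_not_le)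
  ultimately show "c * c * (1 - lam\<^sup>2 / al\<^sup>2) = 1"
    using al_large(2) by (simp add: divide_simps)
qed

lemma lam_al: "\<bar>lam / al\<bar> < 1"
  using al_large lam_pos by (simp add: abs_divide)

lemma sc_pos: "r\<^sup>2 = 1 - \<kappa> \<Longrightarrow> sc r > 0"
proof -
  assume "r\<^sup>2 = 1 - \<kappa>"
  then have "r = lam \<or> r = - lam" using lam_sq by (metis power2_eq_iff)
  then have "\<bar>r / al\<bar> < 1" using lam_al by (auto simp: abs_divide)
  then have "0 < 1 + r / al" by linarith
  then show ?thesis using c_pos by (simp add: sc_def)
qed

lemma sc_inverse:
  assumes "r\<^sup>2 = 1 - \<kappa>" shows "sc r * sc (- r) = 1"
proof -
  have "sc r * sc (- r) = c * c * (1 - r\<^sup>2 / al\<^sup>2)"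
    by (simp add: sc_def algebra_simps power2_eq_square)
  then show ?thesis using c_sq unfolding assms lam_sq by simp
qed

text \<open>One formula for all fields: g - \<eta> \<otimes> \<eta> and h annihilate \<xi>, so the
  factor c affects Ker \<eta> only, and \<eta> \<otimes> \<eta> is added back unscaled.\<close>

definition gbar :: "'a form2" where
  "gbar X Y = (\<lambda>p. c * (g X Y p - \<eta> X p * \<eta> Y p + (1 / al) * g X (h Y) p) + \<eta> X p * \<eta> Y p)"

definition phibar :: "'a endo" where
  "phibar X = c \<cdot>\<^sub>\<real> (\<phi> X + (1 / al) \<cdot>\<^sub>\<real> \<phi> (h X))"

lemma phibar_field [simp]: "X \<in> vector_fields A \<Longrightarrow> phibar X \<in> vector_fields A"
  by (simp add: phibar_def)

lemma phibar_endo: "endo_field A phibar"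
  unfolding endo_field_def
  by (auto simp: phibar_def phi_simps h_simps algebra_simps intro!: vfield_eqI)

lemma gbar_smooth:
  assumes "X \<in> vector_fields A" "Y \<in> vector_fields A"
  shows "gbar X Y \<in> smooth_functions A"
proof -
  have "gbar X Y = (\<lambda>_. c) * (g X Y - \<eta> X * \<eta> Y + (\<lambda>_. 1 / al) * g X (h Y)) + \<eta> X * \<eta> Y"
    by (auto simp: gbar_def)
  then show ?thesis using assms by simp
qed

text \<open>The squared lengths of the two eigencomponents of X are nonnegative; up to positive
  factors they are lam n + g(X, h X) and lam n - g(X, h X), with n the squared length of the
  component of X in Ker \<eta>.\<close>

lemma metric_h_bound:
  assumes X: "X \<in> vector_fields A"
  shows "\<bar>g X (h X) p\<bar> \<le> lam * (g X X p - \<eta> X p * \<eta> X p)"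
proof -
  have *: "g (eig_part r X) (eig_part r X) p = 2 * r * (g X (h X) p + r * (g X X p - \<eta> X p * \<eta> X p))"
    if r: "r\<^sup>2 = 1 - \<kappa>" for r
  proof -
    have "g (h X) (h X) p = r\<^sup>2 * (g X X p - \<eta> X p * \<eta> X p)"
      using X h_sym[of X "h X" p] by (simp add: h_h'[OF X r] metric_simps metric_xi)
    then show ?thesis
      using X h_sym[of X X p] by (simp add: eig_part_def metric_simps metric_xi eta_simps power2_eq_square algebra_simps)
  qed
  have "(- lam)\<^sup>2 = 1 - \<kappa>" using lam_sq by simp
  from *[OF lam_sq] *[OF this] metric_nonneg[of "eig_part lam X" p] metric_nonneg[of "eig_part (- lam) X" p]
  have "0 \<le> 2 * lam * (g X (h X) p + lam * (g X X p - \<eta> X p * \<eta> X p))"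
    "0 \<le> 2 * lam * (- g X (h X) p + lam * (g X X p - \<eta> X p * \<eta> X p))"
    using X by (simp_all add: eig_part_def algebra_simps)
  then show ?thesis using lam_pos by (simp add: zero_le_mult_iff)
qed

lemma gbar_metric: "riemannian_metric A gbar"
  unfolding riemannian_metric_def
proof (intro conjI ballI allI)
  fix X assume X: "X \<in> vector_fields A"
  show "one_form A (gbar X)"
    unfolding one_form_def using X gbar_smooth[OF X]
    by (intro conjI ballI) (auto simp: gbar_def metric_simps h_simps eta_simps algebra_simps)
  fix Y assume Y: "Y \<in> vector_fields A"
  show "gbar X Y = gbar Y X"
    using X Y by (auto simp: gbar_def h_sym metric_sym[of X Y] metric_sym[of "h X" Y])
next
  fix X p assume X: "X \<in> vector_fields A"
  define n where "n = g X X p - \<eta> X p * \<eta> X p"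
  \<comment> \<open>q is 1 / |I_M|. As h / al has norm at most q on Ker \<eta>,
    \<open>gbar X X\<close> is at least c (1 - q) n plus the square of \<eta>(X).\<close>
  define q where "q = lam / \<bar>al\<bar>"
  have q: "q < 1" using lam_al lam_pos by (simp add: q_def)
  have b: "\<bar>g X (h X) p\<bar> \<le> lam * n" using metric_h_bound[OF X, of p] by (simp add: n_def)
  have n: "n \<ge> 0" using b lam_pos abs_ge_zero[of "g X (h X) p"] by (metis order_trans zero_le_mult_iff not_le)
  have "\<bar>(1 / al) * g X (h X) p\<bar> \<le> q * n"
    using b al_large(2) by (simp add: q_def abs_mult divide_simps)
  then have "- (q * n) \<le> (1 / al) * g X (h X) p" by linarith
  then have "(1 - q) * n \<le> n + (1 / al) * g X (h X) p" by (simp add: algebra_simps)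
  then have "c * ((1 - q) * n) \<le> c * (n + (1 / al) * g X (h X) p)"
    using c_pos by (intro mult_left_mono) auto
  then have ge: "c * ((1 - q) * n) + \<eta> X p * \<eta> X p \<le> gbar X X p"
    by (simp add: gbar_def n_def)
  have pos: "0 \<le> c * ((1 - q) * n)" using c_pos q n by simp
  then show "0 \<le> gbar X X p" using ge by (meson add_nonneg_nonneg order_trans zero_le_square)
  show "gbar X X p = 0 \<longleftrightarrow> X p = 0"
  proof
    assume "gbar X X p = 0"
    then have "c * ((1 - q) * n) + \<eta> X p * \<eta> X p = 0"
      using ge pos by (metis add_nonneg_nonneg dual_order.antisym zero_le_square)
    then have "c * ((1 - q) * n) = 0" "\<eta> X p * \<eta> X p = 0"
      using pos by (metis add_nonneg_eq_0_iff zero_le_square)+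
    then have "g X X p = 0" using c_pos q by (simp add: n_def)
    then show "X p = 0" using X metric_zero_iff by blast
  next
    assume "X p = 0"
    then have "g X Z p = 0" if "Z \<in> vector_fields A" for Z
      using metric_pointwise[OF X that] by simp
    moreover from this[of \<xi>] have "\<eta> X p = 0" using X by (simp add: metric_xi)
    ultimately show "gbar X X p = 0" using X by (simp add: gbar_def)
  qed
qed

text \<open>Because h anticommutes with \<phi>, the mixed terms cancel in the square of \<phi> +
  \<phi> h / al, which leaves \<phi>^2 + h^2 / al^2 = (1 - lam^2 / al^2) \<phi>^2.\<close>

lemma phibar_phibar:
  assumes X: "X \<in> vector_fields A"
  shows "phibar (phibar X) = \<eta> X \<cdot> \<xi> - X"
proof (rule vfield_eqI)
  fix p u
  have hh: "h (h X) p u = - lam\<^sup>2 * \<phi> (\<phi> X) p u"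
    using X by (simp add: h_h lam_sq)
  have "\<phi> (h (\<phi> X)) = h X" using X by (simp add: h_phi phi_simps phi_phi)
  moreover have "\<phi> (h (\<phi> (h X))) = h (h X)" using X by (simp add: h_phi phi_simps phi_phi)
  moreover have "\<phi> (\<phi> (h X)) = - h X" using X by (simp add: phi_phi)
  ultimately have "phibar (phibar X) p u = c * c * (\<phi> (\<phi> X) p u + (1 / al)\<^sup>2 * h (h X) p u)"
    using X by (simp add: phibar_def phi_simps h_simps power2_eq_square algebra_simps)
  also have "\<dots> = c * c * (1 - lam\<^sup>2 / al\<^sup>2) * \<phi> (\<phi> X) p u"
    by (simp add: hh algebra_simps power_divide)
  also have "\<dots> = (\<eta> X \<cdot> \<xi> - X) p u"
    using X by (simp only: c_sq phi_phi mult_1)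
  finally show "phibar (phibar X) p u = (\<eta> X \<cdot> \<xi> - X) p u" .
qed

lemma gbar_phibar:
  assumes X: "X \<in> vector_fields A" and Y: "Y \<in> vector_fields A"
  shows "gbar X (phibar Y) = g X (\<phi> Y)"
proof
  fix p
  have "h (\<phi> (h Y)) = (- lam\<^sup>2) \<cdot>\<^sub>\<real> \<phi> Y"
    using Y phi_phi_phi[OF Y] by (auto simp: h_phi h_h phi_simps lam_sq algebra_simps intro!: vfield_eqI)
  moreover have "h (\<phi> Y) = - \<phi> (h Y)" using Y by (rule h_phi)
  ultimately have "gbar X (phibar Y) p = c * c * (1 - lam\<^sup>2 / al\<^sup>2) * g X (\<phi> Y) p"
    using X Y al_large(2)
    by (simp add: gbar_def phibar_def eta_simps h_simps metric_simps algebra_simps power2_eq_square)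
  then show "gbar X (phibar Y) p = g X (\<phi> Y) p" by (simp add: c_sq)
qed

lemma bar_contact_metric: "contact_metric A \<eta> \<xi> gbar phibar"
proof -
  have "gbar \<xi> X = \<eta> X" if "X \<in> vector_fields A" for X
    using that by (auto simp: gbar_def metric_xi)
  then show ?thesis
    using contact_metric unfolding contact_metric_def
    by (simp add: gbar_metric phibar_endo phibar_phibar gbar_phibar)
qed

sublocale bar: contact_metric_structure A \<eta> \<xi> gbar phibar
  by unfold_locales (rule bar_contact_metric)

lemma bar_K_contact: "K_contact A \<eta> \<xi> gbar phibar"
  unfolding bar.K_contact_iff
proof
  fix X assume X: "X \<in> vector_fields A"
  show "bracket \<xi> (phibar X) = phibar (bracket \<xi> X)"
  proof (rule vfield_eqI)
    fix p u
    have "\<phi> (k X) p u = - (2 * al) * h X p u + 2 * (1 - \<kappa>) * \<phi> (\<phi> X) p u"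
      using X by (simp add: k_eq phi_simps phi_phi al_def algebra_simps)
    moreover have "2 * h (h X) p u = - 2 * (1 - \<kappa>) * \<phi> (\<phi> X) p u"
      using X by (simp add: h_h algebra_simps)
    \<comment> \<open>The terms with \<phi>^2 cancel, so that \<phi> k + 2 h^2 = - 2 al h; divided
      by al it cancels the 2 h that comes from L_\<xi> \<phi>.\<close>
    ultimately have "2 * h X p u + (1 / al) * (\<phi> (k X) p u + 2 * h (h X) p u) = 0"
      using al_large(2) by (simp add: field_simps)
    then have z: "c * (2 * h X p u + (1 / al) * (\<phi> (k X) p u + 2 * h (h X) p u)) = 0"
      by simp
    show "bracket \<xi> (phibar X) p u = phibar (bracket \<xi> X) p u"
      using X z by (simp add: phibar_def bracket_simps bracket_xi_phi bracket_xi_h phi_simps algebra_simps)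
  qed
qed

section \<open>The torsion of the canonical structure\<close>

lemma phibar_eig:
  assumes "X \<in> eig r"
  shows "phibar X = sc r \<cdot>\<^sub>\<real> \<phi> X"
  using assms eig_field[OF assms]
  by (auto simp: phibar_def sc_def eig_h phi_simps algebra_simps intro!: vfield_eqI)

text \<open>By \<open>bracket_phi_split\<close> the mixed terms contribute sc lam * sc (- lam) times
  [X, Y] and - (sc lam)^2 times [\<phi> X, \<phi> Y]. The first cancels \<open>phibar\<close>^2
  [X, Y] = - [X, Y] since the two scales have product 1, the second cancels
  [\<open>phibar X\<close>, \<open>phibar Y\<close>].\<close>

lemma bar_nijenhuis_eig:
  assumes X: "X \<in> eig lam" and Y: "Y \<in> eig lam"
  shows "bar.nijenhuis X Y = 0"
proof -
  note f = eig_field[OF X] eig_field[OF Y]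
  have l: "lam \<noteq> 0" using lam_pos by simp
  obtain W where W: "W \<in> eig lam" "bracket (\<phi> X) Y + bracket X (\<phi> Y) = \<phi> (bracket X Y) + W"
    "\<phi> W = bracket (\<phi> X) (\<phi> Y)"
    using bracket_phi_split[OF X Y] by blast
  note fW = eig_field[OF W(1)]
  have b: "bracket X Y \<in> eig lam" by (rule eig_bracket[OF X Y lam_sq])
  have "phibar (bracket (phibar X) Y) + phibar (bracket X (phibar Y)) =
      phibar (sc lam \<cdot>\<^sub>\<real> (bracket (\<phi> X) Y + bracket X (\<phi> Y)))"
    using f by (auto simp: phibar_eig[OF X] phibar_eig[OF Y] bar.phi_simps bracket_cmul_left bracket_cmul_right
        algebra_simps intro!: vfield_eqI)
  also have "\<dots> = sc lam \<cdot>\<^sub>\<real> (phibar (\<phi> (bracket X Y)) + phibar W)"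
    unfolding W(2) using f fW by (simp add: bar.phi_simps)
  also have "phibar (\<phi> (bracket X Y)) = (- sc (- lam)) \<cdot>\<^sub>\<real> bracket X Y"
    using phibar_eig[OF eig_phi[OF b]] eig_phi_phi[OF b l] by (auto intro!: vfield_eqI)
  also have "phibar W = sc lam \<cdot>\<^sub>\<real> bracket (\<phi> X) (\<phi> Y)"
    using phibar_eig[OF W(1)] W(3) by simp
  finally have mix: "phibar (bracket (phibar X) Y) + phibar (bracket X (phibar Y)) =
      sc lam \<cdot>\<^sub>\<real> ((- sc (- lam)) \<cdot>\<^sub>\<real> bracket X Y + sc lam \<cdot>\<^sub>\<real> bracket (\<phi> X) (\<phi> Y))" .
  have "phibar (phibar (bracket X Y)) = - bracket X Y"
    using f eig_eta[OF b l] by (simp add: phibar_phibar)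
  moreover have "gbar X (phibar Y) = (\<lambda>_. 0)"
    using f eig_legendrian[OF X Y l] by (auto simp: gbar_phibar)
  moreover have "bracket (phibar X) (phibar Y) = (sc lam * sc lam) \<cdot>\<^sub>\<real> bracket (\<phi> X) (\<phi> Y)"
    using f by (auto simp: phibar_eig[OF X] phibar_eig[OF Y] bracket_cmul_left bracket_cmul_right intro!: vfield_eqI)
  ultimately show ?thesis
  proof (intro vfield_eqI)
    fix p u
    assume "phibar (phibar (bracket X Y)) = - bracket X Y" "gbar X (phibar Y) = (\<lambda>_. 0)"
      "bracket (phibar X) (phibar Y) = (sc lam * sc lam) \<cdot>\<^sub>\<real> bracket (\<phi> X) (\<phi> Y)"
    moreover have "phibar (bracket (phibar X) Y) p u + phibar (bracket X (phibar Y)) p u =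
        sc lam * (- sc (- lam) * bracket X Y p u + sc lam * bracket (\<phi> X) (\<phi> Y) p u)"
      using vfield_eqD[OF mix, of p u] by simp
    moreover have "\<dots> = - (sc lam * sc (- lam)) * bracket X Y p u + sc lam * (sc lam * bracket (\<phi> X) (\<phi> Y) p u)"
      by (simp add: algebra_simps)
    ultimately show "bar.nijenhuis X Y p u = 0 p u"
      unfolding sc_inverse[OF lam_sq] by (simp add: bar.nijenhuis_def)
  qed
qed

lemma bar_nijenhuis:
  assumes "T \<in> vector_fields A" "T' \<in> vector_fields A"
  shows "bar.nijenhuis T T' = 0"
proof (rule bar.nijenhuis_zero[OF bar_K_contact _ _ bar_nijenhuis_eig assms])
  have l: "lam \<noteq> 0" using lam_pos by simp
  show "X \<in> vector_fields A \<and> \<eta> X = (\<lambda>_. 0)" if "X \<in> eig lam" for X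
    using that eig_field eig_eta l by blast
  fix T assume T: "T \<in> vector_fields A"
  obtain X Y where XY: "X \<in> eig lam" "Y \<in> eig (- lam)" "T = X + Y + \<eta> T \<cdot> \<xi>"
    using eig_decomposition[OF T] .
  have "phibar Y = sc (- lam) \<cdot>\<^sub>\<real> \<phi> Y" by (rule phibar_eig[OF XY(2)])
  then have "(- 1) \<cdot>\<^sub>\<real> phibar Y \<in> eig lam"
    using eig_cmul[OF eig_cmul[OF eig_phi'[OF XY(2)]]] by simp
  moreover have "phibar ((- 1) \<cdot>\<^sub>\<real> phibar Y) = Y"
    using eig_field[OF XY(2)] eig_eta[OF XY(2)] l
    by (auto simp: bar.phi_simps phibar_phibar intro!: vfield_eqI)
  ultimately show "\<exists>X\<in>eig lam. \<exists>Y\<in>eig lam. T = X + phibar Y + \<eta> T \<cdot> \<xi>"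
    using XY by metis
qed

section \<open>Uniqueness of the K-contact structure\<close>

lemma unique_structure:
  assumes K: "K_contact A \<eta> \<xi> g' phi'"
    and orth: "\<And>X Y p. X \<in> eig lam \<Longrightarrow> Y \<in> eig (- lam) \<Longrightarrow> g' X Y p = 0"
  shows "X \<in> vector_fields A \<Longrightarrow> phi' X = phibar X"
    and "X \<in> vector_fields A \<Longrightarrow> Y \<in> vector_fields A \<Longrightarrow> g' X Y = gbar X Y"
proof -
  interpret K: contact_metric_structure A \<eta> \<xi> g' phi'
    using K by unfold_locales (simp add: K_contact_def)
  have l: "lam \<noteq> 0" using lam_pos by simp
  \<comment> \<open>Both structures have the same d\<eta>.\<close>
  have g'_phi': "g' X (phi' Y) = g X (\<phi> Y)" if "X \<in> vector_fields A" "Y \<in> vector_fields A" for X Y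
    using that by (simp flip: deta K.deta)
  have orth': "g' X Y p = 0" if "X \<in> eig r" "Y \<in> eig (- r)" "r\<^sup>2 = 1 - \<kappa>" for X Y p r
  proof -
    have "r = lam \<or> r = - lam" using lam_sq that(3) by (metis power2_eq_iff)
    then show ?thesis
      using that orth[of X Y p] orth[of Y X p] eig_field[OF that(1)] eig_field[OF that(2)]
      by (auto simp: K.metric_sym[of X Y])
  qed
  \<comment> \<open>P is 2 r times the D(r)-component of \<open>phi' X\<close>, and P = 2 r
    \<open>phi' X\<close> + Q with Q in D(- r). So g'(P, P) = 2 r d\<eta>(P, X) + g'(P, Q); the
    first term vanishes because D(r) is Legendrian, the second by the assumed orthogonality.\<close>
  have swap: "phi' X \<in> eig (- r)" if X: "X \<in> eig r" and r: "r\<^sup>2 = 1 - \<kappa>" for X r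
  proof -
    note f = eig_field[OF X]
    have r0: "r \<noteq> 0" by (rule eig_nonzero[OF r])
    define P where "P = eig_part r (phi' X)"
    define Q where "Q = eig_part (- r) (phi' X)"
    have P: "P \<in> eig r" "Q \<in> eig (- r)"
      using f r by (auto simp: P_def Q_def intro!: eig_part_eig)
    note fP = eig_field[OF P(1)] eig_field[OF P(2)]
    have "P = (2 * r) \<cdot>\<^sub>\<real> phi' X + Q"
      using f by (auto simp: P_def Q_def eig_part_def intro!: vfield_eqI)
    then have "g' P P p = g' P ((2 * r) \<cdot>\<^sub>\<real> phi' X + Q) p" for p by simp
    also have "\<dots> p = 0" for p
      using f fP orth'[OF P r] by (simp add: K.metric_simps g'_phi' eig_legendrian[OF P(1) X r0])
    finally have "P = 0" using K.metric_zero_iff[OF fP(1)] by (auto intro!: ext[of P])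
    have "h (phi' X) = (- r) \<cdot>\<^sub>\<real> phi' X"
    proof (rule vfield_eqI)
      fix p u
      show "h (phi' X) p u = ((- r) \<cdot>\<^sub>\<real> phi' X) p u"
        using f vfield_eqD[OF \<open>P = 0\<close>, of p u] by (simp add: P_def eig_part_def)
    qed
    then show ?thesis using f by (simp add: eig_def)
  qed
  have anti: "phi' (h T) = - h (phi' T)" if T: "T \<in> vector_fields A" for T
  proof -
    obtain X Y where XY: "X \<in> eig lam" "Y \<in> eig (- lam)" "T = X + Y + \<eta> T \<cdot> \<xi>"
      using eig_decomposition[OF T] .
    note f = eig_field[OF XY(1)] eig_field[OF XY(2)]
    have "phi' Y \<in> eig lam" using swap[OF XY(2)] lam_sq by simp
    then have "phi' (h (X + Y + \<eta> T \<cdot> \<xi>)) = - h (phi' (X + Y + \<eta> T \<cdot> \<xi>))"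
      using T f eig_h[OF swap[OF XY(1) lam_sq]]
      by (auto simp: K.phi_simps h_simps eig_h[OF XY(1)] eig_h[OF XY(2)] eig_h intro!: vfield_eqI)
    then show ?thesis using XY(3) by simp
  qed
  have lie: "bracket \<xi> (phi' X) = phi' (bracket \<xi> X)" if "X \<in> vector_fields A" for X
    using K that by (simp add: K.K_contact_iff)
  \<comment> \<open>Apply L_\<xi> to \<open>anti\<close>, using that L_\<xi> annihilates
    \<open>phi'\<close>.\<close>
  have k_anti: "k (phi' X) = - phi' (k X)" if X: "X \<in> vector_fields A" for X
  proof -
    have "bracket \<xi> (h (phi' X)) = - phi' (bracket \<xi> (h X))"
      using X anti[OF X] bracket_uminus_right[of \<xi> "phi' (h X)"] lie[of "h X"] by simp
    moreover have "h (phi' (bracket \<xi> X)) = - phi' (h (bracket \<xi> X))"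
      using X anti[of "bracket \<xi> X"] by simp
    ultimately show ?thesis
      using X by (simp add: k_def lie K.phi_simps)
  qed
  have scaled: "phi' X = sc r \<cdot>\<^sub>\<real> \<phi> X" if X: "X \<in> eig r" and r: "r\<^sup>2 = 1 - \<kappa>" for X r
  proof -
    have r0: "r \<noteq> 0" by (rule eig_nonzero[OF r])
    have r': "(- r)\<^sup>2 = 1 - \<kappa>" using r by simp
    define \<psi> where "\<psi> Y = phi' (\<phi> Y)" for Y
    have psi_eig: "\<psi> Y \<in> eig r" if "Y \<in> eig r" for Y
      using swap[OF eig_phi[OF that] r'] by (simp add: \<psi>_def)
    have k_eig: "k Y = (2 * s * (al + s)) \<cdot>\<^sub>\<real> \<phi> Y" if "Y \<in> eig s" "s\<^sup>2 = 1 - \<kappa>" for Y s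
      using eig_field[OF that(1)]
      by (auto simp: k_eq eig_h[OF that(1)] phi_simps al_def that(2)[symmetric] power2_eq_square algebra_simps intro!: vfield_eqI)
    \<comment> \<open>This is \<open>k_anti\<close> on D(r): k is 2 s (al + s) \<phi> on D(s), and
      \<open>phi' Y\<close> lies in D(- r).\<close>
    have star: "(al - r) * \<phi> (phi' Y) p u = (al + r) * \<psi> Y p u" if Y: "Y \<in> eig r" for Y p u
    proof -
      have "(2 * (- r) * (al + - r)) \<cdot>\<^sub>\<real> \<phi> (phi' Y) = - phi' ((2 * r * (al + r)) \<cdot>\<^sub>\<real> \<phi> Y)"
        using k_anti[OF eig_field[OF Y]] k_eig[OF Y r] k_eig[OF swap[OF Y r] r'] by simp
      from vfield_eqD[OF this, of p u] show ?thesis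
        using eig_field[OF Y] r0 by (simp add: K.phi_simps \<psi>_def)
    qed
    \<comment> \<open>Put \<open>\<psi> Y\<close> for Y in \<open>star\<close>: \<phi> phi' phi'
      \<phi> Y = - \<phi> \<phi> Y = Y.\<close>
    have psi_psi: "(al - r) * Y p u = (al + r) * \<psi> (\<psi> Y) p u" if Y: "Y \<in> eig r" for Y p u
    proof -
      have "phi' (\<psi> Y) = - \<phi> Y"
        using eig_field[OF Y] eig_eta[OF eig_phi[OF Y]] r0 by (simp add: \<psi>_def K.phi_phi)
      then have "\<phi> (phi' (\<psi> Y)) = Y"
        using eig_field[OF Y] eig_phi_phi[OF Y r0] by (simp add: phi_simps)
      then show ?thesis using star[OF psi_eig[OF Y], of p u] by simp
    qed
    have s: "sc r > 0" by (rule sc_pos[OF r])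
    have "al + r \<noteq> 0" using al_large lam_sq r by (metis abs_minus_cancel add_eq_0_iff lam_pos less_irrefl power2_eq_iff abs_of_pos)
    then have "sc r * (al - r) = sc (- r) * (al + r)"
      by (simp add: sc_def al_large(2) field_simps)
    then have "sc r * (sc r * (al - r)) = sc r * sc (- r) * (al + r)" by simp
    then have sq: "sc r * sc r * (al - r) = al + r" by (simp add: sc_inverse[OF r])
    have s2: "sc r * sc r * \<psi> (\<psi> Y) p u = Y p u" if "Y \<in> eig r" for Y p u
    proof -
      have "(al + r) * (sc r * sc r * \<psi> (\<psi> Y) p u) = sc r * sc r * ((al + r) * \<psi> (\<psi> Y) p u)"
        by (simp only: mult_ac)
      also have "\<dots> = (sc r * sc r * (al - r)) * Y p u"
        unfolding psi_psi[OF that, symmetric] by (simp only: mult_ac)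
      finally show ?thesis using \<open>al + r \<noteq> 0\<close> by (simp add: sq)
    qed
    \<comment> \<open>Since sc r \<psi> is an involution on D(r), Y is fixed by it. But g'(Y, \<psi>
      Y) = d\<eta>(Y, \<phi> Y) = - g(Y, Y) is never positive, so Y = 0 and \<psi> X = - X / sc
      r.\<close>
    define Y where "Y = X + sc r \<cdot>\<^sub>\<real> \<psi> X"
    have Y: "Y \<in> eig r" by (auto simp: Y_def intro!: eig_add eig_cmul psi_eig X)
    note f = eig_field[OF X] eig_field[OF Y] eig_field[OF psi_eig[OF X]]
    have "sc r \<cdot>\<^sub>\<real> \<psi> Y = Y"
    proof (rule vfield_eqI)
      fix p u
      have "\<psi> Y = \<psi> X + sc r \<cdot>\<^sub>\<real> \<psi> (\<psi> X)"
        unfolding Y_def \<psi>_def using f by (simp add: phi_simps K.phi_simps \<psi>_def)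
      then show "(sc r \<cdot>\<^sub>\<real> \<psi> Y) p u = Y p u"
        using s2[OF X, of p u] by (simp add: Y_def algebra_simps)
    qed
    have "g' Y Y p \<le> 0" for p
    proof -
      have "g' Y Y p = g' Y (sc r \<cdot>\<^sub>\<real> \<psi> Y) p" using \<open>sc r \<cdot>\<^sub>\<real> \<psi> Y = Y\<close> by simp
      also have "\<dots> = - (sc r * g Y Y p)"
        using f eig_phi_phi[OF Y r0] by (simp add: K.metric_simps \<psi>_def g'_phi' metric_simps)
      finally show ?thesis using s metric_nonneg[OF f(2), of p] by simp
    qed
    then have "Y = 0"
      using K.metric_nonneg[OF f(2)] K.metric_zero_iff[OF f(2)] by (metis antisym ext zero_fun_apply)
    then have "phi' (X + sc r \<cdot>\<^sub>\<real> \<psi> X) = 0" by (simp add: Y_def K.phi_simps)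
    then have "phi' X + sc r \<cdot>\<^sub>\<real> phi' (\<psi> X) = 0" using f by (simp add: K.phi_simps)
    moreover have "phi' (\<psi> X) = - \<phi> X"
      using f by (simp add: \<psi>_def K.phi_phi)
    ultimately have e: "phi' X + sc r \<cdot>\<^sub>\<real> (- \<phi> X) = 0" by simp
    show "phi' X = sc r \<cdot>\<^sub>\<real> \<phi> X"
    proof (rule vfield_eqI)
      fix p u
      show "phi' X p u = (sc r \<cdot>\<^sub>\<real> \<phi> X) p u"
        using vfield_eqD[OF e, of p u] by simp
    qed
  qed
  show phi'_eq: "phi' T = phibar T" if T: "T \<in> vector_fields A" for T
  proof -
    obtain X Y where XY: "X \<in> eig lam" "Y \<in> eig (- lam)" "T = X + Y + \<eta> T \<cdot> \<xi>"
      using eig_decomposition[OF T] .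
    note f = eig_field[OF XY(1)] eig_field[OF XY(2)]
    have "phi' (X + Y + \<eta> T \<cdot> \<xi>) = phibar (X + Y + \<eta> T \<cdot> \<xi>)"
      using f T scaled[OF XY(1) lam_sq] scaled[OF XY(2)] lam_sq
      by (simp add: K.phi_simps bar.phi_simps phibar_eig[OF XY(1)] phibar_eig[OF XY(2)])
    then show ?thesis using XY(3) by simp
  qed
  show "g' X Y = gbar X Y" if X: "X \<in> vector_fields A" and Y: "Y \<in> vector_fields A"
  proof
    fix p
    \<comment> \<open>d\<eta> and \<open>phi'\<close> determine g' on the image of
      \<open>phi'\<close>, which is Ker \<eta>; against \<xi> both metrics are \<eta>.\<close>
    have "g' X (phi' (phi' Y)) p = gbar X (phibar (phibar Y)) p"
      using g'_phi'[of X "phi' Y"] gbar_phibar[of X "phibar Y"] phi'_eq[OF Y] X Y by simp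
    then show "g' X Y p = gbar X Y p"
      using X Y by (simp add: K.phi_phi phibar_phibar K.metric_simps bar.metric_simps K.metric_xi bar.metric_xi)
  qed
qed

text \<open>The fields that represent vectors of \<open>eigen_distribution\<close> are eigenvectors
  at p only, so the orthogonality of eigenvectors is derived again at this point, where metrics
  depend on the values of fields alone.\<close>

lemma bar_orthogonal:
  "orthogonal_distributions A gbar (eigen_distribution A h lam) (eigen_distribution A h (- lam))"
  unfolding orthogonal_distributions_def
proof (intro allI ballI impI)
  fix p X Y
  assume X: "X \<in> vector_fields A" and Y: "Y \<in> vector_fields A"
    and "X p \<in> eigen_distribution A h lam p" "Y p \<in> eigen_distribution A h (- lam) p"
  then obtain X' Y' where X': "X' \<in> vector_fields A" "X p = X' p" "h X' p = (lam \<cdot>\<^sub>\<real> X') p"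
    and Y': "Y' \<in> vector_fields A" "Y p = Y' p" "h Y' p = ((- lam) \<cdot>\<^sub>\<real> Y') p"
    by (auto simp: eigen_distribution_def)
  have "g (h X') Y' p = g (lam \<cdot>\<^sub>\<real> X') Y' p" "g X' (h Y') p = g X' ((- lam) \<cdot>\<^sub>\<real> Y') p"
    "g (h X') \<xi> p = g (lam \<cdot>\<^sub>\<real> X') \<xi> p"
    using X' Y' by (auto intro!: metric_cong_point)
  then have "g X' Y' p = 0" "g X' (h Y') p = 0" "\<eta> X' p = 0"
    using X'(1) Y'(1) lam_pos h_sym[of X' Y' p] by (auto simp: metric_simps metric_xi eta_simps)
  then have "gbar X' Y' p = 0" by (simp add: gbar_def)
  then show "gbar X Y p = 0"
    using bar.metric_cong_point[of X X' Y Y' p] X Y X' Y' by simp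
qed

lemma bar_canonical: "canonical_sasakian_structure A \<eta> \<xi> g \<phi> \<kappa> \<mu> gbar phibar"
  unfolding canonical_sasakian_structure_def Let_def
proof (intro conjI ballI impI gbar_metric phibar_endo)
  fix X Y assume XY: "X \<in> vector_fields A" "Y \<in> vector_fields A"
  show "gbar X Y = (\<lambda>p. \<bar>boeckx_index \<kappa> \<mu>\<bar> / sqrt ((boeckx_index \<kappa> \<mu>)\<^sup>2 - 1) *
       (g X Y p + g X ((1 / (1 - \<mu> / 2)) \<cdot>\<^sub>\<real> h Y) p))" if "\<eta> X = (\<lambda>_. 0)" "\<eta> Y = (\<lambda>_. 0)"
    unfolding c_def[symmetric] al_def[symmetric]
    using XY that by (auto simp: gbar_def metric_simps)
  show "ext_deriv \<eta> X Y = gbar X (phibar Y)" using XY by (simp add: gbar_phibar deta)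
next
  fix X assume "X \<in> vector_fields A"
  then show "gbar \<xi> X = \<eta> X" by (rule bar.metric_xi)
qed (rule bar.phi_xi)

end

section \<open>The cone over a contact metric structure\<close>

text \<open>The cone is treated over any contact metric structure; in the theorem it is the one of
  \<open>gbar\<close> and \<open>phibar\<close>.\<close>

locale closed_contact_metric = compact_manifold A + contact_metric_structure A \<eta> \<xi> g \<phi>
  for A :: "('a::{t2_space,second_countable_topology}, 'e::euclidean_space) atlas" and \<eta> \<xi> g \<phi>
begin

abbreviation J :: "('a \<times> real) endo" where "J \<equiv> cone_J A \<eta> \<xi> \<phi>"

lemma M_part_field [simp]:
  assumes Z: "Z \<in> vector_fields A'"
  shows "M_part Z t \<in> vector_fields A"
proof -
  have "(\<lambda>p. M_part Z t p f) \<in> smooth_functions A" if "f \<in> smooth_functions A" for f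
  proof -
    have "deriv_along Z (f \<circ> fst) \<in> smooth_functions A'"
      using Z that by (intro line.deriv_along_smooth) (simp_all add: smooth_fst_iff)
    from smooth_slice[OF this, of t] show ?thesis by (simp add: M_part_def deriv_along_def)
  qed
  then show ?thesis
    using tangent_fst[OF line.field_tangent[OF Z]] by (simp add: vector_fields_def M_part_def)
qed

lemma M_part_simps:
  "M_part (Z + W) t = M_part Z t + M_part W t" "M_part (F \<cdot> Z) t = (\<lambda>p. F (p, t)) \<cdot> M_part Z t"
  by (auto simp: M_part_def intro!: vfield_eqI)

lemma line_part_simps:
  "line_part (Z + W) = line_part Z + line_part W" "line_part (F \<cdot> Z) = F * line_part Z"
  by (auto simp: line_part_def deriv_along_def)

lemma M_part_lift: "X \<in> vector_fields A \<Longrightarrow> M_part (lift X) t = X"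
  using tangent_nonsmooth[OF field_tangent]
  by (intro vfield_eqI) (simp add: M_part_def lift_apply smooth_fst_iff)

lemma line_part_lift: "X \<in> vector_fields A \<Longrightarrow> line_part (lift X) = (\<lambda>_. 0)"
  by (auto simp: line_part_def deriv_along_def lift_apply smooth_snd tangent_const[OF field_tangent])

lemma M_part_dt: "M_part dt t = 0"
  by (auto simp: M_part_def dt_apply line_deriv_def intro!: vfield_eqI)

lemma line_part_dt: "line_part dt = (\<lambda>_. 1)"
  by (auto simp: line_part_def deriv_along_def dt_apply line_deriv_def smooth_snd)

lemma J_apply:
  "J Z (p, t) F = (if F \<in> smooth_functions A' then \<phi> (M_part Z t) p (\<lambda>q. F (q, t)) -
     line_part Z (p, t) * \<xi> p (\<lambda>q. F (q, t)) + \<eta> (M_part Z t) p * line_deriv F (p, t) else 0)"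
  by (simp add: cone_J_def field_pair_def line_deriv_def)

lemma J_add:
  assumes "Z \<in> vector_fields A'" "W \<in> vector_fields A'"
  shows "J (Z + W) = J Z + J W"
proof (rule vfield_eqI)
  fix z F show "J (Z + W) z F = (J Z + J W) z F"
    using assms by (cases z) (simp add: J_apply M_part_simps line_part_simps phi_simps eta_simps algebra_simps)
qed

lemma J_fmul:
  assumes "Z \<in> vector_fields A'" "f \<in> smooth_functions A'"
  shows "J (f \<cdot> Z) = f \<cdot> J Z"
proof (rule vfield_eqI)
  fix z F show "J (f \<cdot> Z) z F = (f \<cdot> J Z) z F"
    using assms smooth_slice[OF assms(2)]
    by (cases z) (simp add: J_apply M_part_simps line_part_simps phi_simps eta_simps algebra_simps)
qed

text \<open>The fields \<open>(X, a \<partial>\<^sub>t)\<close> with \<open>X\<close> and \<open>a\<close> independent of \<open>t\<close>.\<close>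

definition const_pair :: "'a vfield \<Rightarrow> ('a \<Rightarrow> real) \<Rightarrow> ('a \<times> real) vfield" where
  "const_pair X a = lift X + (a \<circ> fst) \<cdot> dt"

lemma const_pair_apply:
  "const_pair X a (p, t) F =
    (if F \<in> smooth_functions A' then X p (\<lambda>q. F (q, t)) + a p * line_deriv F (p, t) else 0)"
  by (simp add: const_pair_def lift_apply dt_apply)

lemma const_pair_field [simp]:
  "X \<in> vector_fields A \<Longrightarrow> a \<in> smooth_functions A \<Longrightarrow> const_pair X a \<in> vector_fields A'"
  by (simp add: const_pair_def smooth_fst_iff)

lemma const_pair_simps:
  "const_pair X a + const_pair Y b = const_pair (X + Y) (a + b)"
  "const_pair X a - const_pair Y b = const_pair (X - Y) (a - b)"
  by (auto simp: const_pair_apply algebra_simps intro!: vfield_eqI)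

lemma lift_eq_const_pair: "lift X = const_pair X 0"
  and dt_eq_const_pair: "dt = const_pair 0 (\<lambda>_. 1)"
  and const_pair_zero: "const_pair 0 0 = 0"
  by (auto simp: const_pair_apply lift_apply dt_apply intro!: vfield_eqI)

lemma J_const_pair:
  assumes X: "X \<in> vector_fields A" and a: "a \<in> smooth_functions A"
  shows "J (const_pair X a) = const_pair (\<phi> X - a \<cdot> \<xi>) (\<eta> X)"
proof (rule vfield_eqI)
  fix z :: "'a \<times> real" and F
  obtain p t where z: "z = (p, t)" by (cases z)
  have "M_part (const_pair X a) t = X"
    using X by (auto simp: const_pair_def M_part_simps M_part_lift M_part_dt intro!: vfield_eqI)
  moreover have "line_part (const_pair X a) (p, t) = a p"
    using X by (simp add: const_pair_def line_part_simps line_part_lift line_part_dt)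
  ultimately show "J (const_pair X a) z F = const_pair (\<phi> X - a \<cdot> \<xi>) (\<eta> X) z F"
    by (simp add: z J_apply const_pair_apply)
qed

lemma J_field [simp]:
  assumes "Z \<in> vector_fields A'"
  shows "J Z \<in> vector_fields A'"
proof (rule field_times_line_induct[OF assms, where P = "\<lambda>Z. J Z \<in> vector_fields A'"])
  have c: "J (const_pair X a) \<in> vector_fields A'"
    if "X \<in> vector_fields A" "a \<in> smooth_functions A" for X a
    unfolding J_const_pair[OF that]
    by (intro const_pair_field field_diff field_fmul phi_field xi_field eta_smooth that)
  show "J (lift X) \<in> vector_fields A'" if "X \<in> vector_fields A" for X
    unfolding lift_eq_const_pair by (rule c[OF that smooth_zero])
  show "J dt \<in> vector_fields A'"
    unfolding dt_eq_const_pair by (rule c[OF field_zero smooth_const])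
next
  fix X Y assume "X \<in> vector_fields A'" "Y \<in> vector_fields A'" "J X \<in> vector_fields A'" "J Y \<in> vector_fields A'"
  then show "J (X + Y) \<in> vector_fields A'" unfolding J_add[OF \<open>X \<in> _\<close> \<open>Y \<in> _\<close>] by (intro line.field_add)
next
  fix f X assume "f \<in> smooth_functions A'" "X \<in> vector_fields A'" "J X \<in> vector_fields A'"
  then show "J (f \<cdot> X) \<in> vector_fields A'" unfolding J_fmul[OF \<open>X \<in> _\<close> \<open>f \<in> _\<close>] by (intro line.field_fmul)
qed

text \<open>By Hadamard's lemma in t, the difference quotients at t of s -> X_p F(., s) are X_p G(.,
  s). This is continuous in s because the lift of X maps G to a smooth function, which gives the
  derivative in Caratheodory's form.\<close>

lemma dt_lift_commute:
  assumes X: "X \<in> vector_fields A" and F: "F \<in> smooth_functions A'"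
  shows "line_deriv (deriv_along (lift X) F) (p, t) = X p (\<lambda>q. line_deriv F (q, t))"
proof -
  obtain G where G: "G \<in> smooth_functions A'" "\<And>p s. F (p, s) - F (p, t) = (s - t) * G (p, s)"
    "\<And>p. G (p, t) = line_deriv F (p, t)" using hadamard_line[OF F] by blast
  have v: "X p \<in> tangent_space A p" by (rule field_tangent[OF X])
  have XF: "deriv_along (lift X) H (p, s) = X p (\<lambda>q. H (q, s))" if "H \<in> smooth_functions A'" for H s
    using that by (simp add: deriv_along_def lift_apply)
  have "((\<lambda>s. X p (\<lambda>q. F (q, s))) has_real_derivative X p (\<lambda>q. G (q, t))) (at t)"
    unfolding CARAT_DERIV
  proof (intro exI conjI allI)
    fix s
    have "(\<lambda>q. F (q, s)) - (\<lambda>q. F (q, t)) = (\<lambda>q. (s - t) * G (q, s))" using G(2) by auto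
    then show "X p (\<lambda>q. F (q, s)) - X p (\<lambda>q. F (q, t)) = X p (\<lambda>q. G (q, s)) * (s - t)"
      using tangent_diff[OF v smooth_slice[OF F, of s] smooth_slice[OF F, of t]]
        tangent_cmult[OF v smooth_slice[OF G(1), of s], of "s - t"] by (simp add: mult.commute)
    have "deriv_along (lift X) G \<in> smooth_functions A'" using X G(1) by simp
    from DERIV_isCont[OF line_deriv_has_derivative[OF this, of p t]]
    show "isCont (\<lambda>s. X p (\<lambda>q. G (q, s))) t" using XF[OF G(1)] by simp
  qed simp
  from DERIV_imp_deriv[OF this] show ?thesis
    using XF[OF F] G(3) by (simp add: line_deriv_def)
qed

text \<open>Lifts have the brackets of the fields on M; \<open>dt\<close> commutes with them and
  annihilates functions pulled back from M.\<close>

lemma bracket_const_pair: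
  assumes X: "X \<in> vector_fields A" and a: "a \<in> smooth_functions A"
    and Y: "Y \<in> vector_fields A" and b: "b \<in> smooth_functions A"
  shows "bracket (const_pair X a) (const_pair Y b) = const_pair (bracket X Y) (D X b - D Y a)"
proof -
  have ll: "bracket (lift U) (lift V) = lift (bracket U V)"
    if "U \<in> vector_fields A" "V \<in> vector_fields A" for U V
  proof (rule vfield_eqI)
    fix z :: "'a \<times> real" and F
    obtain p t where z: "z = (p, t)" by (cases z)
    show "bracket (lift U) (lift V) z F = lift (bracket U V) z F"
    proof (cases "F \<in> smooth_functions A'")
      case True
      then have "deriv_along (lift U) F \<in> smooth_functions A'" "deriv_along (lift V) F \<in> smooth_functions A'"
        using that by simp_all
      then show ?thesis
        using True by (simp add: z bracket_def lift_apply) (simp add: deriv_along_def lift_apply True)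
    next
      case False
      then show ?thesis
        using that line.tangent_nonsmooth[OF line.field_tangent[OF line.field_bracket], of "lift U" "lift V" F z]
        by (simp add: z lift_apply)
    qed
  qed
  have ld: "bracket (lift U) dt = 0" if U: "U \<in> vector_fields A" for U
  proof (rule vfield_eqI)
    fix z :: "'a \<times> real" and F
    obtain p t where z: "z = (p, t)" by (cases z)
    show "bracket (lift U) dt z F = 0 z F"
    proof (cases "F \<in> smooth_functions A'")
      case True
      have "deriv_along dt F = line_deriv F" using True by (auto simp: deriv_along_def dt_apply)
      then show ?thesis
        using True U dt_lift_commute[OF U True, of p t]
        by (simp add: z bracket_def lift_apply dt_apply)
    next
      case False
      then show ?thesis
        using U line.tangent_nonsmooth[OF line.field_tangent[OF line.field_bracket], of "lift U" dt F z] by simp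
    qed
  qed
  have lf: "deriv_along (lift U) (f \<circ> fst) = D U f \<circ> fst" if "f \<in> smooth_functions A" for U f
    using that by (auto simp: deriv_along_def lift_apply smooth_fst_iff)
  have df: "deriv_along dt (f \<circ> fst) = (\<lambda>_. 0)" for f
    by (auto simp: deriv_along_def dt_apply line_deriv_def)
  have dl: "bracket dt (lift U) = 0" if "U \<in> vector_fields A" for U
    using ld[OF that] by (simp add: bracket_antisym[of dt])
  have ab: "a \<circ> fst \<in> smooth_functions A'" "b \<circ> fst \<in> smooth_functions A'"
    using a b by (simp_all add: smooth_fst_iff)
  show ?thesis
  proof (rule vfield_eqI)
    fix z :: "'a \<times> real" and F
    obtain p t where z: "z = (p, t)" by (cases z)
    show "bracket (const_pair X a) (const_pair Y b) z F = const_pair (bracket X Y) (D X b - D Y a) z F"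
      using X Y ab
      by (simp add: const_pair_def line.bracket_add_left line.bracket_add_right line.bracket_fmul_right
          line.bracket_fmul_left line.deriv_along_field_simps ll ld dl lf[OF a] lf[OF b] df z algebra_simps)
  qed
qed

section \<open>The Nijenhuis tensor of J\<close>

definition nijenhuis_J :: "('a \<times> real) vfield \<Rightarrow> ('a \<times> real) vfield \<Rightarrow> ('a \<times> real) vfield" where
  "nijenhuis_J Z W = bracket (J Z) (J W) - J (bracket (J Z) W) - J (bracket Z (J W)) + J (J (bracket Z W))"

lemma J_uminus: "Z \<in> vector_fields A' \<Longrightarrow> J (- Z) = - J Z"
proof -
  assume Z: "Z \<in> vector_fields A'"
  have "- Z = (\<lambda>_. - 1) \<cdot> Z" by (auto intro: vfield_eqI)
  then show ?thesis using J_fmul[OF Z line.smooth_const, of "-1"] by (auto intro!: vfield_eqI)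
qed

lemma nijenhuis_J_antisym:
  assumes "Z \<in> vector_fields A'" "W \<in> vector_fields A'"
  shows "nijenhuis_J Z W = - nijenhuis_J W Z"
  unfolding nijenhuis_J_def
    bracket_antisym[of "J W" "J Z"] bracket_antisym[of "J W" Z] bracket_antisym[of W "J Z"] bracket_antisym[of W Z]
  using assms by (simp add: J_uminus)

lemma nijenhuis_J_add:
  assumes "Z \<in> vector_fields A'" "W \<in> vector_fields A'" "W' \<in> vector_fields A'"
  shows "nijenhuis_J Z (W + W') = nijenhuis_J Z W + nijenhuis_J Z W'"
  using assms by (simp add: nijenhuis_J_def J_add line.bracket_add_right algebra_simps)

lemma nijenhuis_J_fmul:
  assumes "Z \<in> vector_fields A'" "W \<in> vector_fields A'" "f \<in> smooth_functions A'"
  shows "nijenhuis_J Z (f \<cdot> W) = f \<cdot> nijenhuis_J Z W"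
  using assms
  by (auto simp: nijenhuis_J_def J_add J_fmul line.bracket_fmul_right algebra_simps intro!: vfield_eqI)

text \<open>In the M-component the coefficients of \<xi> add up to 2 d\<eta>(X, Y), so that it is
  \<open>nijenhuis X Y\<close>. The line component vanishes because d\<eta>(\<phi> X, Y) = -
  d\<eta>(X, \<phi> Y).\<close>

lemma nijenhuis_J_lift:
  assumes X: "X \<in> vector_fields A" and Y: "Y \<in> vector_fields A" and N: "nijenhuis X Y = 0"
  shows "nijenhuis_J (lift X) (lift Y) = 0"
proof -
  have J: "J (lift Z) = const_pair (\<phi> Z) (\<eta> Z)" if "Z \<in> vector_fields A" for Z
    using that by (auto simp: lift_eq_const_pair J_const_pair const_pair_apply intro!: vfield_eqI)
  have "nijenhuis_J (lift X) (lift Y) =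
    const_pair (bracket (\<phi> X) (\<phi> Y) - (\<phi> (bracket (\<phi> X) Y) - (D (\<phi> X) 0 - D Y (\<eta> X)) \<cdot> \<xi>)
        - (\<phi> (bracket X (\<phi> Y)) - (D X (\<eta> Y) - D (\<phi> Y) 0) \<cdot> \<xi>)
        + (\<phi> (\<phi> (bracket X Y) - (D X 0 - D Y 0) \<cdot> \<xi>) - \<eta> (bracket X Y) \<cdot> \<xi>))
      (D (\<phi> X) (\<eta> Y) - D (\<phi> Y) (\<eta> X) - \<eta> (bracket (\<phi> X) Y) - \<eta> (bracket X (\<phi> Y))
        + \<eta> (\<phi> (bracket X Y) - (D X 0 - D Y 0) \<cdot> \<xi>))" (is "_ = const_pair ?V ?f")
    unfolding nijenhuis_J_def J[OF X] J[OF Y]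
    using X Y by (simp add: lift_eq_const_pair J_const_pair bracket_const_pair const_pair_simps)
  also have "?V = nijenhuis X Y"
  proof (rule vfield_eqI)
    fix p u
    have e: "D X (\<eta> Y) p = 2 * g X (\<phi> Y) p + D Y (\<eta> X) p + \<eta> (bracket X Y) p"
      using X Y by (simp add: ext_deriv_def field_simps flip: deta)
    have 0: "D Z 0 = 0" if "Z \<in> vector_fields A" for Z
      using that deriv_along_const[of Z 0] by (simp add: zero_fun_def)
    show "?V p u = nijenhuis X Y p u"
      using X Y by (simp add: nijenhuis_def phi_simps 0 e algebra_simps)
  qed
  also have "?f = 0"
  proof
    fix p
    have "2 * ext_deriv \<eta> (\<phi> X) Y p = D (\<phi> X) (\<eta> Y) p - \<eta> (bracket (\<phi> X) Y) p"
      "2 * ext_deriv \<eta> X (\<phi> Y) p = - D (\<phi> Y) (\<eta> X) p - \<eta> (bracket X (\<phi> Y)) p"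
      using X Y by (simp_all add: ext_deriv_def)
    moreover have "ext_deriv \<eta> (\<phi> X) Y p = - ext_deriv \<eta> X (\<phi> Y) p"
      using X Y phi_skew[of X "\<phi> Y" p] by (simp add: deta)
    moreover have "D Z 0 = 0" if "Z \<in> vector_fields A" for Z
      using that deriv_along_const[of Z 0] by (simp add: zero_fun_def)
    ultimately show "?f p = 0 p"
      using X Y by (simp add: eta_simps)
  qed
  finally show ?thesis unfolding N const_pair_zero .
qed

text \<open>J maps \<open>dt\<close> to - \<xi>. What remains is [\<xi>, \<phi> X] - \<phi>
  [\<xi>, X] on M, zero by the K-contact condition, and \<xi>(\<eta>(X)) - \<eta>([\<xi>, X]) on the
  line, zero by L_\<xi> \<eta> = 0.\<close>

lemma nijenhuis_J_dt:
  assumes K: "K_contact A \<eta> \<xi> g \<phi>" and X: "X \<in> vector_fields A"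
  shows "nijenhuis_J (lift X) dt = 0"
proof -
  have 0: "D Z 0 = 0" if "Z \<in> vector_fields A" for Z
    using that deriv_along_const[of Z 0] by (simp add: zero_fun_def)
  have 1: "J (lift X) = const_pair (\<phi> X) (\<eta> X)"
    using X by (auto simp: lift_eq_const_pair J_const_pair const_pair_apply intro!: vfield_eqI)
  have 2: "J dt = const_pair (- \<xi>) 0"
    by (auto simp: dt_eq_const_pair J_const_pair const_pair_apply phi_simps eta_simps intro!: vfield_eqI)
  have D0: "D 0 f = 0" "D (- Z) f = - D Z f" for f Z by (auto simp: deriv_along_def)
  have z: "bracket (const_pair (\<phi> X) (\<eta> X)) dt = 0" "bracket (lift X) dt = 0"
    using X by (simp_all add: dt_eq_const_pair lift_eq_const_pair bracket_const_pair bracket_zero_right D0 const_pair_zero)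
  have J0: "J 0 = 0"
    using J_const_pair[of 0 0] by (simp add: const_pair_zero phi_simps eta_simps)
      (auto simp: const_pair_apply intro!: vfield_eqI)
  have "bracket (const_pair (\<phi> X) (\<eta> X)) (const_pair (- \<xi>) 0) = const_pair (bracket \<xi> (\<phi> X)) (D \<xi> (\<eta> X))"
    using X by (auto simp: bracket_const_pair 0 bracket_uminus_right bracket_antisym[of "\<phi> X" \<xi>] D0
        intro!: arg_cong2[of _ _ _ _ const_pair])
  moreover have "J (bracket (lift X) (const_pair (- \<xi>) 0)) = const_pair (\<phi> (bracket \<xi> X)) (\<eta> (bracket \<xi> X))"
    using X by (auto simp: lift_eq_const_pair bracket_const_pair J_const_pair 0 bracket_uminus_right
        bracket_antisym[of X \<xi>] D0 const_pair_apply intro!: arg_cong2[of _ _ _ _ const_pair] vfield_eqI)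
  ultimately have "nijenhuis_J (lift X) dt =
      const_pair (bracket \<xi> (\<phi> X)) (D \<xi> (\<eta> X)) - const_pair (\<phi> (bracket \<xi> X)) (\<eta> (bracket \<xi> X))"
    by (simp add: nijenhuis_J_def 1 2 z J0)
  then show ?thesis
    using K X by (simp add: K_contact_iff eta_bracket_xi)
qed

lemma sasakianI:
  assumes K: "K_contact A \<eta> \<xi> g \<phi>"
    and N: "\<And>X Y. X \<in> vector_fields A \<Longrightarrow> Y \<in> vector_fields A \<Longrightarrow> nijenhuis X Y = 0"
  shows "sasakian A \<eta> \<xi> g \<phi>"
proof -
  have flip: "nijenhuis_J Z W = 0" if "nijenhuis_J W Z = 0" "Z \<in> vector_fields A'" "W \<in> vector_fields A'" for Z W
    using nijenhuis_J_antisym[OF that(2,3)] that(1) by simp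
  \<comment> \<open>Linearity over functions in the second argument reduces it to lifts and
    \<open>dt\<close>; antisymmetry then gives the same reduction in the first.\<close>
  have tensor: "nijenhuis_J Z W = 0"
    if Z: "Z \<in> vector_fields A'" and W: "W \<in> vector_fields A'"
      and "\<And>X. X \<in> vector_fields A \<Longrightarrow> nijenhuis_J Z (lift X) = 0" "nijenhuis_J Z dt = 0" for Z W
  proof (rule field_times_line_induct[OF W, where P = "\<lambda>W. nijenhuis_J Z W = 0"])
    fix X Y assume "X \<in> vector_fields A'" "Y \<in> vector_fields A'" "nijenhuis_J Z X = 0" "nijenhuis_J Z Y = 0"
    then show "nijenhuis_J Z (X + Y) = 0" by (simp only: nijenhuis_J_add[OF Z] add_0)
  next
    fix f X assume "f \<in> smooth_functions A'" "X \<in> vector_fields A'" "nijenhuis_J Z X = 0"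
    then show "nijenhuis_J Z (f \<cdot> X) = 0" by (simp only: nijenhuis_J_fmul[OF Z]) (simp add: vfield_eqI)
  qed (fact that)+
  have dtdt: "nijenhuis_J dt dt = 0"
  proof (rule vfield_eqI)
    fix z F
    show "nijenhuis_J dt dt z F = 0 z F"
      using vfield_eqD[OF nijenhuis_J_antisym[OF dt_field dt_field], of z F] by simp
  qed
  have "nijenhuis_J Z W = 0" if Z: "Z \<in> vector_fields A'" and W: "W \<in> vector_fields A'" for Z W
  proof (rule tensor[OF Z W])
    fix X assume X: "X \<in> vector_fields A"
    have "nijenhuis_J (lift X) Z = 0"
      by (rule tensor[OF lift_field'[OF X] Z]) (simp_all add: X N nijenhuis_J_lift nijenhuis_J_dt[OF K])
    then show "nijenhuis_J Z (lift X) = 0" by (rule flip) (simp_all add: X Z)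
  next
    have "nijenhuis_J dt (lift X) = 0" if "X \<in> vector_fields A" for X
      using flip[OF nijenhuis_J_dt[OF K that]] that by simp
    then have "nijenhuis_J dt Z = 0" using tensor[OF dt_field Z] dtdt by blast
    then show "nijenhuis_J Z dt = 0" by (rule flip) (simp_all add: Z)
  qed
  then show ?thesis
    using K by (simp add: sasakian_def K_contact_def integrable_acs_def nijenhuis_J_def)
qed

end

theorem theorem1p3:
  fixes A :: "('a::{t2_space,second_countable_topology}, 'e::euclidean_space) atlas"
    and \<eta> :: "'a form1" and \<xi> :: "'a vfield" and g :: "'a form2" and \<phi> :: "'a endo"
    and \<kappa> \<mu> lam :: real and h :: "'a endo"
  assumes "closed_manifold A"
    and "kappa_mu_manifold A \<eta> \<xi> g \<phi> \<kappa> \<mu>"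
    and "regular_contact A \<xi>"
    and non_sasakian: "\<kappa> < 1"
    and "\<bar>boeckx_index \<kappa> \<mu>\<bar> > 1"
    and h_def: "h = h_tensor \<xi> \<phi>"
    and lam_def: "lam = sqrt (1 - \<kappa>)"
  shows "\<exists>gbar phibar.
    (K_contact A \<eta> \<xi> gbar phibar \<and>
     orthogonal_distributions A gbar (eigen_distribution A h lam) (eigen_distribution A h (- lam))) \<and>
    (\<forall>g' phi'.
       K_contact A \<eta> \<xi> g' phi' \<and>
       orthogonal_distributions A g' (eigen_distribution A h lam) (eigen_distribution A h (- lam)) \<longrightarrow>
       (\<forall>X\<in>vector_fields A. \<forall>Y\<in>vector_fields A. g' X Y = gbar X Y) \<and>
       (\<forall>X\<in>vector_fields A. phi' X = phibar X)) \<and>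
    canonical_sasakian_structure A \<eta> \<xi> g \<phi> \<kappa> \<mu> gbar phibar \<and>
    sasakian A \<eta> \<xi> gbar phibar"
proof -
  have mfd: "smooth_manifold A" "compact (UNIV :: 'a set)"
    using assms(1) by (simp_all add: closed_manifold_def)
  obtain nabla where nabla: "contact_metric A \<eta> \<xi> g \<phi>" "levi_civita A g nabla"
    "\<And>X Y. X \<in> vector_fields A \<Longrightarrow> Y \<in> vector_fields A \<Longrightarrow> curvature nabla X Y \<xi> =
            \<kappa> \<cdot>\<^sub>\<real> (\<eta> Y \<cdot> X - \<eta> X \<cdot> Y) +
            \<mu> \<cdot>\<^sub>\<real> (\<eta> Y \<cdot> h_tensor \<xi> \<phi> X - \<eta> X \<cdot> h_tensor \<xi> \<phi> Y)"
    using assms(2) unfolding kappa_mu_manifold_def by blast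
  interpret S: kappa_mu_large_index A \<eta> \<xi> g \<phi> nabla \<kappa> \<mu>
    using smooth_manifold_open_atlas[OF mfd(1)] nabla non_sasakian assms(5)
    by (simp add: kappa_mu_large_index_def kappa_mu_large_index_axioms_def kappa_mu_structure_def
        kappa_mu_structure_axioms_def contact_metric_structure_def contact_metric_structure_axioms_def)
  interpret B: closed_contact_metric A \<eta> \<xi> S.gbar S.phibar
    by unfold_locales (use mfd S.bar_contact_metric in simp_all)
  have lam: "lam = S.lam" by (simp add: lam_def S.lam_def)
  \<comment> \<open>Global eigenfields take their values in the eigendistributions, so orthogonality
    of the latter supplies the assumption of \<open>unique_structure\<close>.\<close>
  have eig: "X p \<in> eigen_distribution A h r p" if "X \<in> S.eig r" for X r p
    using that by (auto simp: S.eig_def eigen_distribution_def h_def)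
  have unique: "(\<forall>X\<in>vector_fields A. \<forall>Y\<in>vector_fields A. g' X Y = S.gbar X Y) \<and>
      (\<forall>X\<in>vector_fields A. phi' X = S.phibar X)"
    if K: "K_contact A \<eta> \<xi> g' phi'"
      and o: "orthogonal_distributions A g' (eigen_distribution A h lam) (eigen_distribution A h (- lam))"
    for g' phi'
  proof -
    have "g' X Y p = 0" if "X \<in> S.eig S.lam" "Y \<in> S.eig (- S.lam)" for X Y p
      using o eig[OF that(1)] eig[OF that(2)] S.eig_field[OF that(1)] S.eig_field[OF that(2)]
      by (simp add: orthogonal_distributions_def lam)
    from S.unique_structure[OF K this] show ?thesis by blast
  qed
  have "sasakian A \<eta> \<xi> S.gbar S.phibar"
    by (rule B.sasakianI[OF S.bar_K_contact S.bar_nijenhuis])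
  then show ?thesis
    using S.bar_K_contact S.bar_orthogonal S.bar_canonical unique
    unfolding lam h_def by blast
qed

end
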